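(* Let $(X,\mu)$ be an OU pair with $X\in\{[0,1],S^1\}$. Then $\tau_{ac}$ and $\tau_{co}$ are the only Hausdorff group topologies on $\mathcal{H}_{bac}(X,\mu)$ coarser than (i.e. contained in) $\tau_{ac}$.
   Context: An OU (Oxtoby–Ulam) pair $(X,\mu)$ consists of a compact connected topological manifold $X$ (possibly with boundary $\partial X$) and a finite Borel measure $\mu$ on $X$ with $\mu(U)>0$ for all non-empty open $U\subseteq X$, $\mu(\{x\})=0$ for all $x\in X$, and $\mu(\partial X)=0$. $\mathcal{H}(X)$ is the group of homeomorphisms of $X$, and $\mathcal{H}_{bac}(X,\mu)$ is the subgroup of all $g\in\mathcal{H}(X)$ such that for every Borel set $A$ one has $\mu(A)=0$ iff $\mu(g(A))=0$. For $g\in\mathcal{H}_{bac}(X,\mu)$, $\mathcal{D}(g)\in L^1(X,\mu)$ is the Radon–Nikodym derivative of $A\mapsto\mu(g(A))$ with respect to $\mu$, and $\rho_{ac}(g,h):=\|\mathcal{D}(g)-\mathcal{D}(h)\|_{L^1(X,\mu)}$. $\tau_{co}$ is the restriction to $\mathcal{H}_{bac}(X,\mu)$ of the compact-open topology (uniform convergence), and $\tau_{ac}$ is the topology generated by $\tau_{co}$ together with the topology induced by $\rho_{ac}$. A group topology is a topology for which multiplication and inversion are continuous. *)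

theory Defs
  imports "HOL-Analysis.Analysis" "HOL-Algebra.Bij"
begin

definition half_space :: "nat \<Rightarrow> (nat \<Rightarrow> real) topology" where
  "half_space n = subtopology (Euclidean_space n) {x. x 0 \<ge> 0}"

definition has_chart_at :: "'a topology \<Rightarrow> 'b topology \<Rightarrow> 'a \<Rightarrow> bool" where
  "has_chart_at X E x \<longleftrightarrow>
     (\<exists>U V. openin X U \<and> x \<in> U \<and> openin E V \<and>
            subtopology X U homeomorphic_space subtopology E V)"

definition manifold_with_boundary :: "nat \<Rightarrow> 'a topology \<Rightarrow> bool" where
  "manifold_with_boundary n X \<longleftrightarrow>
     Hausdorff_space X \<and> second_countable X \<and>
     (\<forall>x\<in>topspace X. has_chart_at X (half_space n) x)"

text \<open>The boundary is the complement of the manifold interior, i.e. of the set of points that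
  have a neighbourhood homeomorphic to an open subset of Euclidean space.\<close>

definition manifold_boundary :: "nat \<Rightarrow> 'a topology \<Rightarrow> 'a set" where
  "manifold_boundary n X = {x \<in> topspace X. \<not> has_chart_at X (Euclidean_space n) x}"

definition OU_pair :: "'a topology \<Rightarrow> 'a measure \<Rightarrow> bool" where
  "OU_pair X M \<longleftrightarrow>
     compact_space X \<and> connected_space X \<and>
     finite_measure M \<and> space M = topspace X \<and>
     sets M = sigma_sets (topspace X) {U. openin X U} \<and>
     (\<forall>U. openin X U \<and> U \<noteq> {} \<longrightarrow> emeasure M U > 0) \<and>
     (\<forall>x\<in>topspace X. emeasure M {x} = 0) \<and>
     (\<exists>n. manifold_with_boundary n X \<and> emeasure M (manifold_boundary n X) = 0)"

text \<open>Self-maps of a space are represented by functions that are extensional on its carrier,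
  so that equality of functions is equality of maps; \<^const>\<open>BijGroup\<close> uses the same convention.\<close>

definition homeo :: "'a topology \<Rightarrow> ('a \<Rightarrow> 'a) set" where
  "homeo X = {g \<in> extensional (topspace X). homeomorphic_map X X g}"

definition homeo_bac :: "'a topology \<Rightarrow> 'a measure \<Rightarrow> ('a \<Rightarrow> 'a) set" where
  "homeo_bac X M =
     {g \<in> homeo X. \<forall>A\<in>sets M. emeasure M A = 0 \<longleftrightarrow> emeasure M (g ` A) = 0}"

definition homeo_bac_group :: "'a topology \<Rightarrow> 'a measure \<Rightarrow> ('a \<Rightarrow> 'a) monoid" where
  "homeo_bac_group X M = BijGroup (topspace X) \<lparr>carrier := homeo_bac X M\<rparr>"

definition image_measure :: "'a measure \<Rightarrow> ('a \<Rightarrow> 'a) \<Rightarrow> 'a measure" where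
  "image_measure M g = measure_of (space M) (sets M) (\<lambda>A. emeasure M (g ` A))"

definition homeo_deriv :: "'a measure \<Rightarrow> ('a \<Rightarrow> 'a) \<Rightarrow> 'a \<Rightarrow> real" where
  "homeo_deriv M g x = enn2real (RN_deriv M (image_measure M g) x)"

definition rho_ac :: "'a measure \<Rightarrow> ('a \<Rightarrow> 'a) \<Rightarrow> ('a \<Rightarrow> 'a) \<Rightarrow> real" where
  "rho_ac M g h = (\<integral>x. \<bar>homeo_deriv M g x - homeo_deriv M h x\<bar> \<partial>M)"

definition compact_open_topology :: "'a topology \<Rightarrow> 'b topology \<Rightarrow> ('a \<Rightarrow> 'b) topology" where
  "compact_open_topology X Y =
     topology_generated_by
       {{f \<in> extensional (topspace X). continuous_map X Y f \<and> f ` K \<subseteq> U} | K U.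
          compactin X K \<and> openin Y U}"

definition tau_co :: "'a topology \<Rightarrow> 'a measure \<Rightarrow> ('a \<Rightarrow> 'a) topology" where
  "tau_co X M = subtopology (compact_open_topology X X) (homeo_bac X M)"

text \<open>In general \<^const>\<open>rho_ac\<close> is only a pseudometric (measure-preserving maps all have
  derivative 1), so the library's metric topology does not apply.\<close>

definition tau_rho :: "'a topology \<Rightarrow> 'a measure \<Rightarrow> ('a \<Rightarrow> 'a) topology" where
  "tau_rho X M =
     topology_generated_by
       {{h \<in> homeo_bac X M. rho_ac M g h < e} | g e. g \<in> homeo_bac X M \<and> e > 0}"

definition tau_ac :: "'a topology \<Rightarrow> 'a measure \<Rightarrow> ('a \<Rightarrow> 'a) topology" where
  "tau_ac X M =
     topology_generated_by ({U. openin (tau_co X M) U} \<union> {U. openin (tau_rho X M) U})"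

definition group_topology :: "('g, 'm) monoid_scheme \<Rightarrow> 'g topology \<Rightarrow> bool" where
  "group_topology G T \<longleftrightarrow>
     topspace T = carrier G \<and>
     continuous_map (prod_topology T T) T (\<lambda>(x, y). x \<otimes>\<^bsub>G\<^esub> y) \<and>
     continuous_map T T (\<lambda>x. inv\<^bsub>G\<^esub> x)"

definition coarser_topology :: "'g topology \<Rightarrow> 'g topology \<Rightarrow> bool" where
  "coarser_topology S T \<longleftrightarrow> (\<forall>U. openin S U \<longrightarrow> openin T U)"

definition Hausdorff_group_topologies_below ::
    "('g, 'm) monoid_scheme \<Rightarrow> 'g topology \<Rightarrow> 'g topology set" where
  "Hausdorff_group_topologies_below G T =
     {S. group_topology G S \<and> Hausdorff_space S \<and> coarser_topology S T}"

end

theory Submission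
  imports Defs "HOL-Probability.Distribution_Functions"
begin

text \<open>Write \<open>G\<close> for the group of homeomorphisms that preserve null sets, \<open>D g\<close> for the
  derivative of \<open>g\<close>, and \<open>rho\<close> for the \<open>L\<^sup>1\<close> distance of derivatives.

  The interval and the circle are treated together. Both are images of a segment under a map
  that is injective up to a possible identification of the two ends, and since the measure has
  full support and no atoms, the parameter can be chosen so that the measure becomes Lebesgue
  measure on \<open>{0..m}\<close> (locale \<open>arc_space\<close>, lemma \<open>arc_parametrisation_exists\<close>). Every bi-Lipschitz
  map of \<open>{0..m}\<close> that fixes the ends then induces an element of \<open>G\<close>, and this supplies all the
  explicit group elements of the proof.

  Both topologies come from right-invariant metrics, the uniform distance and the uniform
  distance plus \<open>rho\<close>, for which left translations are continuous; hence they are Hausdorff group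
  topologies. It remains to show that a Hausdorff group topology \<open>S\<close> coarser than \<open>tau_ac\<close> is one of
  the two.

  First, \<open>S\<close> contains \<open>tau_co\<close>. For an arc \<open>J\<close> choose noncommuting \<open>g, h\<close> supported in \<open>J\<close>. As \<open>S\<close> is
  Hausdorff, the conjugate of \<open>g\<close> by any \<open>f\<close> close to the identity still does not commute with \<open>h\<close>,
  so \<open>f J\<close> meets \<open>J\<close>. Doing this for all arcs of a fine grid forces \<open>f\<close> to be uniformly close to the
  identity (lemma \<open>tau_co_coarsest\<close>).

  Secondly, if \<open>rho f 1\<close> tends to 0 along the \<open>S\<close>-neighbourhoods of the identity, then \<open>S\<close> contains
  \<open>tau_ac\<close>. Otherwise every neighbourhood contains maps whose \<open>rho\<close>-distance from the identity is
  bounded below, and the following argument gives \<open>S = tau_co\<close>. Measure the failure of closeness by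
  the Hellinger affinity \<open>hell X f\<close>, the integral of \<open>sqrt (D f)\<close>, which is at most the total mass
  \<open>m\<close>, and let \<open>c\<close> be the limit inferior of \<open>hell X f\<close> as \<open>f\<close> tends to the identity in \<open>S\<close>. Then
  \<open>c < m\<close>. Conjugating with a map that stretches a given arc over almost the whole space shows that
  the affinity over an arc is asymptotically at least the proportional share of \<open>c\<close>; so for a
  nearly optimal \<open>f\<close> it is spread evenly. If \<open>f1\<close> is nearly optimal, and \<open>f2\<close> is nearly optimal,
  evenly spread on a grid fine enough for \<open>D f1\<close>, and uniformly close to the identity on the same
  scale, the chain rule gives an affinity of about \<open>c\<^sup>2 / m\<close> for the product. As products of small
  elements are small, \<open>c \<le> c\<^sup>2 / m\<close>, whence \<open>c = 0\<close> (lemma \<open>hell_arbitrarily_small\<close>).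

  So arbitrarily small \<open>f\<close> are almost singular: \<open>f\<close> carries a set of small measure onto almost the
  whole space. This lets \<open>S\<close> forget derivatives. A map \<open>u\<close> supported on a finite union \<open>U\<close> of grid
  cells that lies essentially inside that large image, and preserving each cell of \<open>U\<close>, is conjugate
  by \<open>f\<close> to a map supported on a set of small measure; this conjugate is close to the identity in
  \<open>tau_ac\<close> whatever the derivative of \<open>u\<close> is, and therefore \<open>u\<close> is small in \<open>S\<close>. Finally every \<open>h\<close>
  uniformly close to the identity is a product of such a \<open>u\<close>, of a map supported on the small
  complement of \<open>U\<close>, and of a map with slope close to 1 that moves the grid points as \<open>h\<close> does
  (lemma \<open>nbhd_contains_co_ball\<close>).\<close>

section \<open>Group topologies\<close>

locale topological_group = group G for G (structure) +
  fixes T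
  assumes group_topology: "group_topology G T"
begin

lemma topspace_T: "topspace T = carrier G"
  using group_topology by (simp add: group_topology_def)

lemma continuous_mult:
  assumes "continuous_map Z T f" "continuous_map Z T g"
  shows "continuous_map Z T (\<lambda>x. f x \<otimes> g x)"
proof -
  have "continuous_map Z T ((\<lambda>(x, y). x \<otimes> y) \<circ> (\<lambda>x. (f x, g x)))"
    using assms group_topology
    by (intro continuous_map_compose[of _ "prod_topology T T"])
       (auto simp: group_topology_def continuous_map_pairedI)
  then show ?thesis by (simp add: o_def)
qed

lemma continuous_inv:
  assumes "continuous_map Z T f"
  shows "continuous_map Z T (\<lambda>x. inv (f x))"
  using continuous_map_compose[OF assms, of T "\<lambda>x. inv x"] group_topology
  by (auto simp: group_topology_def o_def)

lemma continuous_const: "a \<in> carrier G \<Longrightarrow> continuous_map Z T (\<lambda>x. a)"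
  by (simp add: topspace_T)

definition nbhd :: "'a set \<Rightarrow> bool" where
  "nbhd V \<longleftrightarrow> openin T V \<and> \<one> \<in> V"

lemma nbhd_subset: "nbhd V \<Longrightarrow> V \<subseteq> carrier G"
  using openin_subset topspace_T unfolding nbhd_def by metis

lemma nbhd_one: "nbhd V \<Longrightarrow> \<one> \<in> V"
  by (simp add: nbhd_def)

lemma nbhd_Int: "nbhd V \<Longrightarrow> nbhd W \<Longrightarrow> nbhd (V \<inter> W)"
  by (auto simp: nbhd_def)

lemma nbhd_carrier: "nbhd (carrier G)"
  by (metis nbhd_def one_closed openin_topspace topspace_T)

lemma nbhd_INT: "finite I \<Longrightarrow> (\<And>i. i \<in> I \<Longrightarrow> nbhd (V i)) \<Longrightarrow> \<exists>W. nbhd W \<and> (\<forall>i\<in>I. W \<subseteq> V i)"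
proof (induction I rule: finite_induct)
  case empty
  then show ?case using nbhd_carrier by auto
next
  case (insert i I)
  then obtain W where "nbhd W" "\<forall>i\<in>I. W \<subseteq> V i" by auto
  with insert.prems[of i] show ?case
    by (intro exI[of _ "V i \<inter> W"]) (auto intro: nbhd_Int)
qed

lemma nbhd_preimage:
  assumes "continuous_map T T f" "f \<one> = \<one>" "nbhd V"
  shows "\<exists>W. nbhd W \<and> (\<forall>x\<in>W. f x \<in> V)"
  using assms openin_continuous_map_preimage[OF assms(1), of V]
  by (intro exI[of _ "{x \<in> topspace T. f x \<in> V}"]) (auto simp: nbhd_def topspace_T)

lemma nbhd_mult:
  assumes "nbhd V"
  shows "\<exists>W. nbhd W \<and> (\<forall>x\<in>W. \<forall>y\<in>W. x \<otimes> y \<in> V)"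
proof -
  let ?P = "{z \<in> topspace (prod_topology T T). (\<lambda>(x, y). x \<otimes> y) z \<in> V}"
  have "openin (prod_topology T T) ?P"
    using assms group_topology
    by (intro openin_continuous_map_preimage) (auto simp: group_topology_def nbhd_def)
  moreover have "(\<one>, \<one>) \<in> ?P"
    using assms by (auto simp: topspace_T nbhd_def)
  ultimately obtain A B where "openin T A" "openin T B" "\<one> \<in> A" "\<one> \<in> B" "A \<times> B \<subseteq> ?P"
    unfolding openin_prod_topology_alt by meson
  then show ?thesis
    by (intro exI[of _ "A \<inter> B"]) (auto simp: nbhd_def)
qed

lemma nbhd_inv: "nbhd V \<Longrightarrow> \<exists>W. nbhd W \<and> (\<forall>x\<in>W. inv x \<in> V)"
  by (rule nbhd_preimage) (use group_topology in \<open>auto simp: group_topology_def\<close>)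

lemma nbhd_conj:
  assumes "nbhd V" "a \<in> carrier G"
  shows "\<exists>W. nbhd W \<and> (\<forall>x\<in>W. a \<otimes> x \<otimes> inv a \<in> V)"
  by (rule nbhd_preimage[OF _ _ assms(1)])
     (use assms(2) in \<open>auto intro!: continuous_mult continuous_const simp del: continuous_map_const\<close>)

text \<open>Right translations are homeomorphisms, so a group topology is determined by its neighbourhoods
  of the identity. All comparisons of topologies are made through this characterisation.\<close>

lemma openin_iff_nbhd:
  "openin T U \<longleftrightarrow> U \<subseteq> carrier G \<and> (\<forall>g\<in>U. \<exists>V. nbhd V \<and> (\<forall>v\<in>V. v \<otimes> g \<in> U))"
proof (intro iffI conjI ballI)
  assume U: "openin T U"
  then show "U \<subseteq> carrier G" using openin_subset topspace_T by metis
  fix g assume g: "g \<in> U"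
  then have "g \<in> carrier G" using \<open>U \<subseteq> carrier G\<close> by auto
  then have "continuous_map T T (\<lambda>x. x \<otimes> g)"
    by (intro continuous_mult continuous_const) auto
  from openin_continuous_map_preimage[OF this U]
  show "\<exists>V. nbhd V \<and> (\<forall>v\<in>V. v \<otimes> g \<in> U)"
    using g \<open>g \<in> carrier G\<close>
    by (intro exI[of _ "{x \<in> topspace T. x \<otimes> g \<in> U}"]) (auto simp: nbhd_def topspace_T)
next
  assume R: "U \<subseteq> carrier G \<and> (\<forall>g\<in>U. \<exists>V. nbhd V \<and> (\<forall>v\<in>V. v \<otimes> g \<in> U))"
  show "openin T U"
  proof (subst openin_subopen, intro ballI)
    fix g assume g: "g \<in> U"
    then have gc: "g \<in> carrier G" using R by auto
    obtain V where V: "nbhd V" "\<forall>v\<in>V. v \<otimes> g \<in> U" using R g by blast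
    have "continuous_map T T (\<lambda>x. x \<otimes> inv g)"
      using gc by (intro continuous_mult continuous_const) auto
    from openin_continuous_map_preimage[OF this, of V] V(1)
    have "openin T {x \<in> carrier G. x \<otimes> inv g \<in> V}" by (simp add: nbhd_def topspace_T)
    moreover have "x \<in> U" if "x \<in> carrier G" "x \<otimes> inv g \<in> V" for x
    proof -
      have "x \<otimes> inv g \<otimes> g \<in> U" using V that by auto
      then show ?thesis using that gc by (simp add: m_assoc)
    qed
    ultimately show "\<exists>A. openin T A \<and> g \<in> A \<and> A \<subseteq> U"
      using gc V(1) by (intro exI[of _ "{x \<in> carrier G. x \<otimes> inv g \<in> V}"]) (auto simp: nbhd_def)
  qed
qed

text \<open>In a Hausdorff group the \<open>f\<close> whose conjugate of \<open>g\<close> commutes with \<open>h\<close> form a closed set, and the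
  identity is not among them.\<close>

lemma nbhd_noncommuting:
  assumes "Hausdorff_space T" "g \<in> carrier G" "h \<in> carrier G" "g \<otimes> h \<noteq> h \<otimes> g"
  shows "\<exists>V. nbhd V \<and> (\<forall>f\<in>V. (f \<otimes> g \<otimes> inv f) \<otimes> h \<noteq> h \<otimes> (f \<otimes> g \<otimes> inv f))"
proof -
  let ?C = "{f \<in> topspace T. (f \<otimes> g \<otimes> inv f) \<otimes> h = h \<otimes> (f \<otimes> g \<otimes> inv f)}"
  have "closedin T ?C"
    using assms
    by (intro closedin_continuous_maps_eq[OF assms(1)] continuous_mult continuous_inv continuous_const) auto
  then have "openin T (topspace T - ?C)" by blast
  then show ?thesis
    using assms by (intro exI[of _ "topspace T - ?C"]) (auto simp: nbhd_def topspace_T)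
qed

end

lemma topological_group_coarser:
  assumes "topological_group G S" "topological_group G T"
    and "\<And>V. topological_group.nbhd G S V \<Longrightarrow> \<exists>W. topological_group.nbhd G T W \<and> W \<subseteq> V"
  shows "coarser_topology S T"
  unfolding coarser_topology_def topological_group.openin_iff_nbhd[OF assms(1)]
    topological_group.openin_iff_nbhd[OF assms(2)]
  using assms(3) by (meson subsetD)

lemma coarser_topology_antisym:
  "coarser_topology S T \<Longrightarrow> coarser_topology T S \<Longrightarrow> S = T"
  by (auto simp: coarser_topology_def topology_eq)

text \<open>Right invariance makes right translations isometries and gives \<open>d (inv x) (inv y) = d (inv y \<otimes> x) \<one>\<close>
  up to symmetry. Hence both group operations are continuous as soon as left translations are
  continuous at the identity.\<close>

lemma right_invariant_metric_group_topology:
  fixes G (structure)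
  assumes "group G" and "Metric_space (carrier G) d"
    and inva: "\<And>x y z. \<lbrakk>x \<in> carrier G; y \<in> carrier G; z \<in> carrier G\<rbrakk> \<Longrightarrow> d (x \<otimes> z) (y \<otimes> z) = d x y"
    and left: "\<And>a e. \<lbrakk>a \<in> carrier G; e > 0\<rbrakk> \<Longrightarrow> \<exists>\<delta>>0. \<forall>x\<in>carrier G. d x \<one> < \<delta> \<longrightarrow> d (a \<otimes> x) a < e"
  shows "group_topology G (Metric_space.mtopology (carrier G) d)"
proof -
  interpret group G by fact
  interpret Metric_space "carrier G" d by fact
  have left': "\<exists>\<delta>>0. \<forall>x\<in>carrier G. d x h < \<delta> \<longrightarrow> d (a \<otimes> x) (a \<otimes> h) < e"
    if ahe: "a \<in> carrier G" "h \<in> carrier G" "e > 0" for a h e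
  proof -
    obtain \<delta> where \<delta>: "\<delta> > 0" "\<forall>x\<in>carrier G. d x \<one> < \<delta> \<longrightarrow> d (a \<otimes> x) a < e"
      using left[OF ahe(1,3)] by blast
    have "d (a \<otimes> x) (a \<otimes> h) < e" if x: "x \<in> carrier G" "d x h < \<delta>" for x
    proof -
      have "d (x \<otimes> inv h) \<one> = d x h"
        using inva[of "x \<otimes> inv h" \<one> h] x(1) ahe(2) by (simp add: m_assoc)
      then have "d (a \<otimes> (x \<otimes> inv h)) a < e"
        using \<delta>(2)[rule_format, of "x \<otimes> inv h"] x ahe(2) by simp
      moreover have "a \<otimes> (x \<otimes> inv h) \<otimes> h = a \<otimes> x"
        using x(1) ahe(1,2) by (simp add: m_assoc)
      ultimately show ?thesis
        using inva[of "a \<otimes> (x \<otimes> inv h)" a h] x(1) ahe(1,2) by simp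
    qed
    with \<delta>(1) show ?thesis by blast
  qed
  have open_iff: "openin mtopology U \<longleftrightarrow> U \<subseteq> carrier G \<and>
      (\<forall>x\<in>U. \<exists>r>0. \<forall>y\<in>carrier G. d y x < r \<longrightarrow> y \<in> U)" for U
  proof -
    have "mball x r \<subseteq> U \<longleftrightarrow> (\<forall>y\<in>carrier G. d y x < r \<longrightarrow> y \<in> U)" if "x \<in> U" "U \<subseteq> carrier G" for x r
      using that by (auto simp: commute subset_iff)
    then show ?thesis by (auto simp: openin_mtopology)
  qed
  show ?thesis
    unfolding group_topology_def
  proof (intro conjI)
    show "topspace mtopology = carrier G" by simp
    show "continuous_map mtopology mtopology (\<lambda>x. inv x)"
      unfolding continuous_map_def
    proof (intro conjI allI impI)
      show "(\<lambda>x. inv x) \<in> topspace mtopology \<rightarrow> topspace mtopology" by auto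
      fix U assume U: "openin mtopology U"
      have "\<exists>r>0. \<forall>y\<in>carrier G. d y x < r \<longrightarrow> inv y \<in> U" if x: "x \<in> carrier G" "inv x \<in> U" for x
      proof -
        obtain e where e: "e > 0" "\<forall>y\<in>carrier G. d y (inv x) < e \<longrightarrow> y \<in> U"
          using U x unfolding open_iff by blast
        obtain \<delta> where \<delta>: "\<delta> > 0" "\<forall>y\<in>carrier G. d y x < \<delta> \<longrightarrow> d (inv x \<otimes> y) (inv x \<otimes> x) < e"
          using left'[of "inv x" x e] e x by auto
        have "inv y \<in> U" if y: "y \<in> carrier G" "d y x < \<delta>" for y
        proof -
          have "d (inv y) (inv x) = d (inv x \<otimes> y) \<one>"
            using inva[of "inv x" "inv y" y] x y by (simp add: m_assoc commute)
          then show ?thesis using \<delta> y e x by auto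
        qed
        then show ?thesis using \<delta> by blast
      qed
      then show "openin mtopology {x \<in> topspace mtopology. inv x \<in> U}"
        unfolding open_iff by auto
    qed
    show "continuous_map (prod_topology mtopology mtopology) mtopology (\<lambda>(x, y). x \<otimes> y)"
      unfolding continuous_map_def
    proof (intro conjI allI impI)
      show "(\<lambda>(x, y). x \<otimes> y) \<in> topspace (prod_topology mtopology mtopology) \<rightarrow> topspace mtopology" by auto
      fix U assume U: "openin mtopology U"
      have "\<exists>r>0. \<forall>u\<in>carrier G. \<forall>v\<in>carrier G. d u x < r \<longrightarrow> d v y < r \<longrightarrow> u \<otimes> v \<in> U"
        if x: "x \<in> carrier G" "y \<in> carrier G" "x \<otimes> y \<in> U" for x y
      proof -
        obtain e where e: "e > 0" "\<forall>z\<in>carrier G. d z (x \<otimes> y) < e \<longrightarrow> z \<in> U"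
          using U x unfolding open_iff by blast
        obtain \<delta> where \<delta>: "\<delta> > 0" "\<forall>v\<in>carrier G. d v y < \<delta> \<longrightarrow> d (x \<otimes> v) (x \<otimes> y) < e/2"
          using left'[of x y "e/2"] e x by auto
        have "u \<otimes> v \<in> U" if y: "u \<in> carrier G" "v \<in> carrier G" "d u x < min \<delta> (e/2)" "d v y < min \<delta> (e/2)" for u v
        proof -
          have "d (u \<otimes> v) (x \<otimes> y) \<le> d (u \<otimes> v) (x \<otimes> v) + d (x \<otimes> v) (x \<otimes> y)"
            using x y by (intro triangle) auto
          also have "d (u \<otimes> v) (x \<otimes> v) = d u x" using inva x y by auto
          also have "d u x + d (x \<otimes> v) (x \<otimes> y) < e/2 + e/2"
            using \<delta> y by (intro add_strict_mono) auto
          finally show ?thesis using e x y by auto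
        qed
        then show ?thesis using \<delta> e by (intro exI[of _ "min \<delta> (e/2)"]) auto
      qed
      then show "openin (prod_topology mtopology mtopology)
          {x \<in> topspace (prod_topology mtopology mtopology). (\<lambda>(x, y). x \<otimes> y) x \<in> U}"
        unfolding openin_prod_topology_alt
      proof (intro allI impI, clarsimp, goal_cases)
        case (1 x y)
        then obtain r where r: "r > 0" "\<forall>u\<in>carrier G. \<forall>v\<in>carrier G. d u x < r \<longrightarrow> d v y < r \<longrightarrow> u \<otimes> v \<in> U"
          by metis
        then show ?case using 1
          by (intro exI[of _ "mball x r"] conjI exI[of _ "mball y r"] openin_mball) (auto simp: commute)
      qed
    qed
  qed
qed

section \<open>Nonsingular homeomorphisms of a compact measure space\<close>

text \<open>The part of the argument that concerns derivatives and the two metrics uses only a finite Borel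
  measure on a compact subset of a Euclidean space.\<close>

locale compact_measure =
  fixes X :: "'a::euclidean_space set" and M :: "'a measure"
  assumes compact: "compact X" and nonempty: "X \<noteq> {}"
    and sets_M: "sets M = sets (restrict_space borel X)"
    and finite_M: "finite_measure M"
begin

sublocale finite_measure M by (rule finite_M)

abbreviation G :: "('a \<Rightarrow> 'a) set" where "G \<equiv> homeo_bac (top_of_set X) M"

abbreviation GG :: "('a \<Rightarrow> 'a) monoid" where "GG \<equiv> homeo_bac_group (top_of_set X) M"

abbreviation mul (infixl "\<odot>" 70) where "g \<odot> h \<equiv> g \<otimes>\<^bsub>GG\<^esub> h"

abbreviation ginv where "ginv g \<equiv> inv\<^bsub>GG\<^esub> g"

abbreviation one where "one \<equiv> \<one>\<^bsub>GG\<^esub>"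

lemma space_M: "space M = X"
  using sets_eq_imp_space_eq[OF sets_M] by (simp add: space_restrict_space)

lemma sets_M_iff: "A \<in> sets M \<longleftrightarrow> A \<subseteq> X \<and> A \<in> sets borel"
  using compact by (simp add: sets_M sets_restrict_space_iff borel_compact conj_commute)

lemma measurable_on_M: "f \<in> measurable M N \<longleftrightarrow> f \<in> measurable (restrict_space borel X) N"
  by (intro arg_cong[where f="\<lambda>A. f \<in> A"] measurable_cong_sets) (auto simp: sets_M)

lemma continuous_measurable:
  fixes f :: "'a \<Rightarrow> 'b::topological_space"
  shows "continuous_on X f \<Longrightarrow> f \<in> borel_measurable M"
  unfolding measurable_on_M by (rule borel_measurable_continuous_on_restrict)

lemma continuous_self_measurable:
  assumes "continuous_on X f" "f \<in> X \<rightarrow> X"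
  shows "f \<in> measurable M M"
proof -
  have "f \<in> measurable M (restrict_space borel X)"
    using continuous_measurable[OF assms(1)] assms(2)
    by (intro measurable_restrict_space2) (auto simp: space_M)
  then show ?thesis
    using measurable_cong_sets[OF refl sets_M] by blast
qed

lemma G_iff: "g \<in> G \<longleftrightarrow> g \<in> extensional X \<and> bij_betw g X X \<and> continuous_on X g \<and>
    (\<forall>A\<in>sets M. emeasure M A = 0 \<longleftrightarrow> emeasure M (g ` A) = 0)"
proof -
  have "homeomorphic_map (top_of_set X) (top_of_set X) g \<longleftrightarrow> bij_betw g X X \<and> continuous_on X g"
  proof
    assume h: "homeomorphic_map (top_of_set X) (top_of_set X) g"
    then show "bij_betw g X X \<and> continuous_on X g"
      using homeomorphic_imp_injective_map[OF h] homeomorphic_imp_surjective_map[OF h]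
        homeomorphic_imp_continuous_map[OF h]
      by (simp add: bij_betw_def)
  next
    assume "bij_betw g X X \<and> continuous_on X g"
    then show "homeomorphic_map (top_of_set X) (top_of_set X) g"
      using compact
      by (intro continuous_imp_homeomorphic_map)
         (auto simp: bij_betw_def compact_space_subtopology Hausdorff_space_subtopology
           Hausdorff_space_euclidean)
  qed
  then show ?thesis by (auto simp: homeo_bac_def homeo_def)
qed

lemma G_bij: "g \<in> G \<Longrightarrow> bij_betw g X X" and G_continuous: "g \<in> G \<Longrightarrow> continuous_on X g"
  and G_extensional: "g \<in> G \<Longrightarrow> g \<in> extensional X"
  by (auto simp: G_iff)

lemma G_in: "g \<in> G \<Longrightarrow> x \<in> X \<Longrightarrow> g x \<in> X"
  using G_bij by (auto simp: bij_betw_def)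

lemma G_image: "g \<in> G \<Longrightarrow> g ` X = X"
  using G_bij by (auto simp: bij_betw_def)

lemma G_inj: "g \<in> G \<Longrightarrow> inj_on g X"
  using G_bij by (auto simp: bij_betw_def)

lemma G_eqI: "g \<in> G \<Longrightarrow> h \<in> G \<Longrightarrow> (\<And>x. x \<in> X \<Longrightarrow> g x = h x) \<Longrightarrow> g = h"
  using G_extensional extensionalityI by metis

lemma G_inv_continuous: "g \<in> G \<Longrightarrow> continuous_on X (inv_into X g)"
  using continuous_on_inv[OF G_continuous compact, of g "inv_into X g"]
  by (auto simp: G_image G_inj)

lemma G_measurable: "g \<in> G \<Longrightarrow> g \<in> measurable M M"
  by (intro continuous_self_measurable G_continuous) (auto simp: G_in)

lemma G_inv_measurable: "g \<in> G \<Longrightarrow> inv_into X g \<in> measurable M M"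
  by (intro continuous_self_measurable G_inv_continuous)
     (auto simp: G_image intro: inv_into_into)

lemma G_image_sets:
  assumes "g \<in> G" "A \<in> sets M"
  shows "g ` A \<in> sets M"
proof -
  have "A \<subseteq> X" using assms by (simp add: sets_M_iff)
  have "g ` A = inv_into X g -` A \<inter> space M"
    using G_inj[OF assms(1)] G_image[OF assms(1)] \<open>A \<subseteq> X\<close>
    by (auto simp: space_M inv_into_f_f f_inv_into_f subset_iff intro!: rev_image_eqI)
  then show ?thesis using measurable_sets[OF G_inv_measurable[OF assms(1)] assms(2)] by simp
qed

lemma G_null_image: "g \<in> G \<Longrightarrow> A \<in> sets M \<Longrightarrow> emeasure M A = 0 \<longleftrightarrow> emeasure M (g ` A) = 0"
  unfolding G_iff by blast

lemma G_Bij: "G \<subseteq> Bij X"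
  by (auto simp: G_iff Bij_def)

lemma subgroup_G: "subgroup G (BijGroup X)"
proof (rule group.subgroupI[OF group_BijGroup])
  show "G \<subseteq> carrier (BijGroup X)" using G_Bij by (simp add: BijGroup_def)
  have "(\<lambda>x\<in>X. x) \<in> G"
  proof -
    have "(\<lambda>x\<in>X. x) ` A = A" if "A \<in> sets M" for A
      using that by (auto simp: sets_M_iff image_iff subset_iff)
    then show ?thesis
      by (auto simp: G_iff bij_betw_def inj_on_def)
  qed
  then show "G \<noteq> {}" by auto
next
  fix g assume g: "g \<in> G"
  let ?h = "\<lambda>x\<in>X. inv_into X g x"
  have "?h \<in> G"
    unfolding G_iff
  proof (intro conjI ballI)
    show "bij_betw ?h X X" using bij_betw_inv_into[OF G_bij[OF g]] by simp
    show "continuous_on X ?h" using G_inv_continuous[OF g] by (simp cong: continuous_on_cong)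
    fix A assume A: "A \<in> sets M"
    then have AX: "A \<subseteq> X" by (simp add: sets_M_iff)
    have "?h ` A = g -` A \<inter> space M"
    proof
      show "?h ` A \<subseteq> g -` A \<inter> space M"
        using AX G_image[OF g] by (auto simp: space_M f_inv_into_f subset_iff intro: inv_into_into)
      show "g -` A \<inter> space M \<subseteq> ?h ` A"
      proof
        fix x assume "x \<in> g -` A \<inter> space M"
        then have "x \<in> X" "g x \<in> A" by (auto simp: space_M)
        then have "x = ?h (g x)" using AX G_inj[OF g] by (simp add: inv_into_f_f subset_iff)
        then show "x \<in> ?h ` A" using \<open>g x \<in> A\<close> by (rule image_eqI)
      qed
    qed
    then have "?h ` A \<in> sets M" using measurable_sets[OF G_measurable[OF g] A] by simp
    moreover have "g ` (?h ` A) = A"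
      using AX G_image[OF g] by (force simp: image_iff f_inv_into_f subset_iff)
    ultimately show "(emeasure M A = 0) = (emeasure M (?h ` A) = 0)"
      using G_null_image[OF g, of "?h ` A"] by simp
  qed simp
  then show "inv\<^bsub>BijGroup X\<^esub> g \<in> G"
    using g G_Bij by (subst inv_BijGroup) auto
next
  fix g h assume g: "g \<in> G" and h: "h \<in> G"
  have "compose X g h \<in> G"
    unfolding G_iff
  proof (intro conjI ballI)
    show "compose X g h \<in> extensional X" by simp
    show "bij_betw (compose X g h) X X"
      using bij_betw_compose[OF G_bij[OF h] G_bij[OF g]] .
    have "continuous_on X (g \<circ> h)"
      using continuous_on_compose[OF G_continuous[OF h], of g] G_continuous[OF g] G_image[OF h] by simp
    then show "continuous_on X (compose X g h)"
      by (rule continuous_on_eq) (auto simp: compose_def)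
    fix A assume A: "A \<in> sets M"
    then have "compose X g h ` A = g ` h ` A"
      by (force simp: sets_M_iff compose_def image_iff subset_iff)
    then show "(emeasure M A = 0) = (emeasure M (compose X g h ` A) = 0)"
      using G_null_image[OF h A] G_null_image[OF g G_image_sets[OF h A]] by simp
  qed
  then show "g \<otimes>\<^bsub>BijGroup X\<^esub> h \<in> G"
    using g h G_Bij by (auto simp: BijGroup_def subset_iff)
qed

lemma group_GG: "group GG"
  using group.subgroup_imp_group[OF group_BijGroup subgroup_G]
  by (simp add: homeo_bac_group_def)

sublocale grp: group GG by (rule group_GG)

lemma carrier_GG [simp]: "carrier GG = G"
  by (simp add: homeo_bac_group_def)

lemma G_mul_closed [simp]: "g \<in> G \<Longrightarrow> h \<in> G \<Longrightarrow> g \<odot> h \<in> G"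
  using grp.m_closed by simp

lemma G_inv_closed [simp]: "g \<in> G \<Longrightarrow> ginv g \<in> G"
  using grp.inv_closed by simp

lemma G_one_closed [simp]: "one \<in> G"
  using grp.one_closed by simp

lemma mul_apply [simp]: "g \<in> G \<Longrightarrow> h \<in> G \<Longrightarrow> x \<in> X \<Longrightarrow> (g \<odot> h) x = g (h x)"
  using G_Bij by (auto simp: homeo_bac_group_def BijGroup_def compose_def subset_iff)

lemma one_apply [simp]: "x \<in> X \<Longrightarrow> one x = x"
  by (simp add: homeo_bac_group_def BijGroup_def)

lemma ginv_apply [simp]: "g \<in> G \<Longrightarrow> x \<in> X \<Longrightarrow> ginv g (g x) = x"
  by (metis G_inv_closed carrier_GG grp.l_inv mul_apply one_apply)

lemma apply_ginv [simp]: "g \<in> G \<Longrightarrow> x \<in> X \<Longrightarrow> g (ginv g x) = x"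
  by (metis G_inv_closed carrier_GG grp.r_inv mul_apply one_apply)

lemma ginv_image: "g \<in> G \<Longrightarrow> A \<subseteq> X \<Longrightarrow> ginv g ` g ` A = A"
  by (force simp: image_iff subset_iff)

lemma mul_image: "g \<in> G \<Longrightarrow> h \<in> G \<Longrightarrow> A \<subseteq> X \<Longrightarrow> (g \<odot> h) ` A = g ` h ` A"
  by (force simp: image_iff subset_iff)

abbreviation D where "D \<equiv> homeo_deriv M"

lemma D_measurable [measurable]: "D g \<in> borel_measurable M"
  unfolding homeo_deriv_def by measurable

lemma D_nonneg [simp]: "0 \<le> D g x"
  by (simp add: homeo_deriv_def)

lemma image_measure_eq:
  assumes "g \<in> G"
  shows "image_measure M g = distr M M (ginv g)"
proof -
  have "emeasure (distr M M (ginv g)) A = emeasure M (g ` A)" if "A \<in> sets M" for A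
  proof -
    have "ginv g -` A \<inter> space M = g ` A"
      using that assms by (force simp: space_M sets_M_iff image_iff subset_iff G_in)
    then show ?thesis
      using that by (simp add: emeasure_distr G_measurable assms)
  qed
  then have "image_measure M g = measure_of (space M) (sets M) (emeasure (distr M M (ginv g)))"
    unfolding image_measure_def
    by (intro measure_of_eq) (auto simp: sets.sigma_sets_eq sets.space_closed)
  also have "\<dots> = distr M M (ginv g)"
    using measure_of_of_measure[of "distr M M (ginv g)"] by simp
  finally show ?thesis .
qed

lemma emeasure_image_measure:
  assumes "g \<in> G" "A \<in> sets M"
  shows "emeasure (image_measure M g) A = emeasure M (g ` A)"
proof -
  have "ginv g -` A \<inter> space M = g ` A"
    using assms by (force simp: space_M sets_M_iff image_iff subset_iff G_in)
  then show ?thesis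
    using assms by (simp add: image_measure_eq emeasure_distr G_measurable)
qed

text \<open>The Radon--Nikodym derivative is almost everywhere finite, so nothing is lost when the definition
  of \<open>D\<close> converts it to a real number.\<close>

lemma density_D:
  assumes "g \<in> G"
  shows "density M (\<lambda>x. ennreal (D g x)) = image_measure M g"
proof -
  have sets: "sets (image_measure M g) = sets M" using assms by (simp add: image_measure_eq)
  have ac: "absolutely_continuous M (image_measure M g)"
    using assms by (auto simp: absolutely_continuous_def null_sets_def sets emeasure_image_measure
        G_null_image[symmetric])
  have "finite_measure (image_measure M g)"
    by (simp add: image_measure_eq assms finite_measure_distr G_measurable)
  then have "sigma_finite_measure (image_measure M g)"
    by (simp add: finite_measure_def)
  then have "AE x in M. RN_deriv M (image_measure M g) x \<noteq> \<infinity>"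
    by (intro RN_deriv_finite ac sets)
  then have "AE x in M. ennreal (D g x) = RN_deriv M (image_measure M g) x"
    by eventually_elim (simp add: homeo_deriv_def top.not_eq_extremum)
  then have "density M (\<lambda>x. ennreal (D g x)) = density M (RN_deriv M (image_measure M g))"
    by (intro density_cong) auto
  also have "\<dots> = image_measure M g" by (intro density_RN_deriv ac sets)
  finally show ?thesis .
qed

lemma nn_integral_D:
  assumes "g \<in> G" "A \<in> sets M"
  shows "(\<integral>\<^sup>+x\<in>A. ennreal (D g x) \<partial>M) = emeasure M (g ` A)"
  using emeasure_density[of "\<lambda>x. ennreal (D g x)" M A] assms
  by (simp add: density_D emeasure_image_measure)

lemma nn_integral_change:
  assumes g: "g \<in> G" and [measurable]: "u \<in> borel_measurable M"
  shows "(\<integral>\<^sup>+x. u (g x) * ennreal (D g x) \<partial>M) = (\<integral>\<^sup>+x. u x \<partial>M)"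
proof -
  have [measurable]: "g \<in> measurable M M" "ginv g \<in> measurable M M"
    using g by (auto intro: G_measurable)
  have "(\<integral>\<^sup>+x. u (g x) * ennreal (D g x) \<partial>M) = (\<integral>\<^sup>+x. u (g x) \<partial>(density M (\<lambda>x. ennreal (D g x))))"
    by (subst nn_integral_density) (auto simp: mult.commute)
  also have "\<dots> = (\<integral>\<^sup>+x. u (g (ginv g x)) \<partial>M)"
    by (simp add: density_D g image_measure_eq nn_integral_distr)
  also have "\<dots> = (\<integral>\<^sup>+x. u x \<partial>M)"
    using g by (intro nn_integral_cong) (simp add: space_M)
  finally show ?thesis .
qed

lemma integral_change:
  fixes u :: "'a \<Rightarrow> real"
  assumes g: "g \<in> G" and [measurable]: "u \<in> borel_measurable M"
  shows "(\<integral>x. u (g x) * D g x \<partial>M) = (\<integral>x. u x \<partial>M)"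
    and "integrable M (\<lambda>x. u (g x) * D g x) \<longleftrightarrow> integrable M u"
proof -
  have [measurable]: "g \<in> measurable M M" "ginv g \<in> measurable M M"
    using g by (auto intro: G_measurable)
  have "(\<integral>x. u (g x) * D g x \<partial>M) = (\<integral>x. u (g x) \<partial>(density M (\<lambda>x. ennreal (D g x))))"
    by (subst integral_density) (auto simp: mult.commute)
  also have "\<dots> = (\<integral>x. u (g (ginv g x)) \<partial>M)"
    by (simp add: density_D g image_measure_eq integral_distr)
  also have "\<dots> = (\<integral>x. u x \<partial>M)"
    using g by (intro Bochner_Integration.integral_cong) (simp_all add: space_M)
  finally show "(\<integral>x. u (g x) * D g x \<partial>M) = (\<integral>x. u x \<partial>M)" .
  have "integrable M (\<lambda>x. u (g x) * D g x) \<longleftrightarrow> integrable (density M (\<lambda>x. ennreal (D g x))) (\<lambda>x. u (g x))"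
    by (subst integrable_density) (auto simp: mult.commute)
  also have "\<dots> \<longleftrightarrow> integrable M (\<lambda>x. u (g (ginv g x)))"
    by (simp add: density_D g image_measure_eq integrable_distr_eq)
  also have "\<dots> \<longleftrightarrow> integrable M u"
    using g by (intro Bochner_Integration.integrable_cong) (simp_all add: space_M)
  finally show "integrable M (\<lambda>x. u (g x) * D g x) \<longleftrightarrow> integrable M u" .
qed

lemma D_integrable: "g \<in> G \<Longrightarrow> integrable M (D g)"
  using integral_change(2)[of g "\<lambda>_. 1"] by simp

lemma D_unique:
  assumes "g \<in> G" "f \<in> borel_measurable M"
    and "\<And>A. A \<in> sets M \<Longrightarrow> (\<integral>\<^sup>+x\<in>A. ennreal (f x) \<partial>M) = emeasure M (g ` A)" "\<And>x. x \<in> X \<Longrightarrow> 0 \<le> f x"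
  shows "AE x in M. D g x = f x"
proof -
  have "density M (\<lambda>x. ennreal (D g x)) = density M (\<lambda>x. ennreal (f x))"
    by (rule measure_eqI) (use assms in \<open>auto simp: emeasure_density nn_integral_D\<close>)
  then have "AE x in M. ennreal (D g x) = ennreal (f x)"
    using assms(2) by (intro density_unique) auto
  then show ?thesis
    using assms(4) by (auto simp: space_M[symmetric] elim!: eventually_rev_mp intro!: AE_I2)
qed

text \<open>Elements of \<open>G\<close> preserve null sets in both directions, which allows almost sure statements to be
  composed with them.\<close>

lemma AE_pullback:
  assumes "g \<in> G" "AE x in M. P x"
  shows "AE x in M. P (g x)"
proof -
  obtain N where N: "{x \<in> space M. \<not> P x} \<subseteq> N" "emeasure M N = 0" "N \<in> sets M"
    using AE_E[OF assms(2)] by blast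
  have A: "g -` N \<inter> space M \<in> sets M" using G_measurable[OF assms(1)] N(3) by (rule measurable_sets)
  have "N \<subseteq> X" using N(3) by (simp add: sets_M_iff)
  have "g ` (g -` N \<inter> space M) = N"
  proof
    show "N \<subseteq> g ` (g -` N \<inter> space M)"
    proof
      fix y assume "y \<in> N"
      then obtain x where "x \<in> X" "g x = y" using \<open>N \<subseteq> X\<close> G_image[OF assms(1)] by (metis imageE subsetD)
      then show "y \<in> g ` (g -` N \<inter> space M)" using \<open>y \<in> N\<close> by (auto simp: space_M)
    qed
  qed auto
  then have "emeasure M (g -` N \<inter> space M) = 0"
    using G_null_image[OF assms(1) A] N(2) by simp
  then show ?thesis
    using N(1) A G_in[OF assms(1)]
    by (intro AE_I[of _ _ "g -` N \<inter> space M"]) (auto simp: space_M subset_iff)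
qed

lemma D_chain:
  assumes g: "g \<in> G" and h: "h \<in> G"
  shows "AE x in M. D (g \<odot> h) x = D g (h x) * D h x"
proof (rule D_unique)
  have [measurable]: "h \<in> measurable M M" by (rule G_measurable[OF h])
  show "(\<lambda>x. D g (h x) * D h x) \<in> borel_measurable M" by measurable
  fix A assume A: "A \<in> sets M"
  have hA [measurable]: "h ` A \<in> sets M" using G_image_sets h A by simp
  have "(\<integral>\<^sup>+x\<in>A. ennreal (D g (h x) * D h x) \<partial>M) =
     (\<integral>\<^sup>+x. (ennreal (D g (h x)) * indicator (h ` A) (h x)) * ennreal (D h x) \<partial>M)"
  proof (intro nn_integral_cong)
    fix x assume "x \<in> space M"
    then have "h x \<in> h ` A \<longleftrightarrow> x \<in> A"
      using G_inj[OF h] A by (auto simp: space_M sets_M_iff inj_on_def subset_iff)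
    then show "ennreal (D g (h x) * D h x) * indicator A x
        = ennreal (D g (h x)) * indicator (h ` A) (h x) * ennreal (D h x)"
      by (auto simp: indicator_def ennreal_mult)
  qed
  also have "\<dots> = (\<integral>\<^sup>+x\<in>h ` A. ennreal (D g x) \<partial>M)"
    using nn_integral_change[OF h, of "\<lambda>x. ennreal (D g x) * indicator (h ` A) x"] by simp
  also have "\<dots> = emeasure M ((g \<odot> h) ` A)"
    using nn_integral_D[OF g hA] A g h by (simp add: mul_image sets_M_iff)
  finally show "(\<integral>\<^sup>+x\<in>A. ennreal (D g (h x) * D h x) \<partial>M) = emeasure M ((g \<odot> h) ` A)" .
qed (use assms in auto)

lemma D_one: "AE x in M. D one x = 1"
proof (rule D_unique)
  fix A assume "A \<in> sets M"
  then have "one ` A = A" by (force simp: sets_M_iff image_iff subset_iff)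
  then show "(\<integral>\<^sup>+x\<in>A. ennreal 1 \<partial>M) = emeasure M (one ` A)"
    using \<open>A \<in> sets M\<close> by simp
qed auto

lemma X_sets [measurable, simp]: "X \<in> sets M"
  using sets.top[of M] by (simp add: space_M)

lemma measure_image_D:
  assumes "g \<in> G" "A \<in> sets M"
  shows "(LINT x:A|M. D g x) = measure M (g ` A)"
proof -
  have "(LINT x:A|M. D g x) = enn2real (\<integral>\<^sup>+x. ennreal (indicator A x *\<^sub>R D g x) \<partial>M)"
    unfolding set_lebesgue_integral_def
    using assms by (intro integral_eq_nn_integral) (auto simp: indicator_def)
  also have "(\<integral>\<^sup>+x. ennreal (indicator A x *\<^sub>R D g x) \<partial>M) = (\<integral>\<^sup>+x\<in>A. ennreal (D g x) \<partial>M)"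
    by (intro nn_integral_cong) (auto simp: indicator_def)
  finally show ?thesis by (simp add: nn_integral_D[OF assms] measure_def)
qed

lemma measure_X_D: "g \<in> G \<Longrightarrow> (\<integral>x. D g x \<partial>M) = measure M X"
  using integral_change(1)[of g "\<lambda>_. 1"] by (simp add: space_M)

abbreviation rho where "rho \<equiv> rho_ac M"

lemma rho_nonneg [simp]: "0 \<le> rho g h"
  by (simp add: rho_ac_def)

lemma rho_commute: "rho g h = rho h g"
  by (simp add: rho_ac_def abs_minus_commute)

lemma rho_self [simp]: "rho g g = 0"
  by (simp add: rho_ac_def)

lemma rho_triangle:
  assumes "f \<in> G" "g \<in> G" "h \<in> G"
  shows "rho f h \<le> rho f g + rho g h"
proof -
  have "rho f h \<le> (\<integral>x. \<bar>D f x - D g x\<bar> + \<bar>D g x - D h x\<bar> \<partial>M)"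
    unfolding rho_ac_def using assms
    by (intro integral_mono Bochner_Integration.integrable_add integrable_abs
        Bochner_Integration.integrable_diff D_integrable) auto
  also have "\<dots> = rho f g + rho g h"
    unfolding rho_ac_def using assms
    by (intro Bochner_Integration.integral_add integrable_abs
        Bochner_Integration.integrable_diff D_integrable)
  finally show ?thesis .
qed

text \<open>By the chain rule the derivatives of \<open>g \<odot> k\<close> and \<open>h \<odot> k\<close> differ from those of \<open>g\<close> and \<open>h\<close> by the
  same substitution and the same factor \<open>D k\<close>.\<close>

lemma rho_right_invariant:
  assumes "g \<in> G" "h \<in> G" "k \<in> G"
  shows "rho (g \<odot> k) (h \<odot> k) = rho g h"
proof -
  have [measurable]: "k \<in> measurable M M" by (rule G_measurable[OF assms(3)])
  have "rho (g \<odot> k) (h \<odot> k) = (\<integral>x. \<bar>D g (k x) - D h (k x)\<bar> * D k x \<partial>M)"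
    unfolding rho_ac_def
  proof (rule integral_cong_AE)
    show "AE x in M. \<bar>D (g \<odot> k) x - D (h \<odot> k) x\<bar> = \<bar>D g (k x) - D h (k x)\<bar> * D k x"
      using D_chain[OF assms(1,3)] D_chain[OF assms(2,3)]
      by eventually_elim (simp add: abs_mult flip: left_diff_distrib)
  qed measurable
  also have "\<dots> = rho g h"
    unfolding rho_ac_def by (rule integral_change(1)[OF assms(3), of "\<lambda>x. \<bar>D g x - D h x\<bar>"]) measurable
  finally show ?thesis .
qed

lemma rho_one_eq: "rho g one = (\<integral>x. \<bar>D g x - 1\<bar> \<partial>M)"
  unfolding rho_ac_def
  by (rule integral_cong_AE) (use D_one in \<open>auto elim!: eventually_mono\<close>)

text \<open>Since \<open>D g - 1\<close> has integral 0, its \<open>L\<^sup>1\<close> norm is twice the integral of its positive part. The two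
  estimates of \<open>rho g 1\<close> below, from the support of \<open>g\<close> and from a Lipschitz bound, are read off from
  the set on which \<open>D g \<ge> 1\<close>.\<close>

lemma rho_one_witness:
  assumes "g \<in> G"
  obtains A where "A \<in> sets M" "rho g one = 2 * (measure M (g ` A) - measure M A)"
proof
  let ?A = "{x \<in> space M. 1 \<le> D g x}"
  show A [measurable]: "?A \<in> sets M" by measurable
  have gi: "integrable M (D g)" by (rule D_integrable[OF assms])
  have gA: "integrable M (\<lambda>x. indicator ?A x * D g x)"
    using integrable_mult_indicator[OF A gi] by simp
  have iA: "integrable M (\<lambda>x. indicator ?A x :: real)" by (simp add: emeasure_eq_measure)
  have "rho g one = (\<integral>x. 2 * (indicator ?A x * D g x) - 2 * indicator ?A x - (D g x - 1) \<partial>M)"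
    unfolding rho_one_eq
    by (intro Bochner_Integration.integral_cong) (auto simp: indicator_def)
  also have "\<dots> = 2 * (\<integral>x. indicator ?A x * D g x \<partial>M) - 2 * measure M ?A - (measure M X - measure M X)"
    using gi gA iA measure_X_D[OF assms]
    by (simp add: space_M Int_def cong: conj_cong)
  also have "(\<integral>x. indicator ?A x * D g x \<partial>M) = measure M (g ` ?A)"
    using measure_image_D[OF assms A] by (simp add: set_lebesgue_integral_def)
  finally show "rho g one = 2 * (measure M (g ` ?A) - measure M ?A)" by simp
qed

lemma rho_supported_le:
  assumes "g \<in> G" "K \<in> sets M" "g ` K \<subseteq> K" "\<And>x. x \<in> X - K \<Longrightarrow> g x = x"
  shows "rho g one \<le> 2 * measure M K"
proof -
  obtain A where A: "A \<in> sets M" "rho g one = 2 * (measure M (g ` A) - measure M A)"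
    using rho_one_witness[OF assms(1)] .
  have "g ` A \<subseteq> A \<union> K"
  proof
    fix y assume "y \<in> g ` A"
    then obtain x where x: "x \<in> A" "y = g x" by blast
    then have "x \<in> X" using A(1) by (auto simp: sets_M_iff)
    then show "y \<in> A \<union> K"
      using x assms(3) assms(4)[of x] by (cases "x \<in> K") auto
  qed
  then have "measure M (g ` A) \<le> measure M (A \<union> K)"
    using A assms by (intro finite_measure_mono) auto
  also have "\<dots> \<le> measure M A + measure M K"
    using A assms by (intro measure_Un_le) auto
  finally show ?thesis using A by simp
qed

lemma rho_Lipschitz_le:
  assumes "g \<in> G" "0 \<le> L" "\<And>A. A \<in> sets M \<Longrightarrow> measure M (g ` A) \<le> (1 + L) * measure M A"
  shows "rho g one \<le> 2 * L * measure M X"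
proof -
  obtain A where A: "A \<in> sets M" "rho g one = 2 * (measure M (g ` A) - measure M A)"
    using rho_one_witness[OF assms(1)] .
  have "measure M (g ` A) - measure M A \<le> L * measure M A"
    using assms(3)[OF A(1)] by (simp add: algebra_simps)
  also have "\<dots> \<le> L * measure M X"
    using A assms(2) by (intro mult_left_mono finite_measure_mono) (auto simp: sets_M_iff[of A])
  finally show ?thesis using A by simp
qed

lemma D_eq_on:
  assumes g: "g \<in> G" and K: "K \<in> sets M" and "0 \<le> c"
    and c: "\<And>A. A \<in> sets M \<Longrightarrow> A \<subseteq> K \<Longrightarrow> measure M (g ` A) = c * measure M A"
  shows "AE x in M. x \<in> K \<longrightarrow> D g x = c"
proof -
  have "AE x in M. D g x = (if x \<in> K then c else D g x)"
  proof (rule D_unique[OF g])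
    show "(\<lambda>x. if x \<in> K then c else D g x) \<in> borel_measurable M" using K by measurable
    fix A assume A: "A \<in> sets M"
    have "(\<integral>\<^sup>+x\<in>A. ennreal (if x \<in> K then c else D g x) \<partial>M)
        = (\<integral>\<^sup>+x. ennreal c * indicator (A \<inter> K) x + ennreal (D g x) * indicator (A - K) x \<partial>M)"
      by (intro nn_integral_cong) (auto simp: indicator_def)
    also have "\<dots> = (\<integral>\<^sup>+x. ennreal c * indicator (A \<inter> K) x \<partial>M) + (\<integral>\<^sup>+x\<in>A - K. ennreal (D g x) \<partial>M)"
      using A K by (intro nn_integral_add) auto
    also have "(\<integral>\<^sup>+x. ennreal c * indicator (A \<inter> K) x \<partial>M) = ennreal c * emeasure M (A \<inter> K)"
      using A K by (simp add: nn_integral_cmult_indicator)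
    also have "\<dots> = emeasure M (g ` (A \<inter> K))"
      using c[of "A \<inter> K"] A K \<open>0 \<le> c\<close> by (simp add: emeasure_eq_measure ennreal_mult)
    also have "\<dots> = (\<integral>\<^sup>+x\<in>A \<inter> K. ennreal (D g x) \<partial>M)"
      using A K by (simp add: nn_integral_D[OF g])
    also have "\<dots> + (\<integral>\<^sup>+x\<in>A - K. ennreal (D g x) \<partial>M) = (\<integral>\<^sup>+x\<in>A. ennreal (D g x) \<partial>M)"
      using A K by (subst nn_integral_add[symmetric])
        (auto simp: indicator_def intro!: nn_integral_cong)
    finally show "(\<integral>\<^sup>+x\<in>A. ennreal (if x \<in> K then c else D g x) \<partial>M) = emeasure M (g ` A)"
      using nn_integral_D[OF g A] by simp
  qed (use \<open>0 \<le> c\<close> in auto)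
  then show ?thesis by eventually_elim auto
qed

lemma compact_inner_approx:
  assumes A: "A \<in> sets M" and "e > 0"
  obtains K where "K \<subseteq> A" "compact K" "measure M A - e < measure M K"
proof -
  define N where "N = distr M borel (\<lambda>x. x)"
  have [measurable]: "(\<lambda>x. x) \<in> borel_measurable M"
    by (intro continuous_measurable continuous_intros)
  have "finite_measure N" unfolding N_def by (rule finite_measure_distr) measurable
  then interpret N: finite_measure N .
  have sN: "sets N = sets borel" by (simp add: N_def)
  have NM: "measure N B = measure M B" if "B \<in> sets M" for B
    using that by (auto simp: N_def measure_distr space_M sets_M_iff intro!: arg_cong[where f="measure M"])
  have Ab: "A \<in> sets borel" "A \<subseteq> X" using A by (auto simp: sets_M_iff)
  have "emeasure N A = (SUP K \<in> {K. K \<subseteq> A \<and> compact K}. emeasure N K)"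
    by (rule inner_regular[OF sN _ Ab(1)]) simp
  moreover have "emeasure N A \<noteq> \<infinity>" by simp
  moreover have "{} \<in> {K. K \<subseteq> A \<and> compact K}" by simp
  then have "{K. K \<subseteq> A \<and> compact K} \<noteq> {}" by blast
  ultimately obtain K where K: "K \<in> {K. K \<subseteq> A \<and> compact K}" "emeasure N A < emeasure N K + ennreal e"
    using SUP_approx_ennreal[of e "{K. K \<subseteq> A \<and> compact K}" "emeasure N A" "emeasure N"] \<open>e > 0\<close>
    by auto
  have KM: "K \<in> sets M" using K Ab by (auto simp: sets_M_iff borel_compact)
  have "measure N A < measure N K + e"
    using K(2) \<open>e > 0\<close> by (simp add: N.emeasure_eq_measure ennreal_less_iff flip: ennreal_plus)
  then show ?thesis using K by (intro that[of K]) (auto simp: NM[OF A] NM[OF KM])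
qed

lemma open_outer_approx:
  assumes A: "A \<in> sets M" and "e > 0"
  obtains U where "A \<subseteq> U" "open U" "measure M (U \<inter> X) < measure M A + e"
proof -
  have "X - A \<in> sets M" using A by auto
  then obtain K where K: "K \<subseteq> X - A" "compact K" "measure M (X - A) - e < measure M K"
    using compact_inner_approx \<open>e > 0\<close> by blast
  have KM: "K \<in> sets M" using K by (auto simp: sets_M_iff borel_compact)
  have AX: "A \<subseteq> X" using A by (simp add: sets_M_iff)
  have "- K \<inter> X = X - K" by auto
  then have "measure M (- K \<inter> X) = measure M X - measure M K"
    using KM K finite_measure_Diff[OF X_sets KM] by (auto simp: subset_iff)
  moreover have "measure M (X - A) = measure M X - measure M A"
    using A AX by (simp add: finite_measure_Diff)
  ultimately show ?thesis
    using K AX by (intro that[of "- K"]) (auto intro: compact_imp_closed)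
qed

lemma indicator_L1_approx:
  assumes A: "A \<in> sets M" and "e > 0"
  obtains w where "continuous_on UNIV w" "(\<integral>x. \<bar>indicator A x - w x\<bar> \<partial>M) < (e::real)"
proof -
  have e2: "e / 2 > 0" using \<open>e > 0\<close> by simp
  obtain K where K: "K \<subseteq> A" "compact K" "measure M A - e / 2 < measure M K"
    by (rule compact_inner_approx[OF A e2])
  obtain U where U: "A \<subseteq> U" "open U" "measure M (U \<inter> X) < measure M A + e / 2"
    by (rule open_outer_approx[OF A e2])
  have AX: "A \<subseteq> X" using A by (simp add: sets_M_iff)
  have "closedin (top_of_set UNIV) K" "closedin (top_of_set UNIV) (- U)" "K \<inter> - U = {}"
    using K U by (auto intro: compact_imp_closed)
  then obtain w :: "'a \<Rightarrow> real" where w: "continuous_on UNIV w"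
    "\<And>x. w x \<in> closed_segment 1 0" "\<And>x. x \<in> K \<Longrightarrow> w x = 1" "\<And>x. x \<in> - U \<Longrightarrow> w x = 0"
    by (rule Urysohn_local[of UNIV K "- U" "1::real" 0]) auto
  have w01: "0 \<le> w x \<and> w x \<le> 1" for x using w(2)[of x] by (auto simp: closed_segment_eq_real_ivl)
  have KX: "K \<in> sets M" using K AX by (auto simp: sets_M_iff borel_compact)
  have UX: "U \<inter> X \<in> sets M" using U compact by (auto simp: sets_M_iff borel_compact)
  have wm [measurable]: "w \<in> borel_measurable M"
    by (rule continuous_measurable) (rule continuous_on_subset[OF w(1)], simp)
  have "(\<integral>x. \<bar>indicator A x - w x\<bar> \<partial>M) \<le> (\<integral>x. indicator ((U \<inter> X) - K) x \<partial>M)"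
  proof (rule integral_mono)
    have "integrable M w" using w01
      by (intro integrable_const_bound[where B=1]) auto
    moreover have "integrable M (indicator A :: 'a \<Rightarrow> real)" using A by (simp add: emeasure_eq_measure)
    ultimately show "integrable M (\<lambda>x. \<bar>indicator A x - w x\<bar>)" by auto
    show "integrable M (indicator ((U \<inter> X) - K) :: 'a \<Rightarrow> real)"
      using KX UX by (simp add: emeasure_eq_measure)
    fix x assume "x \<in> space M"
    then show "\<bar>indicator A x - w x\<bar> \<le> indicator ((U \<inter> X) - K) x"
      using w01[of x] w(3,4)[of x] K(1) U(1) by (auto simp: indicator_def space_M)
  qed
  also have "\<dots> = measure M ((U \<inter> X) - K)" using KX UX by simp
  also have "\<dots> = measure M (U \<inter> X) - measure M K"
    using KX UX K U AX by (intro finite_measure_Diff) auto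
  also have "\<dots> < e" using K(3) U(3) by linarith
  finally show ?thesis using that w(1) by blast
qed

lemma continuous_integrable:
  fixes w :: "'a \<Rightarrow> real"
  assumes "continuous_on X w"
  shows "integrable M w"
proof -
  have "bounded (w ` X)" by (intro compact_imp_bounded compact_continuous_image assms compact)
  then obtain B where "\<forall>y\<in>w ` X. norm y \<le> B" by (auto simp: bounded_iff)
  then show ?thesis
    by (intro integrable_const_bound[where B=B] continuous_measurable assms) (auto simp: space_M)
qed

lemma L1_approx_continuous:
  fixes f :: "'a \<Rightarrow> real"
  assumes "integrable M f"
  shows "\<forall>e>0. \<exists>w. continuous_on UNIV w \<and> (\<integral>x. \<bar>f x - w x\<bar> \<partial>M) < e"
  using assms
proof (induction rule: integrable_induct)
  case (base A c)
  show ?case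
  proof (intro allI impI)
    fix e :: real assume "e > 0"
    then have "e / (\<bar>c\<bar> + 1) > 0" by simp
    from indicator_L1_approx[OF base(1) this] obtain w where w: "continuous_on UNIV w"
      "(\<integral>x. \<bar>indicator A x - w x\<bar> \<partial>M) < e / (\<bar>c\<bar> + 1)" by blast
    have "(\<integral>x. \<bar>indicator A x *\<^sub>R c - c * w x\<bar> \<partial>M) = \<bar>c\<bar> * (\<integral>x. \<bar>indicator A x - w x\<bar> \<partial>M)"
      by (subst integral_mult_right_zero[symmetric], intro Bochner_Integration.integral_cong)
        (auto simp: abs_mult[symmetric] algebra_simps)
    also have "\<dots> \<le> (\<bar>c\<bar> + 1) * (\<integral>x. \<bar>indicator A x - w x\<bar> \<partial>M)"
      by (intro mult_right_mono) auto
    also have "\<dots> < e" using w(2) by (simp add: field_simps)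
    finally show "\<exists>w. continuous_on UNIV w \<and> (\<integral>x. \<bar>indicator A x *\<^sub>R c - w x\<bar> \<partial>M) < e"
      using w(1) by (intro exI[of _ "\<lambda>x. c * w x"]) (auto intro: continuous_intros)
  qed
next
  case (add f g)
  show ?case
  proof (intro allI impI)
    fix e :: real assume "e > 0"
    then have e2: "e / 2 > 0" by simp
    obtain u where u: "continuous_on UNIV u" "(\<integral>x. \<bar>f x - u x\<bar> \<partial>M) < e/2"
      using add.IH(1) e2 by blast
    obtain v where v: "continuous_on UNIV v" "(\<integral>x. \<bar>g x - v x\<bar> \<partial>M) < e/2"
      using add.IH(2) e2 by blast
    have ui: "integrable M u" "integrable M v"
      using u(1) v(1) by (auto intro!: continuous_integrable intro: continuous_on_subset)
    have "(\<integral>x. \<bar>f x + g x - (u x + v x)\<bar> \<partial>M) \<le> (\<integral>x. \<bar>f x - u x\<bar> + \<bar>g x - v x\<bar> \<partial>M)"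
      using add.hyps ui by (intro integral_mono) auto
    also have "\<dots> = (\<integral>x. \<bar>f x - u x\<bar> \<partial>M) + (\<integral>x. \<bar>g x - v x\<bar> \<partial>M)"
      using add.hyps ui by (intro Bochner_Integration.integral_add) auto
    also have "\<dots> < e" using u(2) v(2) by simp
    finally show "\<exists>w. continuous_on UNIV w \<and> (\<integral>x. \<bar>f x + g x - w x\<bar> \<partial>M) < e"
      using u(1) v(1) by (intro exI[of _ "\<lambda>x. u x + v x"]) (auto intro: continuous_intros)
  qed
next
  case (lim f s)
  show ?case
  proof (intro allI impI)
    fix e :: real assume "e > 0"
    have "(\<lambda>i. \<integral>x. \<bar>f x - s i x\<bar> \<partial>M) \<longlonglongrightarrow> (\<integral>x. 0 \<partial>M)"
    proof (rule integral_dominated_convergence[where w="\<lambda>x. 3 * \<bar>f x\<bar>"])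
      show "AE x in M. (\<lambda>i. \<bar>f x - s i x\<bar>) \<longlonglongrightarrow> 0"
      proof (rule AE_I2)
        fix x assume "x \<in> space M"
        then have "(\<lambda>i. \<bar>f x - s i x\<bar>) \<longlonglongrightarrow> \<bar>f x - f x\<bar>"
          using lim.hyps(2) by (intro tendsto_intros) auto
        then show "(\<lambda>i. \<bar>f x - s i x\<bar>) \<longlonglongrightarrow> 0" by simp
      qed
      show "AE x in M. norm \<bar>f x - s i x\<bar> \<le> 3 * \<bar>f x\<bar>" for i
        using lim.hyps(3)[of _ i] by (intro AE_I2) (fastforce simp: abs_if split: if_splits)
    qed (use lim.hyps in auto)
    then have "eventually (\<lambda>i. (\<integral>x. \<bar>f x - s i x\<bar> \<partial>M) < e/2) sequentially"
      using \<open>e > 0\<close> by (intro order_tendstoD(2)[of _ 0]) auto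
    then obtain i where i: "(\<integral>x. \<bar>f x - s i x\<bar> \<partial>M) < e/2"
      by (auto simp: eventually_sequentially)
    obtain w where w: "continuous_on UNIV w" "(\<integral>x. \<bar>s i x - w x\<bar> \<partial>M) < e/2"
      using lim.IH[of i, rule_format, of "e/2"] \<open>e > 0\<close> by auto
    have wi: "integrable M w"
      using w(1) by (auto intro!: continuous_integrable intro: continuous_on_subset)
    have "(\<integral>x. \<bar>f x - w x\<bar> \<partial>M) \<le> (\<integral>x. \<bar>f x - s i x\<bar> + \<bar>s i x - w x\<bar> \<partial>M)"
      using lim.hyps wi by (intro integral_mono) auto
    also have "\<dots> = (\<integral>x. \<bar>f x - s i x\<bar> \<partial>M) + (\<integral>x. \<bar>s i x - w x\<bar> \<partial>M)"
      using lim.hyps wi by (intro Bochner_Integration.integral_add) auto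
    also have "\<dots> < e" using w(2) i by simp
    finally show "\<exists>w. continuous_on UNIV w \<and> (\<integral>x. \<bar>f x - w x\<bar> \<partial>M) < e"
      using w(1) by blast
  qed
qed

end

section \<open>Metrics for the two topologies\<close>

lemma generated_coarser:
  assumes "\<And>B. B \<in> \<S> \<Longrightarrow> openin T B" "openin (topology_generated_by \<S>) U"
  shows "openin T U"
proof -
  have "generate_topology_on \<S> U" using assms(2) by (rule openin_topology_generated_by)
  then show ?thesis
    by induction (use assms(1) in auto)
qed

context compact_measure
begin

text \<open>The value 0 outside \<open>G\<close> makes symmetry and nonnegativity hold without side conditions, as the
  notion of a metric on a carrier set demands.\<close>

definition sup_dist :: "('a \<Rightarrow> 'a) \<Rightarrow> ('a \<Rightarrow> 'a) \<Rightarrow> real" where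
  "sup_dist g h = (if g \<in> G \<and> h \<in> G then SUP x\<in>X. dist (g x) (h x) else 0)"

lemma sup_dist_le_iff:
  assumes "g \<in> G" "h \<in> G"
  shows "sup_dist g h \<le> e \<longleftrightarrow> (\<forall>x\<in>X. dist (g x) (h x) \<le> e)"
proof -
  obtain B where B: "\<And>x y. x \<in> X \<Longrightarrow> y \<in> X \<Longrightarrow> dist x y \<le> B"
    using compact_imp_bounded[OF compact] by (meson bounded_two_points)
  have "bdd_above ((\<lambda>x. dist (g x) (h x)) ` X)"
    using B[OF G_in[OF assms(1)] G_in[OF assms(2)]] by (intro bdd_aboveI2[where M=B]) auto
  then show ?thesis
    unfolding sup_dist_def using assms nonempty by (simp add: cSUP_le_iff)
qed

lemma dist_le_sup_dist: "g \<in> G \<Longrightarrow> h \<in> G \<Longrightarrow> x \<in> X \<Longrightarrow> dist (g x) (h x) \<le> sup_dist g h"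
  using sup_dist_le_iff[of g h "sup_dist g h"] by blast

lemma sup_dist_nonneg: "0 \<le> sup_dist g h"
proof (cases "g \<in> G \<and> h \<in> G")
  case True
  obtain x where "x \<in> X" using nonempty by blast
  then show ?thesis
    using dist_le_sup_dist[of g h x] True zero_le_dist[of "g x" "h x"] by linarith
next
  case False
  then show ?thesis by (simp only: sup_dist_def if_False order_refl)
qed

lemma sup_dist_commute: "sup_dist g h = sup_dist h g"
  by (simp add: sup_dist_def dist_commute conj_commute)

lemma sup_dist_triangle:
  assumes "f \<in> G" "g \<in> G" "h \<in> G"
  shows "sup_dist f h \<le> sup_dist f g + sup_dist g h"
proof (subst sup_dist_le_iff)
  show "\<forall>x\<in>X. dist (f x) (h x) \<le> sup_dist f g + sup_dist g h"
  proof
    fix x assume "x \<in> X"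
    then have "dist (f x) (g x) \<le> sup_dist f g" "dist (g x) (h x) \<le> sup_dist g h"
      using assms dist_le_sup_dist by auto
    then show "dist (f x) (h x) \<le> sup_dist f g + sup_dist g h"
      using dist_triangle[of "f x" "h x" "g x"] by linarith
  qed
qed (use assms in auto)

lemma Metric_space_sup_dist: "Metric_space G sup_dist"
proof
  show "sup_dist g h = 0 \<longleftrightarrow> g = h" if "g \<in> G" "h \<in> G" for g h
  proof
    assume "sup_dist g h = 0"
    then have "\<forall>x\<in>X. dist (g x) (h x) \<le> 0" using sup_dist_le_iff[OF that, of 0] by simp
    then show "g = h" using that by (intro G_eqI) auto
  next
    assume "g = h"
    then show "sup_dist g h = 0"
      using sup_dist_le_iff[OF that, of 0] sup_dist_nonneg[of g h] by simp
  qed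
qed (use sup_dist_nonneg sup_dist_commute sup_dist_triangle in auto)

lemma Metric_space_ac: "Metric_space G (\<lambda>g h. sup_dist g h + rho g h)"
proof -
  interpret Metric_space G sup_dist by (rule Metric_space_sup_dist)
  show ?thesis
  proof
    fix f g h assume "f \<in> G" "g \<in> G" "h \<in> G"
    then show "sup_dist f h + rho f h \<le> sup_dist f g + rho f g + (sup_dist g h + rho g h)"
      using triangle[of f g h] rho_triangle[of f g h] by auto
  next
    fix g h assume "g \<in> G" "h \<in> G"
    then show "sup_dist g h + rho g h = 0 \<longleftrightarrow> g = h"
      using rho_nonneg[of g h] nonneg[of g h] zero[of g h]
      by (metis add.right_neutral add_nonneg_eq_0_iff rho_self)
  qed (auto simp: commute rho_commute)
qed

lemma sup_dist_right_invariant: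
  assumes "g \<in> G" "h \<in> G" "k \<in> G"
  shows "sup_dist (g \<odot> k) (h \<odot> k) = sup_dist g h"
proof -
  have "sup_dist (g \<odot> k) (h \<odot> k) \<le> e \<longleftrightarrow> sup_dist g h \<le> e" for e
  proof -
    have "(\<forall>x\<in>X. dist (g (k x)) (h (k x)) \<le> e) \<longleftrightarrow> (\<forall>y\<in>k ` X. dist (g y) (h y) \<le> e)" by blast
    then show ?thesis using assms G_image[OF assms(3)] by (simp add: sup_dist_le_iff)
  qed
  then show ?thesis by (meson dual_order.eq_iff)
qed

lemma sup_dist_left_continuous:
  assumes "a \<in> G" "e > 0"
  shows "\<exists>\<delta>>0. \<forall>x\<in>G. sup_dist x one < \<delta> \<longrightarrow> sup_dist (a \<odot> x) a < e"
proof -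
  have "uniformly_continuous_on X a"
    by (rule compact_uniformly_continuous[OF G_continuous[OF assms(1)] compact])
  then obtain d where d: "d > 0" "\<forall>x\<in>X. \<forall>x'\<in>X. dist x' x < d \<longrightarrow> dist (a x') (a x) < e/2"
    unfolding uniformly_continuous_on_def using assms(2) by (meson half_gt_zero)
  have "sup_dist (a \<odot> x) a < e" if x: "x \<in> G" "sup_dist x one < d" for x
  proof -
    have "dist (a (x y)) (a y) \<le> e/2" if "y \<in> X" for y
    proof -
      have "dist (x y) y < d" using dist_le_sup_dist[of x one y] x that by simp
      then show ?thesis using d(2) that G_in[OF x(1) that] by (meson less_imp_le)
    qed
    then have "sup_dist (a \<odot> x) a \<le> e/2" using x(1) assms(1) by (subst sup_dist_le_iff) auto
    then show ?thesis using assms(2) by linarith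
  qed
  then show ?thesis using d(1) by blast
qed

lemma compact_uniform_real:
  assumes "continuous_on UNIV w" "e > 0"
  shows "\<exists>d>0. \<forall>x\<in>X. \<forall>y\<in>X. dist x y < d \<longrightarrow> \<bar>w x - w y\<bar> < (e::real)"
proof -
  have "uniformly_continuous_on X w"
    by (rule compact_uniformly_continuous[OF continuous_on_subset[OF assms(1)] compact]) simp
  then obtain d where "d > 0" "\<forall>x\<in>X. \<forall>x'\<in>X. dist x' x < d \<longrightarrow> dist (w x') (w x) < e"
    unfolding uniformly_continuous_on_def using assms(2) by meson
  then show ?thesis by (auto simp: dist_real_def)
qed

lemma compact_bound_real:
  assumes "continuous_on UNIV w"
  shows "\<exists>B>0. \<forall>x\<in>X. \<bar>w x\<bar> \<le> (B::real)"
proof -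
  have "bounded (w ` X)"
    by (intro compact_imp_bounded compact_continuous_image compact continuous_on_subset[OF assms]) simp
  then obtain B where "B > 0" "\<forall>y\<in>w ` X. norm y \<le> B" by (auto simp: bounded_pos)
  then show ?thesis by auto
qed

text \<open>Left translation is continuous for \<open>rho\<close> together with the uniform distance: \<open>D (a \<odot> k) = (D a \<circ> k) * D k\<close>, and if \<open>D a\<close> is replaced by a continuous \<open>w\<close>, the error is
  the same \<open>L\<^sup>1\<close> error before and after substituting \<open>k\<close>, while \<open>w \<circ> k\<close> is uniformly close to \<open>w\<close>.\<close>

lemma rho_left_estimate:
  assumes a: "a \<in> G" and k: "k \<in> G" and w: "continuous_on UNIV w"
    and B: "\<And>x. x \<in> X \<Longrightarrow> \<bar>w x\<bar> \<le> B" and c: "\<And>x. x \<in> X \<Longrightarrow> \<bar>w (k x) - w x\<bar> \<le> \<eta>"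
  shows "rho (a \<odot> k) a \<le> 2 * (\<integral>x. \<bar>D a x - w x\<bar> \<partial>M) + \<eta> * measure M X + B * rho k one"
proof -
  have [measurable]: "k \<in> measurable M M" by (rule G_measurable[OF k])
  have wX: "continuous_on X w" using w by (rule continuous_on_subset) simp
  have wM [measurable]: "w \<in> borel_measurable M" by (rule continuous_measurable[OF wX])
  have wi: "integrable M w" by (rule continuous_integrable[OF wX])
  have Di: "integrable M (D a)" "integrable M (D k)" using a k by (auto intro: D_integrable)
  let ?E = "\<lambda>x. \<bar>D a x - w x\<bar>"
  have Ei: "integrable M ?E" using Di wi by auto
  have Ek: "integrable M (\<lambda>x. ?E (k x) * D k x)" using integral_change(2)[OF k, of ?E] Ei by simp
  have Ki: "integrable M (\<lambda>x. \<bar>D k x - 1\<bar>)" using Di by simp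
  have "rho (a \<odot> k) a = (\<integral>x. \<bar>D a (k x) * D k x - D a x\<bar> \<partial>M)"
    unfolding rho_ac_def
  proof (rule integral_cong_AE)
    show "AE x in M. \<bar>D (a \<odot> k) x - D a x\<bar> = \<bar>D a (k x) * D k x - D a x\<bar>"
      using D_chain[OF a k] by eventually_elim simp
  qed measurable
  also have "\<dots> \<le> (\<integral>x. (?E (k x) * D k x + \<eta> * D k x) + (B * \<bar>D k x - 1\<bar> + ?E x) \<partial>M)"
  proof (rule integral_mono)
    have "integrable M (\<lambda>x. D a (k x) * D k x)" using integral_change(2)[OF k, of "D a"] Di by simp
    then show "integrable M (\<lambda>x. \<bar>D a (k x) * D k x - D a x\<bar>)" using Di by auto
    show "integrable M (\<lambda>x. (?E (k x) * D k x + \<eta> * D k x) + (B * \<bar>D k x - 1\<bar> + ?E x))"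
      using Ek Di Ki Ei by (intro Bochner_Integration.integrable_add integrable_mult_right)
    fix x assume "x \<in> space M"
    then have x: "x \<in> X" by (simp add: space_M)
    have "\<bar>D a (k x) * D k x - D a x\<bar> = \<bar>(D a (k x) - w (k x)) * D k x + (w (k x) - w x) * D k x
       + w x * (D k x - 1) + (w x - D a x)\<bar>" by (simp add: algebra_simps)
    also have "\<dots> \<le> \<bar>D a (k x) - w (k x)\<bar> * D k x + \<bar>w (k x) - w x\<bar> * D k x
       + \<bar>w x\<bar> * \<bar>D k x - 1\<bar> + \<bar>D a x - w x\<bar>"
    proof -
      have t: "\<bar>p + q + r + s\<bar> \<le> \<bar>p\<bar> + \<bar>q\<bar> + \<bar>r\<bar> + \<bar>s\<bar>" for p q r s :: real by linarith
      show ?thesis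
        using t[of "(D a (k x) - w (k x)) * D k x" "(w (k x) - w x) * D k x" "w x * (D k x - 1)" "w x - D a x"]
        by (simp add: abs_mult abs_minus_commute[of "w x" "D a x"])
    qed
    also have "\<dots> \<le> ?E (k x) * D k x + \<eta> * D k x + B * \<bar>D k x - 1\<bar> + ?E x"
      using c[OF x] B[OF x] by (intro add_mono mult_right_mono) auto
    finally show "\<bar>D a (k x) * D k x - D a x\<bar> \<le> (?E (k x) * D k x + \<eta> * D k x) + (B * \<bar>D k x - 1\<bar> + ?E x)"
      by simp
  qed
  also have "\<dots> = (\<integral>x. ?E (k x) * D k x \<partial>M) + \<eta> * (\<integral>x. D k x \<partial>M) + (B * (\<integral>x. \<bar>D k x - 1\<bar> \<partial>M) + (\<integral>x. ?E x \<partial>M))"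
    using Ek Di Ki Ei by (simp add: Bochner_Integration.integrable_add)
  also have "(\<integral>x. ?E (k x) * D k x \<partial>M) = (\<integral>x. ?E x \<partial>M)"
    by (rule integral_change(1)[OF k]) measurable
  finally show ?thesis by (simp add: measure_X_D[OF k] rho_one_eq)
qed

lemma ac_left_continuous:
  assumes a: "a \<in> G" and e: "e > 0"
  shows "\<exists>\<delta>>0. \<forall>x\<in>G. sup_dist x one + rho x one < \<delta> \<longrightarrow> sup_dist (a \<odot> x) a + rho (a \<odot> x) a < e"
proof -
  \<comment> \<open>The constants split e into e/2 for the uniform distance and three shares of e/6 for the terms
    of the estimate of rho; the approximation error of w enters that estimate twice.\<close>
  obtain w where w: "continuous_on UNIV w" "(\<integral>x. \<bar>D a x - w x\<bar> \<partial>M) < e/12"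
    using L1_approx_continuous[OF D_integrable[OF a]] e by (metis divide_pos_pos zero_less_numeral)
  obtain B where B: "B > 0" "\<And>x. x \<in> X \<Longrightarrow> \<bar>w x\<bar> \<le> B"
    using compact_bound_real[OF w(1)] by blast
  define \<eta> where "\<eta> = e / (6 * (measure M X + 1))"
  have \<eta>: "\<eta> > 0" using e by (simp add: \<eta>_def add_nonneg_pos)
  obtain d1 where d1: "d1 > 0" "\<And>x y. x \<in> X \<Longrightarrow> y \<in> X \<Longrightarrow> dist x y < d1 \<Longrightarrow> \<bar>w x - w y\<bar> < \<eta>"
    using compact_uniform_real[OF w(1) \<eta>] by blast
  obtain d2 where d2: "d2 > 0" "\<forall>x\<in>G. sup_dist x one < d2 \<longrightarrow> sup_dist (a \<odot> x) a < e/2"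
    using sup_dist_left_continuous[OF a, of "e/2"] e by auto
  define \<delta> where "\<delta> = min (min d1 d2) (e / (6 * B))"
  have \<delta>: "\<delta> > 0" using d1 d2 B e by (simp add: \<delta>_def)
  have "sup_dist (a \<odot> k) a + rho (a \<odot> k) a < e" if k: "k \<in> G" "sup_dist k one + rho k one < \<delta>" for k
  proof -
    have sk: "sup_dist k one < \<delta>" "rho k one < \<delta>"
      using k(2) sup_dist_nonneg[of k one] rho_nonneg[of k one] by linarith+
    have cl: "\<bar>w (k x) - w x\<bar> \<le> \<eta>" if "x \<in> X" for x
    proof -
      have "dist (k x) x < d1" using dist_le_sup_dist[of k one x] sk(1) k(1) that by (simp add: \<delta>_def)
      then show ?thesis using d1(2)[of "k x" x] that G_in[OF k(1)] by fastforce
    qed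
    have "rho (a \<odot> k) a \<le> 2 * (\<integral>x. \<bar>D a x - w x\<bar> \<partial>M) + \<eta> * measure M X + B * rho k one"
      by (rule rho_left_estimate[OF a k(1) w(1) B(2) cl])
    also have "\<eta> * measure M X \<le> e / 6"
    proof -
      have "e * measure M X \<le> e / 6 * (6 * (measure M X + 1))" using e by (simp add: algebra_simps)
      moreover have "6 * (measure M X + 1) > 0" by (simp add: add_nonneg_pos)
      ultimately have "e * measure M X / (6 * (measure M X + 1)) \<le> e / 6"
        by (simp only: pos_divide_le_eq)
      then show ?thesis by (simp add: \<eta>_def)
    qed
    also have "B * rho k one \<le> e / 6"
      using sk(2) B(1) by (simp add: \<delta>_def field_simps)
    finally have "rho (a \<odot> k) a < e/2" using w(2) by linarith
    moreover have "sup_dist (a \<odot> k) a < e/2" using d2(2) k(1) sk(1) by (simp add: \<delta>_def)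
    ultimately show ?thesis by linarith
  qed
  then show ?thesis using \<delta> by blast
qed

abbreviation tco where "tco \<equiv> tau_co (top_of_set X) M"
abbreviation tac where "tac \<equiv> tau_ac (top_of_set X) M"

lemma tau_co_eq: "tco = Metric_space.mtopology G sup_dist"
proof -
  interpret ms: Metric_space G sup_dist by (rule Metric_space_sup_dist)
  define S where "S = {{f \<in> extensional (topspace (top_of_set X)). continuous_map (top_of_set X) (top_of_set X) f \<and> f ` K \<subseteq> U} | K U.
          compactin (top_of_set X) K \<and> openin (top_of_set X) U}"
  have co: "compact_open_topology (top_of_set X) (top_of_set X) = topology_generated_by S"
    by (simp add: compact_open_topology_def S_def)
  have basis: "openin ms.mtopology (B \<inter> G)" if "B \<in> S" for B
  proof -
    from that obtain K U where B: "B = {f \<in> extensional X. continuous_map (top_of_set X) (top_of_set X) f \<and> f ` K \<subseteq> U}"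
      and K: "compact K" "K \<subseteq> X" and U: "openin (top_of_set X) U"
      unfolding S_def by (auto simp: compactin_subtopology)
    have BG: "B \<inter> G = {f \<in> G. f ` K \<subseteq> U}"
      by (auto simp: B G_iff bij_betw_def)
    have "\<exists>r>0. ms.mball g r \<subseteq> B \<inter> G" if g: "g \<in> B \<inter> G" for g
    proof -
      obtain W where W: "open W" "U = X \<inter> W" using U by (auto simp: openin_open)
      have gK: "g ` K \<subseteq> W" "g \<in> G" using g W by (auto simp: BG)
      have "compact (g ` K)"
        using K gK by (intro compact_continuous_image continuous_on_subset[OF G_continuous]) auto
      then obtain r where r: "r > 0" "(\<Union>x\<in>g ` K. ball x r) \<subseteq> W"
        using compact_subset_open_imp_ball_epsilon_subset[OF _ W(1) gK(1)] by blast
      have "h \<in> B \<inter> G" if h: "h \<in> ms.mball g r" for h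
      proof -
        have hG: "h \<in> G" "sup_dist g h < r" using h by auto
        have "h x \<in> U" if "x \<in> K" for x
        proof -
          have "dist (g x) (h x) < r" using dist_le_sup_dist[OF gK(2) hG(1), of x] hG K that by auto
          then have "h x \<in> ball (g x) r" by simp
          then have "h x \<in> W" using r(2) that by blast
          then show ?thesis using that G_in[OF hG(1)] K W by auto
        qed
        then show ?thesis using hG by (auto simp: BG)
      qed
      then show ?thesis using r(1) by blast
    qed
    then show ?thesis unfolding ms.openin_mtopology by blast
  qed
  have "openin tco U \<longleftrightarrow> openin ms.mtopology U" for U
  proof
    assume "openin tco U"
    then obtain W where W: "openin (topology_generated_by S) W" "U = W \<inter> G"
      unfolding tau_co_def co by (auto simp: openin_subtopology)
    have "generate_topology_on S W" using W(1) by (rule openin_topology_generated_by)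
    then have "openin ms.mtopology (W \<inter> G)"
    proof induction
      case (Int a b)
      then have "openin ms.mtopology ((a \<inter> G) \<inter> (b \<inter> G))" by blast
      then show ?case by (simp add: Int_ac)
    next
      case (UN K)
      have "\<Union>K \<inter> G = (\<Union>k\<in>K. k \<inter> G)" by auto
      moreover have "openin ms.mtopology (\<Union>k\<in>K. k \<inter> G)" using UN by (intro openin_Union) auto
      ultimately show ?case by simp
    qed (use basis in auto)
    then show "openin ms.mtopology U" using W(2) by simp
  next
    assume U: "openin ms.mtopology U"
    show "openin tco U"
    proof (subst openin_subopen, intro ballI)
      fix g assume g: "g \<in> U"
      then obtain r where r: "r > 0" "ms.mball g r \<subseteq> U" using U by (auto simp: ms.openin_mtopology)
      have gG: "g \<in> G" using g U by (auto simp: ms.openin_mtopology)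
      have "uniformly_continuous_on X g"
        by (rule compact_uniformly_continuous[OF G_continuous[OF gG] compact])
      then obtain d where d: "d > 0" "\<forall>x\<in>X. \<forall>x'\<in>X. dist x' x < d \<longrightarrow> dist (g x') (g x) < r/3"
        unfolding uniformly_continuous_on_def using r(1) by (metis divide_pos_pos zero_less_numeral)
      \<comment> \<open>Finitely many conditions, each sending a small closed ball around a centre into a small ball
        around its image, already force uniform closeness.\<close>
      obtain C where C: "finite C" "C \<subseteq> X" "X \<subseteq> (\<Union>c\<in>C. ball c (d/2))"
        using compactE_image[OF compact, of X "\<lambda>c. ball c (d/2)"] d(1) by (metis (no_types, lifting) UN_I centre_in_ball half_gt_zero open_ball subsetI)
      have "C \<noteq> {}" using C(3) nonempty by auto
      define N where "N c = {f \<in> extensional X. continuous_map (top_of_set X) (top_of_set X) f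
          \<and> f ` (X \<inter> cball c (d/2)) \<subseteq> X \<inter> ball (g c) (r/3)}" for c
      have NS: "N c \<in> S" for c
        unfolding S_def N_def using compact
        by (intro CollectI exI[of _ "X \<inter> cball c (d/2)"] exI[of _ "X \<inter> ball (g c) (r/3)"])
           (auto simp: compactin_subtopology intro: compact_Int_closed)
      have "openin (topology_generated_by S) (\<Inter>(N ` C))"
        using C(1) \<open>C \<noteq> {}\<close> NS by (intro openin_Inter) (auto intro: topology_generated_by_Basis)
      then have "openin tco (\<Inter>(N ` C) \<inter> G)"
        unfolding tau_co_def co by (auto simp: openin_subtopology)
      moreover have "g \<in> \<Inter>(N ` C) \<inter> G"
        using gG C(2) d by (auto simp: N_def G_iff bij_betw_def dist_commute subset_iff)
      moreover have "\<Inter>(N ` C) \<inter> G \<subseteq> U"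
      proof
        fix h assume h: "h \<in> \<Inter>(N ` C) \<inter> G"
        have "dist (g x) (h x) \<le> 2*r/3" if x: "x \<in> X" for x
        proof -
          obtain c where c: "c \<in> C" "x \<in> ball c (d/2)" using C(3) x by blast
          have "h x \<in> ball (g c) (r/3)" using h c x by (fastforce simp: N_def)
          moreover have "dist (g c) (g x) < r/3"
          proof -
            have "dist c x < d" using c(2) d(1) by simp
            then show ?thesis using d(2) c(1) C(2) x by blast
          qed
          ultimately show ?thesis using dist_triangle3[of "g x" "h x" "g c"] by simp
        qed
        then have "sup_dist g h \<le> 2*r/3" using h gG by (subst sup_dist_le_iff) auto
        then have "h \<in> ms.mball g r" using h gG r(1) by auto
        then show "h \<in> U" using r(2) by blast
      qed
      ultimately show "\<exists>T. openin tco T \<and> g \<in> T \<and> T \<subseteq> U" by blast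
    qed
  qed
  then show ?thesis by (simp add: topology_eq)
qed

lemma tau_ac_eq: "tac = Metric_space.mtopology G (\<lambda>g h. sup_dist g h + rho g h)"
proof -
  interpret ms: Metric_space G sup_dist by (rule Metric_space_sup_dist)
  interpret ma: Metric_space G "\<lambda>g h. sup_dist g h + rho g h" by (rule Metric_space_ac)
  have co: "openin ma.mtopology U" if "openin tco U" for U
  proof -
    have U: "U \<subseteq> G" "\<And>x. x \<in> U \<Longrightarrow> \<exists>r>0. ms.mball x r \<subseteq> U"
      using that by (auto simp: tau_co_eq ms.openin_mtopology)
    have "\<exists>r>0. ma.mball x r \<subseteq> U" if xU: "x \<in> U" for x
    proof -
      obtain r where r: "r > 0" "ms.mball x r \<subseteq> U" using U(2)[OF xU] by blast
      have "ma.mball x r \<subseteq> ms.mball x r"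
      proof
        fix y assume "y \<in> ma.mball x r"
        then have "x \<in> G" "y \<in> G" "sup_dist x y + rho x y < r" by auto
        then show "y \<in> ms.mball x r" using rho_nonneg[of x y] by (simp del: rho_nonneg)
      qed
      then show ?thesis using r by blast
    qed
    then show ?thesis using U(1) by (auto simp: ma.openin_mtopology)
  qed
  have ball: "openin ma.mtopology {h \<in> G. rho g h < e}" if "g \<in> G" for g e
  proof -
    have "\<exists>r>0. ma.mball x r \<subseteq> {h \<in> G. rho g h < e}" if x: "x \<in> G" "rho g x < e" for x
    proof (intro exI conjI)
      show "e - rho g x > 0" using x by simp
      show "ma.mball x (e - rho g x) \<subseteq> {h \<in> G. rho g h < e}"
      proof
        fix y assume y: "y \<in> ma.mball x (e - rho g x)"
        then have "sup_dist x y + rho x y < e - rho g x" and yG: "y \<in> G" by auto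
        then have "rho x y < e - rho g x" using sup_dist_nonneg[of x y] by linarith
        then show "y \<in> {h \<in> G. rho g h < e}" using rho_triangle[OF \<open>g \<in> G\<close> x(1) yG] yG by auto
      qed
    qed
    then show ?thesis by (auto simp: ma.openin_mtopology)
  qed
  have "openin tac U \<longleftrightarrow> openin ma.mtopology U" for U
  proof
    assume "openin tac U"
    then show "openin ma.mtopology U"
      unfolding tau_ac_def
    proof (rule generated_coarser[rotated])
      fix B assume "B \<in> {U. openin tco U} \<union> {U. openin (tau_rho (top_of_set X) M) U}"
      then show "openin ma.mtopology B"
        using co generated_coarser[of "{{h \<in> G. rho g h < e} |g e. g \<in> G \<and> 0 < e}" ma.mtopology B] ball
        by (auto simp: tau_rho_def)
    qed
  next
    assume U: "openin ma.mtopology U"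
    show "openin tac U"
    proof (subst openin_subopen, intro ballI)
      fix g assume g: "g \<in> U"
      then have gG: "g \<in> G" using U by (auto simp: ma.openin_mtopology)
      obtain r where r: "r > 0" "ma.mball g r \<subseteq> U" using U g by (auto simp: ma.openin_mtopology)
      let ?R = "{h \<in> G. rho g h < r/2}"
      have "openin tac (ms.mball g (r/2))"
        unfolding tau_ac_def by (rule topology_generated_by_Basis) (simp add: tau_co_eq)
      moreover have "openin (tau_rho (top_of_set X) M) ?R"
        unfolding tau_rho_def using gG r(1) half_gt_zero[OF r(1)] by (intro topology_generated_by_Basis) blast
      then have "openin tac ?R"
        unfolding tau_ac_def by (intro topology_generated_by_Basis) simp
      ultimately have "openin tac (ms.mball g (r/2) \<inter> ?R)" by blast
      moreover have "g \<in> ms.mball g (r/2) \<inter> ?R" using gG r(1) by simp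
      moreover have "ms.mball g (r/2) \<inter> ?R \<subseteq> ma.mball g r" by auto
      ultimately show "\<exists>T. openin tac T \<and> g \<in> T \<and> T \<subseteq> U" using r(2) by blast
    qed
  qed
  then show ?thesis by (simp add: topology_eq)
qed

lemma group_topology_tau_co: "group_topology GG tco"
  unfolding tau_co_eq
  using right_invariant_metric_group_topology[OF group_GG, of sup_dist] Metric_space_sup_dist
    sup_dist_right_invariant sup_dist_left_continuous by simp

lemma group_topology_tau_ac: "group_topology GG tac"
  unfolding tau_ac_eq
  using right_invariant_metric_group_topology[OF group_GG, of "\<lambda>g h. sup_dist g h + rho g h"] Metric_space_ac
    sup_dist_right_invariant rho_right_invariant ac_left_continuous by simp

sublocale co: topological_group GG tco
  by unfold_locales (rule group_topology_tau_co)

sublocale ac: topological_group GG tac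
  by unfold_locales (rule group_topology_tau_ac)

lemma Hausdorff_tau_co: "Hausdorff_space tco"
  unfolding tau_co_eq by (rule Metric_space.Hausdorff_space_mtopology[OF Metric_space_sup_dist])

lemma Hausdorff_tau_ac: "Hausdorff_space tac"
  unfolding tau_ac_eq by (rule Metric_space.Hausdorff_space_mtopology[OF Metric_space_ac])

lemma coarser_co_ac: "coarser_topology tco tac"
  unfolding coarser_topology_def tau_ac_def by (auto intro: topology_generated_by_Basis)

lemma co_nbhd_ball: "e > 0 \<Longrightarrow> co.nbhd {h \<in> G. sup_dist h one < e}"
proof -
  interpret ms: Metric_space G sup_dist by (rule Metric_space_sup_dist)
  assume "e > 0"
  moreover have "{h \<in> G. sup_dist h one < e} = ms.mball one e" by (auto simp: sup_dist_commute)
  ultimately show ?thesis unfolding co.nbhd_def by (simp add: tau_co_eq)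
qed

lemma co_nbhd_contains_ball:
  assumes "co.nbhd V"
  obtains e where "e > 0" "\<And>h. h \<in> G \<Longrightarrow> sup_dist h one < e \<Longrightarrow> h \<in> V"
proof -
  interpret ms: Metric_space G sup_dist by (rule Metric_space_sup_dist)
  obtain r where "r > 0" "ms.mball one r \<subseteq> V"
    using assms unfolding co.nbhd_def by (auto simp: tau_co_eq ms.openin_mtopology)
  then show ?thesis using that[of r] by (auto simp: sup_dist_commute subset_iff)
qed

lemma ac_nbhd_contains_ball:
  assumes "ac.nbhd V"
  obtains e where "e > 0" "\<And>h. h \<in> G \<Longrightarrow> sup_dist h one + rho h one < e \<Longrightarrow> h \<in> V"
proof -
  interpret ma: Metric_space G "\<lambda>g h. sup_dist g h + rho g h" by (rule Metric_space_ac)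
  obtain r where "r > 0" "ma.mball one r \<subseteq> V"
    using assms unfolding ac.nbhd_def by (auto simp: tau_ac_eq ma.openin_mtopology)
  then show ?thesis using that[of r] by (auto simp: sup_dist_commute rho_commute subset_iff)
qed

end

section \<open>The Hellinger affinity\<close>

lemma Cauchy_Schwarz_integral:
  fixes f g :: "'a \<Rightarrow> real"
  assumes f: "integrable M (\<lambda>x. (f x)\<^sup>2)" and g: "integrable M (\<lambda>x. (g x)\<^sup>2)"
    and fg: "integrable M (\<lambda>x. f x * g x)"
  shows "(\<integral>x. f x * g x \<partial>M)\<^sup>2 \<le> (\<integral>x. (f x)\<^sup>2 \<partial>M) * (\<integral>x. (g x)\<^sup>2 \<partial>M)"
proof -
  let ?A = "\<integral>x. (f x)\<^sup>2 \<partial>M" and ?B = "\<integral>x. f x * g x \<partial>M" and ?C = "\<integral>x. (g x)\<^sup>2 \<partial>M"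
  have q: "0 \<le> ?A - 2 * t * ?B + t\<^sup>2 * ?C" for t
  proof -
    have "0 \<le> (\<integral>x. (f x - t * g x)\<^sup>2 \<partial>M)" by simp
    also have "\<dots> = (\<integral>x. (f x)\<^sup>2 - 2 * t * (f x * g x) + t\<^sup>2 * (g x)\<^sup>2 \<partial>M)"
      by (intro Bochner_Integration.integral_cong) (auto simp: power2_eq_square algebra_simps)
    also have "\<dots> = ?A - 2 * t * ?B + t\<^sup>2 * ?C" using f g fg by simp
    finally show ?thesis .
  qed
  have C0: "0 \<le> ?C" by simp
  show ?thesis
  proof (cases "?C = 0")
    case True
    have "?B = 0"
    proof (rule ccontr)
      assume "?B \<noteq> 0"
      then show False using q[of "(?A + 1) / (2 * ?B)"] True by simp
    qed
    then show ?thesis by simp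
  next
    case False
    then have C: "?C > 0" using C0 by linarith
    have "0 \<le> ?A - 2 * (?B / ?C) * ?B + (?B / ?C)\<^sup>2 * ?C" by (rule q)
    also have "\<dots> = ?A - ?B\<^sup>2 / ?C" using C by (simp add: power2_eq_square field_simps)
    finally show ?thesis using C by (simp add: field_simps)
  qed
qed

context compact_measure
begin

text \<open>The affinity of the measure \<open>M\<close> and its pullback under \<open>f\<close>, restricted to \<open>K\<close>. It is
  additive in \<open>K\<close>, and square roots turn the chain rule into an inner product in \<open>L\<^sup>2\<close>.\<close>

definition hell :: "'a set \<Rightarrow> ('a \<Rightarrow> 'a) \<Rightarrow> real" where
  "hell K f = (LINT x:K|M. sqrt (D f x))"

lemma sqrt_D_integrable:
  assumes "f \<in> G"
  shows "integrable M (\<lambda>x. sqrt (D f x))"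
proof (rule Bochner_Integration.integrable_bound)
  show "integrable M (\<lambda>x. 1 + D f x)" using D_integrable[OF assms] by simp
  show "AE x in M. norm (sqrt (D f x)) \<le> norm (1 + D f x)"
  proof (rule AE_I2)
    fix x
    have "0 \<le> (sqrt (D f x) - 1/2)\<^sup>2" by simp
    then have "sqrt (D f x) \<le> 1 + D f x" by (simp add: power2_diff power_divide)
    then show "norm (sqrt (D f x)) \<le> norm (1 + D f x)" by simp
  qed
qed measurable

lemma hell_set_integrable:
  assumes "f \<in> G" "K \<in> sets M"
  shows "set_integrable M K (\<lambda>x. sqrt (D f x))"
  unfolding set_integrable_def using integrable_mult_indicator[OF assms(2) sqrt_D_integrable[OF assms(1)]] .

lemma hell_nonneg [simp]: "0 \<le> hell K f"
  by (simp add: hell_def set_lebesgue_integral_def)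

lemma hell_mono:
  assumes "f \<in> G" "K \<in> sets M" "L \<in> sets M" "K \<subseteq> L"
  shows "hell K f \<le> hell L f"
  unfolding hell_def set_lebesgue_integral_def
  using hell_set_integrable[OF assms(1)] assms
  by (intro integral_mono) (auto simp: set_integrable_def indicator_def)

lemma hell_Un_le:
  assumes "f \<in> G" "K \<in> sets M" "L \<in> sets M"
  shows "hell (K \<union> L) f \<le> hell K f + hell L f"
proof -
  have i: "integrable M (\<lambda>x. indicator A x *\<^sub>R sqrt (D f x))" if "A \<in> sets M" for A
    using hell_set_integrable[OF assms(1) that] by (simp add: set_integrable_def)
  have "hell (K \<union> L) f \<le> (\<integral>x. indicator K x *\<^sub>R sqrt (D f x) + indicator L x *\<^sub>R sqrt (D f x) \<partial>M)"
    unfolding hell_def set_lebesgue_integral_def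
    by (intro integral_mono Bochner_Integration.integrable_add i assms sets.Un)
      (auto simp: indicator_def)
  also have "\<dots> = hell K f + hell L f"
    unfolding hell_def set_lebesgue_integral_def using i assms
    by (intro Bochner_Integration.integral_add)
  finally show ?thesis .
qed

lemma hell_Union_disjoint:
  assumes f: "f \<in> G" and I: "finite I" "\<And>i. i \<in> I \<Longrightarrow> K i \<in> sets M" "disjoint_family_on K I"
  shows "hell (\<Union>i\<in>I. K i) f = (\<Sum>i\<in>I. hell (K i) f)"
  unfolding hell_def using I hell_set_integrable[OF f]
  by (intro set_integral_finite_Union) (auto simp: disjoint_family_on_def)

lemma hell_sq_le:
  assumes f: "f \<in> G" and K: "K \<in> sets M"
  shows "(hell K f)\<^sup>2 \<le> measure M K * measure M X"
proof -
  let ?i = "\<lambda>x. indicator K x :: real" and ?s = "\<lambda>x. sqrt (D f x)"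
  have "(\<integral>x. ?i x * ?s x \<partial>M)\<^sup>2 \<le> (\<integral>x. (?i x)\<^sup>2 \<partial>M) * (\<integral>x. (?s x)\<^sup>2 \<partial>M)"
  proof (rule Cauchy_Schwarz_integral)
    show "integrable M (\<lambda>x. (?s x)\<^sup>2)" using D_integrable[OF f] by simp
    have "(\<lambda>x. (?i x)\<^sup>2) = ?i" by (auto simp: indicator_def)
    then show "integrable M (\<lambda>x. (?i x)\<^sup>2)" using K by (simp add: emeasure_eq_measure)
    show "integrable M (\<lambda>x. ?i x * ?s x)"
      using hell_set_integrable[OF f K] by (simp add: set_integrable_def)
  qed
  moreover have "(\<integral>x. (?i x)\<^sup>2 \<partial>M) = measure M K"
  proof -
    have "(\<lambda>x. (?i x)\<^sup>2) = ?i" by (auto simp: indicator_def)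
    then show ?thesis using K by simp
  qed
  moreover have "(\<integral>x. (?s x)\<^sup>2 \<partial>M) = measure M X" using measure_X_D[OF f] by simp
  ultimately show ?thesis by (simp add: hell_def set_lebesgue_integral_def)
qed

lemma hell_le: "f \<in> G \<Longrightarrow> K \<in> sets M \<Longrightarrow> hell K f \<le> sqrt (measure M K * measure M X)"
  using hell_sq_le real_le_rsqrt by blast

lemma hell_X: "hell X f = (\<integral>x. sqrt (D f x) \<partial>M)"
  unfolding hell_def set_lebesgue_integral_def
  by (intro Bochner_Integration.integral_cong) (auto simp: space_M)

lemma hell_X_le: "f \<in> G \<Longrightarrow> hell X f \<le> measure M X"
  using hell_le[of f X] by (simp flip: power2_eq_square)

text \<open>Cauchy--Schwarz for \<open>\<bar>D f - 1\<bar> = \<bar>sqrt (D f) - 1\<bar> * (sqrt (D f) + 1)\<close>. Consequently, maps that stay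
  away from the identity for \<open>rho\<close> have an affinity that stays below the total mass.\<close>

lemma rho_sq_le_hell:
  assumes f: "f \<in> G"
  shows "(rho f one)\<^sup>2 \<le> 8 * measure M X * (measure M X - hell X f)"
proof -
  let ?s = "\<lambda>x. sqrt (D f x)"
  have si: "integrable M ?s" "integrable M (\<lambda>x. (?s x)\<^sup>2)"
    using D_integrable[OF f] sqrt_D_integrable[OF f] by auto
  have e: "(?s x - 1)\<^sup>2 = (?s x)\<^sup>2 - 2 * ?s x + 1" "(?s x + 1)\<^sup>2 = (?s x)\<^sup>2 + 2 * ?s x + 1" for x
    by (simp_all only: power2_diff power2_sum) simp_all
  have m: "\<bar>D f x - 1\<bar> = \<bar>?s x - 1\<bar> * (?s x + 1)" for x
  proof -
    have "D f x - 1 = (?s x - 1) * (?s x + 1)" by (simp add: algebra_simps)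
    then show ?thesis by (simp add: abs_mult)
  qed
  have "(rho f one)\<^sup>2 = (\<integral>x. \<bar>?s x - 1\<bar> * (?s x + 1) \<partial>M)\<^sup>2"
    unfolding rho_one_eq m ..
  also have "\<dots> \<le> (\<integral>x. \<bar>?s x - 1\<bar>\<^sup>2 \<partial>M) * (\<integral>x. (?s x + 1)\<^sup>2 \<partial>M)"
  proof (rule Cauchy_Schwarz_integral)
    show "integrable M (\<lambda>x. \<bar>?s x - 1\<bar>\<^sup>2)" "integrable M (\<lambda>x. (?s x + 1)\<^sup>2)"
      unfolding power2_abs e using si by (auto simp del: real_sqrt_pow2_iff real_sqrt_pow2)
    show "integrable M (\<lambda>x. \<bar>?s x - 1\<bar> * (?s x + 1))"
      unfolding m[symmetric] using D_integrable[OF f] by simp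
  qed
  also have "(\<integral>x. \<bar>?s x - 1\<bar>\<^sup>2 \<partial>M) = 2 * (measure M X - hell X f)"
  proof -
    have "(\<integral>x. \<bar>?s x - 1\<bar>\<^sup>2 \<partial>M) = (\<integral>x. D f x - 2 * ?s x + 1 \<partial>M)"
      unfolding power2_abs e by simp
    also have "\<dots> = (\<integral>x. D f x \<partial>M) - 2 * hell X f + measure M X"
      using si D_integrable[OF f] by (simp add: hell_X space_M)
    finally show ?thesis by (simp add: measure_X_D[OF f])
  qed
  also have "(\<integral>x. (?s x + 1)\<^sup>2 \<partial>M) = 2 * (measure M X + hell X f)"
  proof -
    have "(\<integral>x. (?s x + 1)\<^sup>2 \<partial>M) = (\<integral>x. D f x + 2 * ?s x + 1 \<partial>M)"
      unfolding e by simp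
    also have "\<dots> = (\<integral>x. D f x \<partial>M) + 2 * hell X f + measure M X"
      using si D_integrable[OF f] by (simp add: hell_X space_M)
    finally show ?thesis by (simp add: measure_X_D[OF f])
  qed
  also have "2 * (measure M X - hell X f) * (2 * (measure M X + hell X f))
     \<le> 2 * (measure M X - hell X f) * (4 * measure M X)"
    using hell_X_le[OF f] by (intro mult_left_mono) auto
  finally show ?thesis by (simp add: algebra_simps)
qed

lemma sqrt_diff_sq_le: "0 \<le> a \<Longrightarrow> 0 \<le> b \<Longrightarrow> (sqrt a - b)\<^sup>2 \<le> \<bar>a - b\<^sup>2\<bar>"
proof -
  assume "0 \<le> a" "0 \<le> b"
  have "(sqrt a - b)\<^sup>2 = \<bar>sqrt a - b\<bar> * \<bar>sqrt a - b\<bar>" by (simp add: power2_eq_square)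
  also have "\<dots> \<le> \<bar>sqrt a - b\<bar> * (sqrt a + b)"
    using \<open>0 \<le> a\<close> \<open>0 \<le> b\<close> by (intro mult_left_mono) (auto simp: abs_le_iff)
  also have "\<dots> = \<bar>(sqrt a - b) * (sqrt a + b)\<bar>"
    using \<open>0 \<le> a\<close> \<open>0 \<le> b\<close> by (simp add: abs_mult)
  also have "(sqrt a - b) * (sqrt a + b) = a - b\<^sup>2"
    using \<open>0 \<le> a\<close> by (simp add: algebra_simps power2_eq_square)
  finally show ?thesis .
qed

text \<open>The chain rule writes the affinity of the product as the integral of
  \<open>sqrt (D f1) \<circ> f2\<close> times \<open>sqrt (D f2)\<close>. Composition with \<open>f2\<close> followed by multiplication with
  \<open>sqrt (D f2)\<close> is an isometry of \<open>L\<^sup>2\<close>, and so replacing \<open>sqrt (D f1)\<close> by a continuous \<open>w\<close> costs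
  the same \<open>L\<^sup>2\<close> error in both inequalities. Continuity of \<open>w\<close> is what later makes \<open>w \<circ> f2\<close> close
  to \<open>w\<close>.\<close>

lemma hell_product_le:
  assumes f1: "f1 \<in> G" and f2: "f2 \<in> G" and w: "continuous_on X w" "\<And>x. x \<in> X \<Longrightarrow> 0 \<le> w x"
  shows "hell X (f1 \<odot> f2) \<le> (\<integral>x. w (f2 x) * sqrt (D f2 x) \<partial>M)
      + sqrt (measure M X * (\<integral>x. \<bar>D f1 x - (w x)\<^sup>2\<bar> \<partial>M))"
    and "(\<integral>x. w x \<partial>M) \<le> hell X f1 + sqrt (measure M X * (\<integral>x. \<bar>D f1 x - (w x)\<^sup>2\<bar> \<partial>M))"
proof -
  have [measurable]: "f2 \<in> measurable M M" by (rule G_measurable[OF f2])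
  have wm [measurable]: "w \<in> borel_measurable M" by (rule continuous_measurable[OF w(1)])
  have w2: "integrable M (\<lambda>x. (w x)\<^sup>2)" by (intro continuous_integrable continuous_intros w)
  have wi: "integrable M w" by (intro continuous_integrable w)
  let ?u = "\<lambda>x. \<bar>sqrt (D f1 x) - w x\<bar>"
  let ?I = "\<integral>x. \<bar>D f1 x - (w x)\<^sup>2\<bar> \<partial>M"
  have Ii: "integrable M (\<lambda>x. \<bar>D f1 x - (w x)\<^sup>2\<bar>)" using D_integrable[OF f1] w2 by auto
  have u2: "integrable M (\<lambda>x. (?u x)\<^sup>2)"
  proof (rule Bochner_Integration.integrable_bound[OF Ii])
    show "AE x in M. norm ((?u x)\<^sup>2) \<le> norm \<bar>D f1 x - (w x)\<^sup>2\<bar>"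
      using sqrt_diff_sq_le w(2) by (intro AE_I2) (auto simp: space_M)
  qed measurable
  have u2I: "(\<integral>x. (?u x)\<^sup>2 \<partial>M) \<le> ?I"
    using sqrt_diff_sq_le w(2) by (intro integral_mono u2 Ii) (auto simp: space_M)
  have ui: "integrable M ?u" using sqrt_D_integrable[OF f1] wi by auto
  have I0: "0 \<le> ?I" by simp
  have "(\<integral>x. ?u x * 1 \<partial>M)\<^sup>2 \<le> (\<integral>x. (?u x)\<^sup>2 \<partial>M) * (\<integral>x. 1\<^sup>2 \<partial>M)"
    using u2 ui by (intro Cauchy_Schwarz_integral) auto
  also have "\<dots> \<le> ?I * measure M X" using u2I by (simp add: space_M mult_right_mono)
  finally have uI: "(\<integral>x. ?u x \<partial>M) \<le> sqrt (measure M X * ?I)"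
    using real_le_rsqrt by (simp add: mult.commute)
  have "(\<integral>x. w x \<partial>M) \<le> (\<integral>x. sqrt (D f1 x) + ?u x \<partial>M)"
    using wi ui sqrt_D_integrable[OF f1] by (intro integral_mono) auto
  also have "\<dots> = hell X f1 + (\<integral>x. ?u x \<partial>M)"
    using ui sqrt_D_integrable[OF f1] by (simp add: hell_X)
  finally show "(\<integral>x. w x \<partial>M) \<le> hell X f1 + sqrt (measure M X * ?I)" using uI by linarith
  \<comment> \<open>The same estimate after the substitution f2, under which the error u is carried to v.\<close>
  let ?v = "\<lambda>x. ?u (f2 x) * sqrt (D f2 x)"
  have v2: "(\<lambda>x. (?v x)\<^sup>2) = (\<lambda>x. (?u (f2 x))\<^sup>2 * D f2 x)" by (auto simp: power_mult_distrib)
  have v2i: "integrable M (\<lambda>x. (?v x)\<^sup>2)"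
    unfolding v2 using integral_change(2)[OF f2, of "\<lambda>x. (?u x)\<^sup>2"] u2 by simp
  have v2I: "(\<integral>x. (?v x)\<^sup>2 \<partial>M) \<le> ?I"
    unfolding v2 using integral_change(1)[OF f2, of "\<lambda>x. (?u x)\<^sup>2"] u2I by simp
  have vm [measurable]: "?v \<in> borel_measurable M" by measurable
  have vi: "integrable M ?v"
  proof (rule Bochner_Integration.integrable_bound)
    show "integrable M (\<lambda>x. 1 + (?v x)\<^sup>2)" using v2i by simp
    show "AE x in M. norm (?v x) \<le> norm (1 + (?v x)\<^sup>2)"
    proof (rule AE_I2)
      fix x
      have "0 \<le> (?v x - 1/2)\<^sup>2" by simp
      then have "?v x \<le> 1 + (?v x)\<^sup>2" by (simp only: power2_diff) (simp add: power2_eq_square)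
      moreover have "0 \<le> ?v x" by simp
      ultimately show "norm (?v x) \<le> norm (1 + (?v x)\<^sup>2)" by simp
    qed
  qed measurable
  have "(\<integral>x. ?v x * 1 \<partial>M)\<^sup>2 \<le> (\<integral>x. (?v x)\<^sup>2 \<partial>M) * (\<integral>x. 1\<^sup>2 \<partial>M)"
    using v2i vi by (intro Cauchy_Schwarz_integral) auto
  also have "\<dots> \<le> ?I * measure M X" using v2I by (simp add: space_M mult_right_mono)
  finally have vI: "(\<integral>x. ?v x \<partial>M) \<le> sqrt (measure M X * ?I)"
    using real_le_rsqrt by (simp add: mult.commute)
  have wv: "integrable M (\<lambda>x. w (f2 x) * sqrt (D f2 x))"
  proof -
    have "bounded (w ` X)" by (intro compact_imp_bounded compact_continuous_image w compact)
    then obtain B where B: "\<And>x. x \<in> X \<Longrightarrow> \<bar>w x\<bar> \<le> B" by (auto simp: bounded_iff)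
    show ?thesis
    proof (rule Bochner_Integration.integrable_bound)
      show "integrable M (\<lambda>x. B * sqrt (D f2 x))" using sqrt_D_integrable[OF f2] by simp
      show "AE x in M. norm (w (f2 x) * sqrt (D f2 x)) \<le> norm (B * sqrt (D f2 x))"
      proof (rule AE_I2)
        fix x assume "x \<in> space M"
        then have "\<bar>w (f2 x)\<bar> \<le> \<bar>B\<bar>" using B[OF G_in[OF f2]] by (fastforce simp: space_M)
        then show "norm (w (f2 x) * sqrt (D f2 x)) \<le> norm (B * sqrt (D f2 x))"
          by (simp add: abs_mult mult_right_mono)
      qed
    qed measurable
  qed
  have "hell X (f1 \<odot> f2) = (\<integral>x. sqrt (D f1 (f2 x)) * sqrt (D f2 x) \<partial>M)"
    unfolding hell_X
  proof (rule integral_cong_AE)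
    show "AE x in M. sqrt (D (f1 \<odot> f2) x) = sqrt (D f1 (f2 x)) * sqrt (D f2 x)"
      using D_chain[OF f1 f2] by eventually_elim (simp add: real_sqrt_mult)
  qed measurable
  also have "\<dots> \<le> (\<integral>x. w (f2 x) * sqrt (D f2 x) + ?v x \<partial>M)"
  proof (rule integral_mono')
    show "integrable M (\<lambda>x. w (f2 x) * sqrt (D f2 x) + ?v x)" using wv vi by simp
    fix x
    have "sqrt (D f1 (f2 x)) \<le> w (f2 x) + ?u (f2 x)" by linarith
    then show "sqrt (D f1 (f2 x)) * sqrt (D f2 x) \<le> w (f2 x) * sqrt (D f2 x) + ?v x"
      by (simp flip: distrib_right add: mult_right_mono)
  qed (use w(2) G_in[OF f2] in \<open>auto simp: space_M\<close>)
  also have "\<dots> = (\<integral>x. w (f2 x) * sqrt (D f2 x) \<partial>M) + (\<integral>x. ?v x \<partial>M)"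
    using wv vi by simp
  finally show "hell X (f1 \<odot> f2) \<le> (\<integral>x. w (f2 x) * sqrt (D f2 x) \<partial>M) + sqrt (measure M X * ?I)"
    using vI by linarith
qed

lemma D_approx_square:
  assumes f: "f \<in> G" and e: "e > 0"
  obtains w where "continuous_on UNIV w" "\<And>x. 0 \<le> (w x :: real)" "(\<integral>x. \<bar>D f x - (w x)\<^sup>2\<bar> \<partial>M) < e"
proof -
  obtain v where v: "continuous_on UNIV v" "(\<integral>x. \<bar>D f x - v x\<bar> \<partial>M) < e"
    using L1_approx_continuous[OF D_integrable[OF f]] e by blast
  let ?w = "\<lambda>x. sqrt (max 0 (v x))"
  have vi: "integrable M v" by (intro continuous_integrable continuous_on_subset[OF v(1)]) simp
  have "continuous_on UNIV ?w" using v(1) by (intro continuous_intros)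
  moreover have "(\<integral>x. \<bar>D f x - (?w x)\<^sup>2\<bar> \<partial>M) \<le> (\<integral>x. \<bar>D f x - v x\<bar> \<partial>M)"
  proof (rule integral_mono')
    show "integrable M (\<lambda>x. \<bar>D f x - v x\<bar>)" using vi D_integrable[OF f] by simp
    fix x show "\<bar>D f x - (?w x)\<^sup>2\<bar> \<le> \<bar>D f x - v x\<bar>"
    proof (cases "0 \<le> v x")
      case False
      then have "\<bar>D f x\<bar> \<le> \<bar>D f x - v x\<bar>" using D_nonneg[of f x] by linarith
      then show ?thesis using False by (simp add: max_def)
    qed (simp add: max_def)
  qed simp
  ultimately show ?thesis using v(2) by (intro that[of ?w]) auto
qed

text \<open>On \<open>{1 \<le> D f}\<close> the integrand \<open>sqrt (D f)\<close> is at least 1, and off this set it dominates \<open>D f\<close>. So a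
  small affinity makes this set small and the image of its complement small.\<close>

lemma hell_small_singular:
  assumes f: "f \<in> G" and h: "hell X f < e"
  obtains A where "A \<in> sets M" "measure M A < e" "measure M X - e < measure M (f ` A)"
proof
  let ?A = "{x \<in> space M. 1 \<le> D f x}"
  let ?B = "space M - ?A"
  show A [measurable]: "?A \<in> sets M" by measurable
  have B: "?B \<in> sets M" using A by (rule sets.compl_sets)
  have "measure M ?A = (\<integral>x. indicator ?A x \<partial>M)" by simp
  also have "\<dots> \<le> (\<integral>x. sqrt (D f x) \<partial>M)"
    using sqrt_D_integrable[OF f] by (intro integral_mono') (auto simp: indicator_def)
  finally show "measure M ?A < e" using h by (simp add: hell_X)
  have "measure M (f ` ?B) = (\<integral>x. indicator ?B x * D f x \<partial>M)"
    using measure_image_D[OF f B] by (simp add: set_lebesgue_integral_def)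
  also have "\<dots> \<le> (\<integral>x. sqrt (D f x) \<partial>M)"
  proof (rule integral_mono')
    fix x assume "x \<in> space M"
    have "D f x \<le> sqrt (D f x)" if "D f x < 1"
    proof -
      have "(D f x)\<^sup>2 \<le> D f x * 1" unfolding power2_eq_square using that by (intro mult_left_mono) auto
      then show ?thesis using real_le_rsqrt by simp
    qed
    then show "indicator ?B x * D f x \<le> sqrt (D f x)" by (auto simp: indicator_def)
  qed (use sqrt_D_integrable[OF f] in auto)
  finally have "measure M (f ` ?B) < e" using h by (simp add: hell_X)
  moreover have "f ` X = f ` ?A \<union> f ` ?B" by (auto simp: space_M)
  then have "measure M X \<le> measure M (f ` ?A) + measure M (f ` ?B)"
    using measure_Un_le[OF G_image_sets[OF f A] G_image_sets[OF f B]] G_image[OF f] by simp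
  ultimately show "measure M X - e < measure M (f ` ?A)" by linarith
qed

end

section \<open>Bi-Lipschitz maps of the line\<close>

lemma real_measure_eqI_Ioc:
  fixes M N :: "real measure"
  assumes "sets M = sets borel" "sets N = sets borel"
    and "\<And>a b. a \<le> b \<Longrightarrow> emeasure M {a<..b} = emeasure N {a<..b}"
    and "\<And>a b. a \<le> b \<Longrightarrow> emeasure N {a<..b} \<noteq> \<infinity>"
  shows "M = N"
proof (rule measure_eqI_generator_eq[where E="range (\<lambda>(a, b). {a<..b::real})" and \<Omega>=UNIV
    and A="\<lambda>i. {- real i<..real i}"])
  show "Int_stable (range (\<lambda>(a, b). {a<..b::real}))"
    by (auto simp: Int_stable_def)
  have "sets (borel :: real measure) = sigma_sets UNIV (range (\<lambda>(a, b). {a<..b::real}))"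
    by (subst borel_sigma_sets_Ioc) (simp add: sets_measure_of)
  then show "sets M = sigma_sets UNIV (range (\<lambda>(a, b). {a<..b}))"
    "sets N = sigma_sets UNIV (range (\<lambda>(a, b). {a<..b}))" by (simp_all add: assms)
  show "range (\<lambda>i. {- real i<..real i}) \<subseteq> range (\<lambda>(a, b). {a<..b})" by auto
  show "(\<Union>i. {- real i<..real i}) = UNIV"
  proof -
    have "x \<in> (\<Union>i. {- real i<..real i})" for x
    proof -
      obtain n where "\<bar>x\<bar> < real n" using reals_Archimedean2 by blast
      then show ?thesis by (intro UN_I[of n]) auto
    qed
    then show ?thesis by blast
  qed
  show "emeasure M {- real i<..real i} \<noteq> \<infinity>" for i using assms(3,4)[of "- real i" "real i"] by simp
  fix B assume "B \<in> range (\<lambda>(a, b). {a<..b::real})"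
  then obtain a b where B: "B = {a<..b}" by auto
  then show "emeasure M B = emeasure N B" using assms(3)[of a b] by (cases "a \<le> b") auto
qed simp

text \<open>Needed only to compare Stieltjes measures: if \<open>H\<close> is monotone, adding it to \<open>F\<close> increases the
  measure.\<close>

lemma interval_measure_add:
  fixes F H :: "real \<Rightarrow> real"
  assumes F: "mono F" "continuous_on UNIV F" and H: "mono H" "continuous_on UNIV H"
    and A: "A \<in> sets borel"
  shows "emeasure (interval_measure (\<lambda>x. F x + H x)) A
     = emeasure (interval_measure F) A + emeasure (interval_measure H) A"
proof -
  define \<nu> where "\<nu> = measure_of (UNIV::real set) (sets borel)
     (\<lambda>A. emeasure (interval_measure F) A + emeasure (interval_measure H) A)"
  have rc: "continuous (at_right a) f" if "continuous_on UNIV f" for a and f :: "real \<Rightarrow> real"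
    using that by (simp add: continuous_on_eq_continuous_at continuous_at_imp_continuous_at_within)
  have sets_nu: "sets \<nu> = sets borel"
    unfolding \<nu>_def using sets.sigma_sets_eq[of "borel :: real measure"] by (simp add: sets_measure_of)
  have em: "emeasure \<nu> A = emeasure (interval_measure F) A + emeasure (interval_measure H) A"
    if "A \<in> sets borel" for A
    unfolding \<nu>_def
  proof (rule emeasure_measure_of_sigma)
    show "sigma_algebra (UNIV::real set) (sets borel)"
      using sets.sigma_algebra_axioms[of "borel :: real measure"] by simp
    show "positive (sets borel) (\<lambda>A. emeasure (interval_measure F) A + emeasure (interval_measure H) A)"
      by (simp add: positive_def)
    show "countably_additive (sets borel) (\<lambda>A. emeasure (interval_measure F) A + emeasure (interval_measure H) A)"
      unfolding countably_additive_def
    proof (intro allI impI)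
      fix B :: "nat \<Rightarrow> real set"
      assume "range B \<subseteq> sets borel" "disjoint_family B"
      then show "(\<Sum>i. emeasure (interval_measure F) (B i) + emeasure (interval_measure H) (B i))
         = emeasure (interval_measure F) (\<Union>i. B i) + emeasure (interval_measure H) (\<Union>i. B i)"
        using suminf_emeasure[of B "interval_measure F"] suminf_emeasure[of B "interval_measure H"]
        by (subst suminf_add[symmetric]) auto
    qed
  qed (use that in auto)
  have mono: "F x \<le> F y" "H x \<le> H y" if "x \<le> y" for x y
    using F(1) H(1) that by (auto dest: monoD)
  have "interval_measure (\<lambda>x. F x + H x) = \<nu>"
  proof (rule real_measure_eqI_Ioc)
    fix a b :: real assume ab: "a \<le> b"
    have nu: "emeasure \<nu> {a<..b} = ennreal (F b - F a) + ennreal (H b - H a)"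
      using ab mono by (simp add: em emeasure_interval_measure_Ioc rc F H)
    have "emeasure (interval_measure (\<lambda>x. F x + H x)) {a<..b} = ennreal (F b + H b - (F a + H a))"
      using ab by (intro emeasure_interval_measure_Ioc) (auto intro!: add_mono mono rc continuous_intros F H)
    also have "\<dots> = ennreal (F b - F a) + ennreal (H b - H a)"
      using mono[OF ab] by (subst ennreal_plus[symmetric]) (auto simp: algebra_simps)
    finally show "emeasure (interval_measure (\<lambda>x. F x + H x)) {a<..b} = emeasure \<nu> {a<..b}" using nu by simp
    show "emeasure \<nu> {a<..b} \<noteq> \<infinity>" by (simp add: nu)
  qed (simp_all add: sets_nu)
  then show ?thesis using em[OF A] by simp
qed

lemma interval_measure_scaled:
  assumes "0 \<le> c" "A \<in> sets borel"
  shows "emeasure (interval_measure (\<lambda>x. c * x)) A = ennreal c * emeasure lborel A"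
proof -
  have "interval_measure (\<lambda>x. c * x) = density lborel (\<lambda>_. ennreal c)"
  proof (rule real_measure_eqI_Ioc)
    fix a b :: real assume ab: "a \<le> b"
    have d: "emeasure (density lborel (\<lambda>_. ennreal c)) {a<..b} = ennreal (c * (b - a))"
      using assms(1) ab by (simp add: emeasure_density nn_integral_cmult_indicator ennreal_mult[symmetric])
    have "emeasure (interval_measure (\<lambda>x. c * x)) {a<..b} = ennreal (c * b - c * a)"
      using ab assms by (intro emeasure_interval_measure_Ioc) (auto intro!: mult_left_mono continuous_intros)
    then show "emeasure (interval_measure (\<lambda>x. c * x)) {a<..b} = emeasure (density lborel (\<lambda>_. ennreal c)) {a<..b}"
      by (simp add: d right_diff_distrib)
    show "emeasure (density lborel (\<lambda>_. ennreal c)) {a<..b} \<noteq> \<infinity>" by (simp add: d)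
  qed simp_all
  then show ?thesis using assms(2) by (simp add: emeasure_density nn_integral_cmult_indicator)
qed

lemma bi_Lipschitz_strict_mono:
  fixes \<phi> :: "real \<Rightarrow> real"
  assumes "0 < c" "s < t" "c * (t - s) \<le> \<phi> t - \<phi> s"
  shows "\<phi> s < \<phi> t"
  using assms mult_pos_pos[of c "t - s"] by linarith

text \<open>The Stieltjes measure of \<open>\<phi>\<close> is Lebesgue measure pulled back under \<open>\<phi>\<close>. The slope bounds say
  that \<open>\<phi> t - c * t\<close> and \<open>C * t - \<phi> t\<close> are monotone, so additivity of Stieltjes measures gives both
  inequalities without differentiating \<open>\<phi>\<close>.\<close>

lemma bi_Lipschitz_line_measure:
  fixes \<phi> :: "real \<Rightarrow> real"
  assumes c: "0 < c" and lo: "\<And>s t. s \<le> t \<Longrightarrow> c * (t - s) \<le> \<phi> t - \<phi> s"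
    and up: "\<And>s t. s \<le> t \<Longrightarrow> \<phi> t - \<phi> s \<le> C * (t - s)" and B: "B \<in> sets borel"
  shows "\<phi> ` B \<in> sets borel" "ennreal c * emeasure lborel B \<le> emeasure lborel (\<phi> ` B)"
    "emeasure lborel (\<phi> ` B) \<le> ennreal C * emeasure lborel B"
proof -
  have C0: "0 \<le> C" using lo[of 0 1] up[of 0 1] c by auto
  have sm: "strict_mono \<phi>"
    by (rule strict_monoI) (use bi_Lipschitz_strict_mono[OF c] lo in auto)
  have "\<bar>\<phi> x - \<phi> y\<bar> \<le> C * \<bar>x - y\<bar>" for x y
  proof (cases "x \<le> y")
    case True
    then have "\<phi> x \<le> \<phi> y" using sm by (simp add: strict_mono_less_eq)
    then show ?thesis using up[OF True] True by auto
  next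
    case False
    then have "\<phi> y \<le> \<phi> x" using sm by (simp add: strict_mono_less_eq)
    then show ?thesis using up[of y x] False by auto
  qed
  then have "C-lipschitz_on UNIV \<phi>" using C0 by (auto simp: lipschitz_on_def dist_real_def)
  then have cont: "continuous_on UNIV \<phi>" by (rule lipschitz_on_continuous_on)
  have surj: "surj \<phi>"
    unfolding surj_def
  proof
    fix y
    define K where "K = (\<bar>y\<bar> + \<bar>\<phi> 0\<bar>) / c"
    have K: "0 \<le> K" "c * K = \<bar>y\<bar> + \<bar>\<phi> 0\<bar>" using c by (auto simp: K_def)
    have "\<phi> (- K) \<le> y" "y \<le> \<phi> K" using lo[of "- K" 0] lo[of 0 K] K by auto
    then show "\<exists>x. y = \<phi> x"
      using IVT'[of \<phi> "- K" y K] K(1) continuous_on_subset[OF cont] by force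
  qed
  define \<psi> where "\<psi> = inv_into UNIV \<phi>"
  have inj: "inj \<phi>" using sm by (rule strict_mono_imp_inj_on)
  have \<psi>: "\<psi> (\<phi> x) = x" "\<phi> (\<psi> x) = x" for x
    using inj surj by (simp_all add: \<psi>_def surj_f_inv_f)
  have smp: "strict_mono \<psi>" by (rule strict_mono_inv[OF sm surj \<psi>(1)])
  have [measurable]: "\<psi> \<in> borel_measurable borel"
    using smp by (intro borel_measurable_mono strict_mono_mono)
  have img: "\<phi> ` A = \<psi> -` A" for A using \<psi> by (auto simp: image_iff) (metis \<psi>(2))
  show "\<phi> ` B \<in> sets borel" unfolding img using B measurable_sets_borel[of \<psi> borel B] by simp
  have "interval_measure \<phi> = distr lborel borel \<psi>"
  proof (rule real_measure_eqI_Ioc)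
    fix a b :: real assume ab: "a \<le> b"
    have "\<psi> -` {a<..b} = {\<phi> a<..\<phi> b}"
      using sm \<psi> by (auto simp: strict_mono_less strict_mono_less_eq) (metis \<psi>(2) sm strict_mono_less strict_mono_less_eq)+
    moreover have "\<phi> a \<le> \<phi> b" using sm ab by (simp add: strict_mono_less_eq)
    ultimately have d: "emeasure (distr lborel borel \<psi>) {a<..b} = ennreal (\<phi> b - \<phi> a)"
      by (simp add: emeasure_distr)
    show "emeasure (interval_measure \<phi>) {a<..b} = emeasure (distr lborel borel \<psi>) {a<..b}"
      unfolding d using ab cont sm
      by (intro emeasure_interval_measure_Ioc)
        (auto simp: strict_mono_less_eq continuous_on_eq_continuous_at continuous_at_imp_continuous_at_within)
    show "emeasure (distr lborel borel \<psi>) {a<..b} \<noteq> \<infinity>" by (simp add: d)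
  qed simp_all
  then have im: "emeasure (interval_measure \<phi>) B = emeasure lborel (\<phi> ` B)"
    using B by (simp add: emeasure_distr img)
  have "mono (\<lambda>x. c * x)" "mono (\<lambda>x. \<phi> x - c * x)"
    using c lo by (auto intro!: monoI simp: algebra_simps)
  then have "emeasure (interval_measure (\<lambda>x. c * x + (\<phi> x - c * x))) B
      = ennreal c * emeasure lborel B + emeasure (interval_measure (\<lambda>x. \<phi> x - c * x)) B"
    using c by (subst interval_measure_add) (auto intro!: continuous_intros cont B simp: interval_measure_scaled B)
  then show "ennreal c * emeasure lborel B \<le> emeasure lborel (\<phi> ` B)"
    using im by (simp add: add_increasing2)
  have "mono \<phi>" "mono (\<lambda>x. C * x - \<phi> x)"
    using up by (auto intro!: monoI simp: algebra_simps strict_mono_mono[OF sm, THEN monoD])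
  then have "emeasure (interval_measure (\<lambda>x. \<phi> x + (C * x - \<phi> x))) B
      = emeasure lborel (\<phi> ` B) + emeasure (interval_measure (\<lambda>x. C * x - \<phi> x)) B"
    by (subst interval_measure_add) (auto intro!: continuous_intros cont B simp: im)
  moreover have "(\<lambda>x. \<phi> x + (C * x - \<phi> x)) = (\<lambda>x. C * x)" by auto
  ultimately show "emeasure lborel (\<phi> ` B) \<le> ennreal C * emeasure lborel B"
    using interval_measure_scaled[OF C0 B] by (metis le_iff_add)
qed

section \<open>Spaces parametrised by an interval\<close>

text \<open>Injectivity on both half-open segments leaves exactly two possibilities, an arc and a simple closed
  curve with \<open>p 0 = p m\<close>.\<close>

locale parametrised_space = compact_measure X M for X :: "'a::euclidean_space set" and M +
  fixes p :: "real \<Rightarrow> 'a" and m :: real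
  assumes m_pos: "0 < m"
    and p_continuous: "continuous_on {0..m} p"
    and p_surj: "p ` {0..m} = X"
    and p_inj: "inj_on p {0..<m}" and p_inj': "inj_on p {0<..m}"
begin

lemma p_in: "0 \<le> t \<Longrightarrow> t \<le> m \<Longrightarrow> p t \<in> X"
  using p_surj by auto

lemma p_eqD:
  assumes "p s = p t" "0 \<le> s" "s \<le> m" "0 \<le> t" "t \<le> m"
  shows "s = t \<or> (s = 0 \<and> t = m) \<or> (s = m \<and> t = 0)"
  using assms inj_onD[OF p_inj, of s t] inj_onD[OF p_inj', of s t] by fastforce

lemma p_eq_iff:
  assumes "0 < s" "s < m" "0 \<le> t" "t \<le> m"
  shows "p s = p t \<longleftrightarrow> s = t"
  using p_eqD[of s t] assms by auto

text \<open>A parameter of \<open>x\<close>. When \<open>p 0 = p m\<close> that point has two parameters, and the case distinction selects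
  0, so that \<open>T\<close> is a left inverse of \<open>p\<close> on all of \<open>{0..<m}\<close>.\<close>

definition T :: "'a \<Rightarrow> real" where
  "T x = (if x = p 0 then 0 else inv_into {0..m} p x)"

lemma T_in: "x \<in> X \<Longrightarrow> 0 \<le> T x \<and> T x \<le> m"
  using m_pos inv_into_into[of x p "{0..m}"] p_surj by (auto simp: T_def)

lemma p_T: "x \<in> X \<Longrightarrow> p (T x) = x"
  using f_inv_into_f[of x p "{0..m}"] p_surj by (auto simp: T_def)

lemma T_p:
  assumes "0 \<le> t" "t < m"
  shows "T (p t) = t"
proof -
  have "p t \<in> X" using assms by (intro p_in) auto
  then have "p (T (p t)) = p t" "0 \<le> T (p t)" "T (p t) \<le> m" using p_T T_in by auto
  moreover have "t = 0 \<Longrightarrow> T (p t) = 0" by (simp add: T_def)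
  ultimately show ?thesis using p_eqD[of "T (p t)" t] assms by auto
qed

lemma T_pm: "T (p m) = m \<or> p m = p 0"
proof (cases "p m = p 0")
  case False
  then have "T (p m) = inv_into {0..m} p (p m)" by (simp add: T_def)
  moreover have "p (T (p m)) = p m" "0 \<le> T (p m)" "T (p m) \<le> m"
    using p_T[of "p m"] T_in[of "p m"] p_in[of m] m_pos by auto
  ultimately show ?thesis using p_eqD[of "T (p m)" m] m_pos False by auto
qed simp

lemma closed_p_image: "S \<subseteq> {0..m} \<Longrightarrow> closed S \<Longrightarrow> compact (p ` S)"
  using compact_continuous_image[OF continuous_on_subset[OF p_continuous]]
  by (metis compact_Icc compact_Int_closed inf.absorb_iff2 inf_commute)

lemma T_le_set:
  assumes "0 \<le> t" "t < m"
  shows "{x \<in> X. T x \<le> t} = p ` {0..t}"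
proof
  show "{x \<in> X. T x \<le> t} \<subseteq> p ` {0..t}"
  proof
    fix x assume "x \<in> {x \<in> X. T x \<le> t}"
    then show "x \<in> p ` {0..t}" using p_T[of x] T_in[of x] by (intro image_eqI[of _ _ "T x"]) auto
  qed
  show "p ` {0..t} \<subseteq> {x \<in> X. T x \<le> t}" using assms by (auto simp: T_p p_in)
qed

lemma T_measurable [measurable]: "T \<in> borel_measurable M"
proof (rule borel_measurableI_le)
  fix a :: real
  have "{x \<in> space M. T x \<le> a} = (if a < 0 then {} else if a < m then p ` {0..a} else X)"
  proof -
    have "{x \<in> X. T x \<le> a} = {}" if "a < 0" using T_in that by fastforce
    moreover have "{x \<in> X. T x \<le> a} = X" if "a \<ge> m" using T_in that by fastforce
    ultimately show ?thesis using T_le_set[of a] by (simp add: space_M)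
  qed
  moreover have "p ` {0..a} \<in> sets M" if "a < m"
    using that closed_p_image[of "{0..a}"] p_surj by (auto simp: sets_M_iff borel_compact)
  ultimately show "{x \<in> space M. T x \<le> a} \<in> sets M" by simp
qed

lemma p_sets: "A \<in> sets M \<Longrightarrow> p -` A \<inter> {0..m} \<in> sets borel"
  using measurable_sets[OF borel_measurable_continuous_on_restrict[OF p_continuous], of A]
  by (simp add: sets_M_iff sets_restrict_space_iff space_restrict_space)

lemma arc_complement:
  assumes "0 \<le> a" "a \<le> b" "b \<le> m"
  shows "p ` {a<..<b} \<inter> p ` ({0..a} \<union> {b..m}) = {}" "p ` {a<..<b} \<union> p ` ({0..a} \<union> {b..m}) = X"
proof -
  show "p ` {a<..<b} \<inter> p ` ({0..a} \<union> {b..m}) = {}"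
  proof (rule ccontr)
    assume "p ` {a<..<b} \<inter> p ` ({0..a} \<union> {b..m}) \<noteq> {}"
    then obtain s t where "s \<in> {a<..<b}" "t \<in> {0..a} \<union> {b..m}" "p s = p t" by blast
    then show False using p_eqD[of s t] assms by auto
  qed
  have "{a<..<b} \<union> ({0..a} \<union> {b..m}) = {0..m}" using assms by auto
  then show "p ` {a<..<b} \<union> p ` ({0..a} \<union> {b..m}) = X" using p_surj by (metis image_Un)
qed

end

locale arc_space = parametrised_space X M p m
  for X :: "'a::euclidean_space set" and M and p :: "real \<Rightarrow> 'a" and m +
  assumes p_measure: "\<And>t. 0 \<le> t \<Longrightarrow> t \<le> m \<Longrightarrow> measure M (p ` {0..t}) = t"
begin

lemma measure_X: "measure M X = m"
  using p_measure[of m] m_pos p_surj by simp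

lemma distr_T: "distr M borel T = density lborel (indicator {0..m})"
proof (rule real_measure_eqI_Ioc)
  interpret N: finite_measure "distr M borel T" by (rule finite_measure_distr) measurable
  fix a b :: real assume ab: "a \<le> b"
  have le: "emeasure (distr M borel T) {..t} = ennreal (max 0 (min t m))" for t
  proof -
    have "T -` {..t} \<inter> space M = (if t < 0 then {} else if t < m then p ` {0..t} else X)"
    proof -
      have "{x \<in> X. T x \<le> t} = {}" if "t < 0" using T_in that by fastforce
      moreover have "{x \<in> X. T x \<le> t} = X" if "t \<ge> m" using T_in that by fastforce
      ultimately show ?thesis using T_le_set[of t] by (simp add: space_M vimage_def Int_def conj_commute)
    qed
    then show ?thesis
      using p_measure[of t] measure_X m_pos
      by (auto simp: emeasure_distr emeasure_eq_measure)
  qed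
  have "{a<..b} = {..b} - {..a}" by auto
  then have "emeasure (distr M borel T) {a<..b}
      = emeasure (distr M borel T) {..b} - emeasure (distr M borel T) {..a}"
    using ab by (simp add: emeasure_Diff)
  also have "\<dots> = ennreal (max 0 (min b m) - max 0 (min a m))"
    unfolding le by (simp add: ennreal_minus)
  also have "\<dots> = emeasure lborel ({a<..b} \<inter> {0..m})"
  proof -
    have "emeasure lborel ({a<..b} \<inter> {0..m}) = ennreal (max 0 (min b m) - max 0 (min a m))"
    proof (cases "a < 0")
      case True
      then have "{a<..b} \<inter> {0..m} = {0..min b m}" by auto
      then show ?thesis using True m_pos by (cases "b < 0") auto
    next
      case False
      then have "{a<..b} \<inter> {0..m} = {a<..min b m}" by auto
      then show ?thesis using False m_pos ab by (cases "a < m") auto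
    qed
    then show ?thesis by simp
  qed
  finally show "emeasure (distr M borel T) {a<..b} = emeasure (density lborel (indicator {0..m})) {a<..b}"
    by (simp add: emeasure_density indicator_inter_arith[symmetric] Int_commute)
  moreover have "emeasure (distr M borel T) {a<..b} \<noteq> \<infinity>" by simp
  ultimately show "emeasure (density lborel (indicator {0..m})) {a<..b} \<noteq> \<infinity>" by metis
qed simp_all

lemma emeasure_eq_preimage:
  assumes "A \<in> sets M"
  shows "emeasure M A = emeasure lborel (p -` A \<inter> {0..m})"
proof -
  have "A = T -` (p -` A \<inter> {0..m}) \<inter> space M"
    using assms p_T T_in by (auto simp: space_M sets_M_iff subset_iff)
  then have "emeasure M A = emeasure (distr M borel T) (p -` A \<inter> {0..m})"
    using p_sets[OF assms] by (simp add: emeasure_distr)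
  also have "\<dots> = emeasure lborel (p -` A \<inter> {0..m})"
    using p_sets[OF assms]
    by (simp add: distr_T emeasure_density indicator_inter_arith[symmetric] Int_ac)
  finally show ?thesis .
qed

end

section \<open>Lifting bi-Lipschitz maps of the parameter\<close>

lemma slope_bound_join:
  fixes f :: "real \<Rightarrow> real"
  assumes "\<And>s t. x \<le> s \<Longrightarrow> s \<le> t \<Longrightarrow> t \<le> a \<Longrightarrow> c * (t - s) \<le> f t - f s"
    and "\<And>s t. a \<le> s \<Longrightarrow> s \<le> t \<Longrightarrow> t \<le> y \<Longrightarrow> c * (t - s) \<le> f t - f s"
    and "x \<le> s" "s \<le> t" "t \<le> y"
  shows "c * (t - s) \<le> f t - f s"
proof (cases "s \<le> a \<and> a \<le> t")
  case True
  then have "c * (a - s) \<le> f a - f s" "c * (t - a) \<le> f t - f a" using assms by auto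
  then show ?thesis by (simp add: algebra_simps)
qed (use assms in auto)

lemma slope_bound_glue:
  fixes f :: "real \<Rightarrow> real"
  assumes "\<And>s t. s \<le> t \<Longrightarrow> t \<le> a \<Longrightarrow> c * (t - s) \<le> f t - f s"
    and "\<And>s t. a \<le> s \<Longrightarrow> s \<le> t \<Longrightarrow> t \<le> b \<Longrightarrow> c * (t - s) \<le> f t - f s"
    and "s \<le> t" "t \<le> b"
  shows "c * (t - s) \<le> f t - f s"
  by (rule slope_bound_join[of s a c f b s t]) (use assms in auto)

context arc_space
begin

lemma p_image_measure:
  assumes B: "B \<in> sets borel" "B \<subseteq> {0..m}"
  shows "p ` B \<in> sets M" "emeasure M (p ` B) = emeasure lborel B"
proof -
  let ?C = "if m \<in> B \<and> p m = p 0 then insert 0 B else B"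
  have "p ` B = T -` ?C \<inter> space M"
  proof
    show "p ` B \<subseteq> T -` ?C \<inter> space M"
    proof
      fix x assume "x \<in> p ` B"
      then obtain t where t: "t \<in> B" "x = p t" "0 \<le> t" "t \<le> m" using B by auto
      have "T x \<in> ?C"
      proof (cases "t < m")
        case True
        then show ?thesis using t by (simp add: T_p)
      next
        case False
        then have "t = m" using t by simp
        then show ?thesis using T_pm t T_p[of 0] m_pos by auto
      qed
      then show "x \<in> T -` ?C \<inter> space M" using t by (simp add: space_M p_in)
    qed
    show "T -` ?C \<inter> space M \<subseteq> p ` B"
    proof
      fix x assume "x \<in> T -` ?C \<inter> space M"
      then have "T x \<in> ?C" "x = p (T x)" using p_T by (auto simp: space_M)
      then show "x \<in> p ` B" by (auto split: if_splits intro: rev_image_eqI)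
    qed
  qed
  then show s: "p ` B \<in> sets M" using B by (auto intro!: measurable_sets[OF T_measurable])
  have pre: "p -` (p ` B) \<inter> {0..m} \<in> sets borel" by (rule p_sets[OF s])
  have "p -` (p ` B) \<inter> {0..m} \<subseteq> B \<union> {0, m}"
    using B(2) p_eqD by fastforce
  then have "emeasure lborel (p -` (p ` B) \<inter> {0..m}) \<le> emeasure lborel (B \<union> {0, m})"
    using B by (intro emeasure_mono) auto
  also have "\<dots> \<le> emeasure lborel B + emeasure lborel {0, m}"
    using B by (intro emeasure_subadditive) auto
  also have "\<dots> = emeasure lborel B" by (simp add: emeasure_lborel_countable)
  finally have "emeasure M (p ` B) \<le> emeasure lborel B" by (simp add: emeasure_eq_preimage[OF s])
  moreover have "emeasure lborel B \<le> emeasure lborel (p -` (p ` B) \<inter> {0..m})"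
    using B pre by (intro emeasure_mono) auto
  ultimately show "emeasure M (p ` B) = emeasure lborel B" by (simp add: emeasure_eq_preimage[OF s])
qed

lemma p_image_Icc_sets: "0 \<le> a \<Longrightarrow> b \<le> m \<Longrightarrow> p ` {a..b} \<in> sets M"
  by (intro p_image_measure) auto

lemma measure_p_Icc: "0 \<le> a \<Longrightarrow> a \<le> b \<Longrightarrow> b \<le> m \<Longrightarrow> measure M (p ` {a..b}) = b - a"
  using p_image_measure(2)[of "{a..b}"] by (simp add: measure_def)

lemma measure_p_image: "B \<in> sets borel \<Longrightarrow> B \<subseteq> {0..m} \<Longrightarrow> measure M (p ` B) = measure lborel B"
  using p_image_measure(2)[of B] by (simp add: measure_def)

text \<open>Fixing both ends is what makes the induced map of \<open>X\<close> continuous when \<open>p 0 = p m\<close>.\<close>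

definition bilip :: "real \<Rightarrow> real \<Rightarrow> (real \<Rightarrow> real) \<Rightarrow> bool" where
  "bilip c C \<phi> \<longleftrightarrow> 0 < c \<and> \<phi> 0 = 0 \<and> \<phi> m = m \<and>
     (\<forall>s t. 0 \<le> s \<longrightarrow> s \<le> t \<longrightarrow> t \<le> m \<longrightarrow> c * (t - s) \<le> \<phi> t - \<phi> s \<and> \<phi> t - \<phi> s \<le> C * (t - s))"

lemma bilip_ends: "bilip c C \<phi> \<Longrightarrow> \<phi> 0 = 0 \<and> \<phi> m = m"
  by (simp add: bilip_def)

lemma bilip_less:
  assumes "bilip c C \<phi>" "0 \<le> s" "s < t" "t \<le> m"
  shows "\<phi> s < \<phi> t"
  using assms bi_Lipschitz_strict_mono[of c s t \<phi>] by (auto simp: bilip_def)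

lemma bilip_range:
  assumes "bilip c C \<phi>" "0 \<le> t" "t \<le> m"
  shows "0 \<le> \<phi> t" "\<phi> t \<le> m"
  using bilip_less[OF assms(1), of 0 t] bilip_less[OF assms(1), of t m] bilip_ends[OF assms(1)] assms
  by (cases "t = 0"; force)+

lemma bilip_inj: "bilip c C \<phi> \<Longrightarrow> inj_on \<phi> {0..m}"
  by (rule inj_onI) (metis atLeastAtMost_iff bilip_less less_irrefl linorder_neqE_linordered_idom)

lemma bilip_one:
  assumes "bilip c C \<phi>"
  shows "c \<le> 1" "1 \<le> C"
proof -
  have "c * (m - 0) \<le> \<phi> m - \<phi> 0 \<and> \<phi> m - \<phi> 0 \<le> C * (m - 0)"
    using assms m_pos unfolding bilip_def by (metis less_imp_le order_refl)
  then have "c * m \<le> 1 * m" "1 * m \<le> C * m" using bilip_ends[OF assms] by auto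
  then show "c \<le> 1" "1 \<le> C" using m_pos by (auto dest: mult_right_le_imp_le)
qed

lemma bilip_continuous:
  assumes "bilip c C \<phi>"
  shows "continuous_on {0..m} \<phi>"
proof (rule lipschitz_on_continuous_on)
  show "C-lipschitz_on {0..m} \<phi>"
  proof (rule lipschitz_onI)
    show "0 \<le> C" using bilip_one[OF assms] by simp
    have *: "dist (\<phi> s) (\<phi> t) \<le> C * dist s t" if "0 \<le> s" "s \<le> t" "t \<le> m" for s t
    proof -
      have "\<phi> s \<le> \<phi> t" using bilip_less[OF assms, of s t] that by (cases "s = t") auto
      then show ?thesis using assms that by (auto simp: bilip_def dist_real_def)
    qed
    fix s t assume "s \<in> {0..m}" "t \<in> {0..m}"
    then show "dist (\<phi> s) (\<phi> t) \<le> C * dist s t"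
      using *[of s t] *[of t s] by (cases "s \<le> t") (auto simp: dist_commute)
  qed
qed

lemma bilip_image:
  assumes "bilip c C \<phi>"
  shows "\<phi> ` {0..m} = {0..m}"
proof
  show "\<phi> ` {0..m} \<subseteq> {0..m}" using bilip_range[OF assms] by auto
  show "{0..m} \<subseteq> \<phi> ` {0..m}"
  proof
    fix y assume "y \<in> {0..m}"
    then show "y \<in> \<phi> ` {0..m}"
      using IVT'[of \<phi> 0 y m] bilip_continuous[OF assms] bilip_ends[OF assms] m_pos by force
  qed
qed

lemma bilip_measure:
  assumes b: "bilip c C \<phi>" and B: "B \<in> sets borel" "B \<subseteq> {0..m}"
  shows "\<phi> ` B \<in> sets borel" "ennreal c * emeasure lborel B \<le> emeasure lborel (\<phi> ` B)"
    "emeasure lborel (\<phi> ` B) \<le> ennreal C * emeasure lborel B"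
proof -
  \<comment> \<open>The estimate is known for maps of the whole line; extending by the identity keeps the slope
    bounds because c \<le> 1 \<le> C.\<close>
  define f where "f t = (if t < 0 \<or> m < t then t else \<phi> t)" for t
  note one = bilip_one[OF b]
  have e: "\<phi> 0 = 0" "\<phi> m = m" using bilip_ends[OF b] by auto
  have lo0: "c * (t - s) \<le> t - s" and up0: "(- C) * (t - s) \<le> (- t) - (- s)" if "s \<le> t" for s t :: real
    using one that mult_right_mono[of c 1 "t - s"] mult_right_mono[of 1 C "t - s"]
    by (auto simp: algebra_simps)
  have mid: "c * (t - s) \<le> \<phi> t - \<phi> s" "(- C) * (t - s) \<le> (- \<phi> t) - (- \<phi> s)"
    if "0 \<le> s" "s \<le> t" "t \<le> m" for s t
  proof -
    have "c * (t - s) \<le> \<phi> t - \<phi> s \<and> \<phi> t - \<phi> s \<le> C * (t - s)"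
      using b that unfolding bilip_def by blast
    then show "c * (t - s) \<le> \<phi> t - \<phi> s" "(- C) * (t - s) \<le> (- \<phi> t) - (- \<phi> s)" by auto
  qed
  have f1: "f t = t" if "t \<le> 0 \<or> m \<le> t" for t using that e m_pos by (auto simp: f_def)
  have f2: "f t = \<phi> t" if "0 \<le> t" "t \<le> m" for t using that by (auto simp: f_def)
  have lo: "c * (t - s) \<le> f t - f s" if st: "s \<le> t" for s t
  proof (rule slope_bound_glue[of m "c" "f" t s t])
    show "c * (t - s) \<le> f t - f s" if st: "s \<le> t" "t \<le> m" for s t
    proof (rule slope_bound_glue[of 0 "c" "f" m s t])
      show "c * (t - s) \<le> f t - f s" if "s \<le> t" "t \<le> 0" for s t
        using lo0[OF that(1)] f1[of s] f1[of t] that by simp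
      show "c * (t - s) \<le> f t - f s" if "0 \<le> s" "s \<le> t" "t \<le> m" for s t
        using mid(1)[OF that] f2[of s] f2[of t] that by simp
    qed (rule st)+
    show "c * (t' - s') \<le> f t' - f s'" if "m \<le> s'" "s' \<le> t'" "t' \<le> t" for s' t'
      using lo0[OF that(2)] f1[of s'] f1[of t'] that by simp
  qed (use st in simp_all)
  have up': "(- C) * (t - s) \<le> (- f t) - (- f s)" if st: "s \<le> t" for s t
  proof (rule slope_bound_glue[of m "(- C)" "\<lambda>t. - f t" t s t])
    show "(- C) * (t - s) \<le> (- f t) - (- f s)" if st: "s \<le> t" "t \<le> m" for s t
    proof (rule slope_bound_glue[of 0 "(- C)" "\<lambda>t. - f t" m s t])
      show "(- C) * (t - s) \<le> (- f t) - (- f s)" if "s \<le> t" "t \<le> 0" for s t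
        using up0[OF that(1)] f1[of s] f1[of t] that by simp
      show "(- C) * (t - s) \<le> (- f t) - (- f s)" if "0 \<le> s" "s \<le> t" "t \<le> m" for s t
        using mid(2)[OF that] f2[of s] f2[of t] that by simp
    qed (rule st)+
    show "(- C) * (t' - s') \<le> (- f t') - (- f s')" if "m \<le> s'" "s' \<le> t'" "t' \<le> t" for s' t'
      using up0[OF that(2)] f1[of s'] f1[of t'] that by simp
  qed (use st in simp_all)
  have up: "f t - f s \<le> C * (t - s)" if "s \<le> t" for s t using up'[OF that] by simp
  have "0 < c" using b by (simp add: bilip_def)
  note bi_Lipschitz_line_measure[of c f C B, OF this lo up B(1)]
  moreover have "f ` B = \<phi> ` B" using B(2) f2 by (intro image_cong) auto
  ultimately show "\<phi> ` B \<in> sets borel" "ennreal c * emeasure lborel B \<le> emeasure lborel (\<phi> ` B)"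
    "emeasure lborel (\<phi> ` B) \<le> ennreal C * emeasure lborel B" by simp_all
qed

text \<open>A continuous map of the compact segment onto \<open>X\<close> is closed, hence a quotient map.\<close>

lemma continuous_on_via_p:
  fixes f :: "'a \<Rightarrow> 'b::topological_space"
  assumes "continuous_on {0..m} (\<lambda>t. f (p t))"
  shows "continuous_on X f"
  unfolding continuous_on_closed_vimage[OF compact_imp_closed[OF compact]]
proof (intro allI impI)
  fix B :: "'b set" assume "closed B"
  then have "closed ((\<lambda>t. f (p t)) -` B \<inter> {0..m})"
    using assms continuous_on_closed_vimage[of "{0..m}" "\<lambda>t. f (p t)"] by simp
  then have "compact (p ` ((\<lambda>t. f (p t)) -` B \<inter> {0..m}))" by (intro closed_p_image) auto
  moreover have "p ` ((\<lambda>t. f (p t)) -` B \<inter> {0..m}) = f -` B \<inter> X" using p_surj by auto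
  ultimately show "closed (f -` B \<inter> X)" by (simp add: compact_imp_closed)
qed

definition lift :: "(real \<Rightarrow> real) \<Rightarrow> 'a \<Rightarrow> 'a" where
  "lift \<phi> = (\<lambda>x\<in>X. p (\<phi> (T x)))"

lemma lift_p:
  assumes "bilip c C \<phi>" "0 \<le> t" "t \<le> m"
  shows "lift \<phi> (p t) = p (\<phi> t)"
proof (cases "t < m")
  case True
  then show ?thesis using assms by (simp add: lift_def p_in T_p)
next
  case False
  then have "t = m" using assms by simp
  then show ?thesis
    using T_pm bilip_ends[OF assms(1)] T_p[of 0] m_pos by (auto simp: lift_def p_in)
qed

lemma lift_preimage:
  assumes b: "bilip c C \<phi>" and A: "A \<subseteq> X"
  shows "p -` (lift \<phi> ` A) \<inter> {0..m} = \<phi> ` (p -` A \<inter> {0..m})"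
proof
  show "\<phi> ` (p -` A \<inter> {0..m}) \<subseteq> p -` (lift \<phi> ` A) \<inter> {0..m}"
  proof
    fix s assume "s \<in> \<phi> ` (p -` A \<inter> {0..m})"
    then obtain t where t: "0 \<le> t" "t \<le> m" "p t \<in> A" "s = \<phi> t" by auto
    then have "p s = lift \<phi> (p t)" using lift_p[OF b] by simp
    then show "s \<in> p -` (lift \<phi> ` A) \<inter> {0..m}" using t bilip_range[OF b] by auto
  qed
  show "p -` (lift \<phi> ` A) \<inter> {0..m} \<subseteq> \<phi> ` (p -` A \<inter> {0..m})"
  proof
    fix s assume "s \<in> p -` (lift \<phi> ` A) \<inter> {0..m}"
    then obtain x where s: "0 \<le> s" "s \<le> m" and x: "x \<in> A" "p s = lift \<phi> x" by auto
    then obtain t where t: "0 \<le> t" "t \<le> m" "x = p t" using A p_surj by force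
    have eq: "p s = p (\<phi> t)" using x t lift_p[OF b] by simp
    consider "s = \<phi> t" | "s = 0" "\<phi> t = m" | "s = m" "\<phi> t = 0"
      using p_eqD[OF eq s bilip_range[OF b t(1,2)]] by auto
    then show "s \<in> \<phi> ` (p -` A \<inter> {0..m})"
    proof cases
      case 1 then show ?thesis using t x by auto
    next
      case 2
      then have "t = m" using bilip_less[OF b, of t m] bilip_ends[OF b] t by fastforce
      then have "p 0 \<in> A" using 2 eq x t bilip_ends[OF b] by simp
      then show ?thesis using 2 bilip_ends[OF b] m_pos by (intro image_eqI[of _ _ 0]) auto
    next
      case 3
      then have "t = 0" using bilip_less[OF b, of 0 t] bilip_ends[OF b] t by fastforce
      then have "p m \<in> A" using 3 eq x t bilip_ends[OF b] by simp
      then show ?thesis using 3 bilip_ends[OF b] m_pos by (intro image_eqI[of _ _ m]) auto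
    qed
  qed
qed

lemma lift_bij_continuous:
  assumes b: "bilip c C \<phi>"
  shows "bij_betw (lift \<phi>) X X" "continuous_on X (lift \<phi>)"
proof -
  have "continuous_on {0..m} (\<lambda>t. p (\<phi> t))"
    using continuous_on_compose2[OF p_continuous bilip_continuous[OF b]] bilip_image[OF b] by simp
  then have "continuous_on {0..m} (\<lambda>t. lift \<phi> (p t))"
    by (rule continuous_on_eq) (use lift_p[OF b] in auto)
  then show "continuous_on X (lift \<phi>)" by (rule continuous_on_via_p)
  have "lift \<phi> ` X = (\<lambda>t. p (\<phi> t)) ` {0..m}"
  proof -
    have "lift \<phi> ` p ` {0..m} = (\<lambda>t. p (\<phi> t)) ` {0..m}"
      unfolding image_image using lift_p[OF b] by (intro image_cong) auto
    then show ?thesis by (simp add: p_surj)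
  qed
  also have "\<dots> = p ` \<phi> ` {0..m}" by (simp add: image_image)
  also have "\<dots> = X" using bilip_image[OF b] p_surj by simp
  finally have im: "lift \<phi> ` X = X" .
  have "inj_on (lift \<phi>) X"
  proof (rule inj_onI)
    fix x y assume "x \<in> X" "y \<in> X" and eq: "lift \<phi> x = lift \<phi> y"
    then obtain s t where st: "x = p s" "y = p t" "0 \<le> s" "s \<le> m" "0 \<le> t" "t \<le> m" using p_surj by force
    have "p (\<phi> s) = p (\<phi> t)" using eq st lift_p[OF b] by simp
    then have "\<phi> s = \<phi> t \<or> \<phi> s = 0 \<and> \<phi> t = m \<and> p 0 = p m \<or> \<phi> s = m \<and> \<phi> t = 0 \<and> p m = p 0"
      using p_eqD[of "\<phi> s" "\<phi> t"] bilip_range[OF b] st by metis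
    moreover have z: "u = 0" if "\<phi> u = 0" "0 \<le> u" "u \<le> m" for u
      using bilip_less[OF b, of 0 u] bilip_ends[OF b] that by fastforce
    moreover have mm: "u = m" if "\<phi> u = m" "0 \<le> u" "u \<le> m" for u
      using bilip_less[OF b, of u m] bilip_ends[OF b] that by fastforce
    moreover have "s = t" if "\<phi> s = \<phi> t" using inj_onD[OF bilip_inj[OF b] that] st by simp
    ultimately show "x = y" using st by metis
  qed
  then show "bij_betw (lift \<phi>) X X" using im by (simp add: bij_betw_def)
qed

lemma lift_image_sets:
  assumes b: "bilip c C \<phi>" and A: "A \<in> sets M"
  shows "lift \<phi> ` A \<in> sets M" and "emeasure M (lift \<phi> ` A) = emeasure lborel (\<phi> ` (p -` A \<inter> {0..m}))"
proof -
  have AX: "A \<subseteq> X" using A by (simp add: sets_M_iff)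
  have "lift \<phi> ` A = p ` \<phi> ` (p -` A \<inter> {0..m})"
  proof -
    have "lift \<phi> ` A \<subseteq> X" using lift_bij_continuous(1)[OF b] AX by (auto simp: bij_betw_def)
    moreover have "B = p ` (p -` B \<inter> {0..m})" if "B \<subseteq> p ` {0..m}" for B using that by auto
    ultimately have "lift \<phi> ` A = p ` (p -` (lift \<phi> ` A) \<inter> {0..m})" using p_surj by metis
    then show ?thesis using lift_preimage[OF b AX] by simp
  qed
  moreover have "\<phi> ` (p -` A \<inter> {0..m}) \<in> sets borel" "\<phi> ` (p -` A \<inter> {0..m}) \<subseteq> {0..m}"
    using bilip_measure(1)[OF b p_sets[OF A]] bilip_range[OF b] by auto
  ultimately show "lift \<phi> ` A \<in> sets M" "emeasure M (lift \<phi> ` A) = emeasure lborel (\<phi> ` (p -` A \<inter> {0..m}))"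
    using p_image_measure by simp_all
qed

lemma lift_emeasure:
  assumes b: "bilip c C \<phi>" and A: "A \<in> sets M"
  shows "ennreal c * emeasure M A \<le> emeasure M (lift \<phi> ` A)"
    "emeasure M (lift \<phi> ` A) \<le> ennreal C * emeasure M A"
  using bilip_measure[OF b p_sets[OF A]]
  by (simp_all add: lift_image_sets[OF b A] emeasure_eq_preimage[OF A])

lemma lift_in_G:
  assumes b: "bilip c C \<phi>"
  shows "lift \<phi> \<in> G"
  unfolding G_iff
proof (intro conjI ballI lift_bij_continuous[OF b])
  show "lift \<phi> \<in> extensional X" by (simp add: lift_def)
  fix A assume A: "A \<in> sets M"
  have "0 < c" using b by (simp add: bilip_def)
  then show "(emeasure M A = 0) = (emeasure M (lift \<phi> ` A) = 0)"
    using lift_emeasure[OF b A] by auto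
qed

lemma lift_measure_le:
  assumes b: "bilip c C \<phi>" and A: "A \<in> sets M"
  shows "measure M (lift \<phi> ` A) \<le> C * measure M A"
  using lift_emeasure(2)[OF b A] bilip_one[OF b]
  by (simp add: emeasure_eq_measure ennreal_mult[symmetric])

text \<open>The hypothesis that \<open>A\<close> avoids the ends of the segment lets parameters of points of \<open>A\<close> be compared
  without regard to a possible identification \<open>p 0 = p m\<close>.\<close>

lemma lift_measure_affine:
  assumes b: "bilip c C \<phi>" and A: "A \<in> sets M" "A \<subseteq> p ` {s..t}" and st: "0 < s" "t < m"
    and aff: "\<And>u. s \<le> u \<Longrightarrow> u \<le> t \<Longrightarrow> \<phi> u = r * u + d" and r: "0 < r"
  shows "measure M (lift \<phi> ` A) = r * measure M A"
proof -
  let ?B = "p -` A \<inter> {0..m}"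
  have "?B \<subseteq> {s..t}"
  proof
    fix u assume u: "u \<in> ?B"
    then obtain v where "v \<in> {s..t}" "p u = p v" using A(2) by auto
    then show "u \<in> {s..t}" using p_eqD[of u v] u st by auto
  qed
  then have im: "\<phi> ` ?B = (\<lambda>u. r * u + d) ` ?B" using aff by (intro image_cong) auto
  have B: "?B \<in> sets borel" by (rule p_sets[OF A(1)])
  have "emeasure lborel ((\<lambda>u. r * u + d) ` ?B) = ennreal r * emeasure lborel ?B"
    using bi_Lipschitz_line_measure(2,3)[of r "\<lambda>u. r * u + d" r ?B, OF r _ _ B]
    by (intro antisym) (auto simp: algebra_simps)
  then have "emeasure M (lift \<phi> ` A) = ennreal r * emeasure M A"
    using im by (simp add: lift_image_sets[OF b A(1)] emeasure_eq_preimage[OF A(1)])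
  then show ?thesis using r by (simp add: measure_def enn2real_mult)
qed

lemma bilip_perturbation:
  assumes "L < 1" "\<psi> 0 = 0" "\<psi> m = 0" "\<And>s t. \<bar>\<psi> t - \<psi> s\<bar> \<le> L * \<bar>t - s\<bar>"
  shows "bilip (1 - L) (1 + L) (\<lambda>t. t + \<psi> t)"
  unfolding bilip_def
proof (intro conjI allI impI)
  fix s t :: real assume "s \<le> t"
  then have "\<bar>\<psi> t - \<psi> s\<bar> \<le> L * (t - s)" using assms(4)[of t s] by simp
  then show "(1 - L) * (t - s) \<le> t + \<psi> t - (s + \<psi> s)" "t + \<psi> t - (s + \<psi> s) \<le> (1 + L) * (t - s)"
    by (auto simp: abs_le_iff algebra_simps)
qed (use assms in auto)

lemma lift_supported:
  assumes b: "bilip c C \<phi>" and "\<And>t. t \<notin> {a<..<b} \<Longrightarrow> \<phi> t = t" "0 \<le> a" "b \<le> m" "x \<in> X" "x \<notin> p ` {a<..<b}"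
  shows "lift \<phi> x = x"
proof -
  have "T x \<notin> {a<..<b}" using assms(5,6) p_T by (metis image_eqI)
  then show ?thesis using assms p_T by (simp add: lift_def)
qed

section \<open>Topology of arcs\<close>

text \<open>Off the two end points, an open arc and the complement of the closed arc are complementary open
  sets.\<close>

lemma connected_arc_dichotomy:
  assumes Q: "connected Q" "Q \<subseteq> X" "p a \<notin> Q" "p b \<notin> Q" and ab: "0 \<le> a" "a \<le> b" "b \<le> m"
  shows "Q \<subseteq> p ` {a<..<b} \<or> Q \<inter> p ` {a..b} = {}"
proof -
  let ?A = "p ` {a..b}" and ?B = "p ` ({0..a} \<union> {b..m})"
  have cl: "closed ?A" "closed ?B"
    using ab by (auto intro!: compact_imp_closed closed_p_image)
  have "{a..b} \<union> ({0..a} \<union> {b..m}) = {0..m}" using ab by auto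
  then have AB: "?A \<union> ?B = X" using p_surj by (metis image_Un)
  have meet: "?A \<inter> ?B \<subseteq> {p a, p b}"
  proof
    fix x assume "x \<in> ?A \<inter> ?B"
    then have "x \<in> ?A" "x \<in> ?B" by auto
    then obtain s t where st: "x = p s" "x = p t" "s \<in> {a..b}" "t \<in> {0..a} \<union> {b..m}"
      by (elim imageE)
    then have "s = t \<or> s = 0 \<and> t = m \<or> s = m \<and> t = 0" using p_eqD[of s t] ab by auto
    then have "s = a \<or> s = b" using st ab m_pos by auto
    then show "x \<in> {p a, p b}" using st by auto
  qed
  have "?A \<inter> Q = {} \<or> ?B \<inter> Q = {}"
  proof (rule connected_closedD[OF Q(1) _ _ cl])
    show "?A \<inter> ?B \<inter> Q = {}" using meet Q(3,4) by auto
    show "Q \<subseteq> ?A \<union> ?B" using AB Q(2) by simp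
  qed
  moreover have "Q \<subseteq> p ` {a<..<b}" if "?B \<inter> Q = {}"
  proof
    fix x assume "x \<in> Q"
    then have "x \<in> p ` {a<..<b} \<union> ?B" "x \<notin> ?B" using Q(2) that arc_complement(2)[OF ab] by auto
    then show "x \<in> p ` {a<..<b}" by (metis UnE)
  qed
  ultimately show ?thesis by auto
qed

lemma arc_neighbourhood:
  assumes "0 \<le> a" "a < s" "s \<le> t" "t < b" "b \<le> m"
  shows "\<exists>e>0. \<forall>x\<in>p ` {s..t}. \<forall>y\<in>X. dist x y < e \<longrightarrow> y \<in> p ` {a<..<b}"
proof -
  let ?B = "p ` ({0..a} \<union> {b..m})"
  have ab: "0 \<le> a" "a \<le> b" "b \<le> m" using assms by auto
  have c: "compact (p ` {s..t})" "closed ?B"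
    using assms by (auto intro!: compact_imp_closed closed_p_image)
  have "p ` {s..t} \<subseteq> p ` {a<..<b}" using assms by (intro image_mono) auto
  then have disj: "p ` {s..t} \<inter> ?B = {}" using arc_complement(1)[OF ab] by blast
  obtain d where d: "0 < d" "\<forall>x\<in>p ` {s..t}. \<forall>y\<in>?B. d \<le> dist x y"
    using separate_compact_closed[OF c disj] by metis
  have "y \<in> p ` {a<..<b}" if xy: "x \<in> p ` {s..t}" "y \<in> X" "dist x y < d" for x y
  proof -
    have "y \<notin> ?B"
    proof
      assume "y \<in> ?B"
      then have "d \<le> dist x y" by (rule d(2)[THEN bspec, THEN bspec, OF xy(1)])
      then show False using xy(3) by simp
    qed
    then show ?thesis using arc_complement(2)[OF ab] xy(2) by (metis UnE)
  qed
  then show ?thesis using d(1) by blast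
qed

lemma p_uniformly_continuous:
  assumes "e > 0"
  shows "\<exists>d>0. \<forall>s\<in>{0..m}. \<forall>t\<in>{0..m}. \<bar>s - t\<bar> < d \<longrightarrow> dist (p s) (p t) < e"
proof -
  have uc: "uniformly_continuous_on {0..m} p"
    by (rule compact_uniformly_continuous[OF p_continuous compact_Icc])
  obtain d where "d > 0"
    and d: "\<And>s t. s \<in> {0..m} \<Longrightarrow> t \<in> {0..m} \<Longrightarrow> dist t s < d \<Longrightarrow> dist (p t) (p s) < e"
    by (rule uniformly_continuous_onE[OF uc assms]) (rule that)
  then show ?thesis by (intro exI[of _ d]) (simp add: dist_real_def)
qed

lemma p_in_image_iff:
  assumes "0 < t" "t < m" "B \<subseteq> {0..m}"
  shows "p t \<in> p ` B \<longleftrightarrow> t \<in> B"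
proof
  assume "p t \<in> p ` B"
  then obtain b where "b \<in> B" "p t = p b" by (elim imageE)
  then show "t \<in> B" using p_eq_iff[of t b] assms by auto
qed simp

lemma p_in_Ioo_iff:
  assumes "0 < t" "t < m" "0 \<le> a" "b \<le> m"
  shows "p t \<in> p ` {a<..<b} \<longleftrightarrow> t \<in> {a<..<b}"
  by (rule p_in_image_iff) (use assms in auto)

section \<open>Minimality of the compact-open topology\<close>

definition tent :: "real \<Rightarrow> real \<Rightarrow> real \<Rightarrow> real" where
  "tent s l t = max 0 (l - \<bar>t - s\<bar>)"

lemma tent_Lipschitz: "\<bar>tent s l t - tent s l t'\<bar> \<le> \<bar>t - t'\<bar>"
  unfolding tent_def by linarith

lemma tent_zero: "l \<le> \<bar>t - s\<bar> \<Longrightarrow> tent s l t = 0"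
  by (simp add: tent_def)

lemma bump_bilip:
  assumes "0 < l" "0 \<le> s - l" "s + l \<le> m"
  shows "bilip (1/2) (3/2) (\<lambda>t. t + tent s l t / 2)"
proof -
  have "bilip (1 - 1/2) (1 + 1/2) (\<lambda>t. t + tent s l t / 2)"
  proof (rule bilip_perturbation)
    show "\<bar>tent s l t / 2 - tent s l t' / 2\<bar> \<le> 1 / 2 * \<bar>t - t'\<bar>" for t' t
      using tent_Lipschitz[of s l t t'] by (simp flip: diff_divide_distrib)
  qed (use assms in \<open>auto simp: tent_def\<close>)
  then show ?thesis by simp
qed

text \<open>Two bumps around the same centre, the second half as wide as the first: at the centre \<open>s\<close> the
  narrow bump followed by the wide one leads to the parameter \<open>s + 5/8 * l\<close>, the wide one followed by
  the narrow one to \<open>s + l/2\<close>, where the narrow bump vanishes.\<close>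

lemma noncommuting_pair:
  assumes ab: "0 \<le> a" "a < b" "b \<le> m"
  obtains g h where "g \<in> G" "h \<in> G" "g \<odot> h \<noteq> h \<odot> g"
    "\<And>x. x \<in> X \<Longrightarrow> x \<notin> p ` {a<..<b} \<Longrightarrow> g x = x"
    "\<And>x. x \<in> X \<Longrightarrow> x \<notin> p ` {a<..<b} \<Longrightarrow> h x = x"
proof -
  define s where "s = (a + b) / 2"
  define l where "l = (b - a) / 2"
  have l: "0 < l" "s - l = a" "s + l = b" using ab by (auto simp: s_def l_def field_simps)
  define \<phi> where "\<phi> = (\<lambda>t. t + tent s l t / 2)"
  define q where "q = (\<lambda>t. t + tent s (l/2) t / 2)"
  have b1: "bilip (1/2) (3/2) \<phi>" unfolding \<phi>_def using l ab by (intro bump_bilip) auto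
  have b2: "bilip (1/2) (3/2) q" unfolding q_def using l ab by (intro bump_bilip) auto
  have G: "lift \<phi> \<in> G" "lift q \<in> G" using lift_in_G b1 b2 by auto
  have bds: "0 < s" "s + 5/8 * l < m" "s + l/2 < m" using l ab by auto
  have v: "\<phi> s = s + l/2" "q s = s + l/4" "\<phi> (s + l/4) = s + 5/8 * l" "q (s + l/2) = s + l/2"
    using l by (auto simp: \<phi>_def q_def tent_def)
  have "(lift \<phi> \<odot> lift q) (p s) = p (s + 5/8 * l)"
    using G bds l v lift_p[OF b1] lift_p[OF b2] by (simp add: p_in)
  moreover have "(lift q \<odot> lift \<phi>) (p s) = p (s + l/2)"
    using G bds l v lift_p[OF b1] lift_p[OF b2] by (simp add: p_in)
  moreover have "p (s + 5/8 * l) \<noteq> p (s + l/2)"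
    using p_eq_iff[of "s + 5/8 * l" "s + l/2"] bds l by simp
  ultimately have "lift \<phi> \<odot> lift q \<noteq> lift q \<odot> lift \<phi>" by metis
  moreover have id: "\<phi> t = t" "q t = t" if "t \<notin> {a<..<b}" for t
    using that l by (auto simp: \<phi>_def q_def tent_def)
  have "lift \<phi> x = x" "lift q x = x" if "x \<in> X" "x \<notin> p ` {a<..<b}" for x
    using lift_supported[OF b1 id(1) ab(1,3) that] lift_supported[OF b2 id(2) ab(1,3) that] by auto
  ultimately show ?thesis using G by (intro that[of "lift \<phi>" "lift q"])
qed

lemma disjoint_supports_commute:
  assumes k: "k \<in> G" and h: "h \<in> G" and AB: "A \<inter> B = {}"
    and kA: "\<And>x. x \<in> X \<Longrightarrow> x \<notin> A \<Longrightarrow> k x = x" and hB: "\<And>x. x \<in> X \<Longrightarrow> x \<notin> B \<Longrightarrow> h x = x"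
  shows "k \<odot> h = h \<odot> k"
proof (rule G_eqI)
  fix x assume x: "x \<in> X"
  have kin: "k x = x \<or> k x \<in> A" if "x \<in> X" for x
    using kA[of "k x"] G_in[OF k that] inj_onD[OF G_inj[OF k], of "k x" x] that by metis
  have hin: "h x = x \<or> h x \<in> B" if "x \<in> X" for x
    using hB[of "h x"] G_in[OF h that] inj_onD[OF G_inj[OF h], of "h x" x] that by metis
  have "k (h x) = h (k x)"
  proof (cases "h x = x")
    case True
    then show ?thesis using kin[OF x] hB[of "k x"] AB G_in[OF k x] by (metis disjoint_iff)
  next
    case False
    then have "x \<in> B" "h x \<in> B" using hB[OF x] hin[OF x] by auto
    then have "k x = x" "k (h x) = h x" using kA AB x G_in[OF h x] by auto
    then show ?thesis by simp
  qed
  then show "(k \<odot> h) x = (h \<odot> k) x" using k h x by simp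
qed (use k h in auto)

text \<open>Otherwise the conjugate of \<open>g\<close> would be supported in \<open>f J\<close>, disjoint from the support of \<open>h\<close> in \<open>J\<close>,
  and would commute with \<open>h\<close>.\<close>

lemma nbhd_meets_arc:
  assumes "topological_group GG S" "Hausdorff_space S" and ab: "0 \<le> a" "a < b" "b \<le> m"
  shows "\<exists>V. topological_group.nbhd GG S V \<and>
     (\<forall>f\<in>V. \<exists>s\<in>{a<..<b}. \<exists>t\<in>{a<..<b}. f (p s) = p t)"
proof -
  interpret S: topological_group GG S by fact
  obtain g h where g: "g \<in> G" and h: "h \<in> G" and gh: "g \<odot> h \<noteq> h \<odot> g"
    and gs: "\<And>x. x \<in> X \<Longrightarrow> x \<notin> p ` {a<..<b} \<Longrightarrow> g x = x"
    and hs: "\<And>x. x \<in> X \<Longrightarrow> x \<notin> p ` {a<..<b} \<Longrightarrow> h x = x"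
    using noncommuting_pair[OF ab] by metis
  obtain V where V: "S.nbhd V" "\<forall>f\<in>V. (f \<odot> g \<odot> ginv f) \<odot> h \<noteq> h \<odot> (f \<odot> g \<odot> ginv f)"
    using S.nbhd_noncommuting[OF assms(2), of g h] g h gh by auto
  have "\<exists>s\<in>{a<..<b}. \<exists>t\<in>{a<..<b}. f (p s) = p t" if fV: "f \<in> V" for f
  proof (rule ccontr)
    assume no: "\<not> ?thesis"
    have f: "f \<in> G" using S.nbhd_subset[OF V(1)] fV by auto
    have "f ` p ` {a<..<b} \<inter> p ` {a<..<b} = {}" using no by auto
    moreover have "(f \<odot> g \<odot> ginv f) x = x" if "x \<in> X" "x \<notin> f ` p ` {a<..<b}" for x
    proof -
      have "ginv f x \<notin> p ` {a<..<b}" using that f by (metis apply_ginv image_eqI)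
      then show ?thesis using that f g gs[of "ginv f x"] by (simp add: G_in)
    qed
    ultimately have "(f \<odot> g \<odot> ginv f) \<odot> h = h \<odot> (f \<odot> g \<odot> ginv f)"
      using f g h hs by (intro disjoint_supports_commute[of _ h "f ` p ` {a<..<b}" "p ` {a<..<b}"]) auto
    then show False using V(2) fV by blast
  qed
  then show ?thesis using V(1) by blast
qed

lemma chain_cover:
  fixes t :: "nat \<Rightarrow> real"
  assumes "t 0 \<le> v" "v \<le> t n" "0 < n"
  shows "\<exists>i<n. t i \<le> v \<and> v \<le> t (Suc i)"
  using assms
proof (induction n)
  case (Suc n)
  show ?case
  proof (cases "0 < n \<and> v \<le> t n")
    case True
    then show ?thesis using Suc less_SucI by blast
  next
    case False
    then show ?thesis using Suc.prems by (intro exI[of _ n]) (cases n; auto)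
  qed
qed simp

lemma connected_p_image: "connected S \<Longrightarrow> S \<subseteq> {0..m} \<Longrightarrow> connected (p ` S)"
  by (intro connected_continuous_image continuous_on_subset[OF p_continuous])

lemma connected_G_image:
  "f \<in> G \<Longrightarrow> connected Q \<Longrightarrow> Q \<subseteq> X \<Longrightarrow> connected (f ` Q)"
  by (intro connected_continuous_image continuous_on_subset[OF G_continuous])

text \<open>On a closed curve the images of the end points bound two arcs, and the image of the given arc could
  be either of them. The further point \<open>p k\<close>, whose image lies off the arc from \<open>t\<close> to \<open>t'\<close>, rules out
  the wrong one.\<close>

lemma arc_image_eq:
  assumes f: "f \<in> G" and s: "0 < s" "s < s'" "s' < m" and t: "0 < t" "t < t'" "t' < m"
    and fs: "f (p s) = p t" "f (p s') = p t'"
    and k: "0 < k" "k < m" "k \<notin> {s..s'}" "0 < k'" "k' < m" "k' \<notin> {t..t'}" "f (p k) = p k'"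
  shows "f ` p ` {s..s'} = p ` {t..t'}"
proof -
  define Q where "Q = f ` p ` {s..s'}"
  define C where "C = f ` p ` {s<..<s'}"
  have inj: "p u = p v" if "f (p u) = f (p v)" "u \<in> {0..m}" "v \<in> {0..m}" for u v
    using inj_onD[OF G_inj[OF f] that(1)] that p_in by auto
  have QX: "Q \<subseteq> X" "C \<subseteq> X" unfolding Q_def C_def using s G_in[OF f] p_in by auto
  have con: "connected Q" "connected C" unfolding Q_def C_def using s
    by (auto intro!: connected_G_image[OF f] connected_p_image p_in)
  have QC: "Q \<subseteq> insert (p t) (insert (p t') C)"
  proof
    fix y assume "y \<in> Q"
    then obtain u where u: "u \<in> {s..s'}" "y = f (p u)" by (auto simp: Q_def)
    then consider "u = s" | "u = s'" | "u \<in> {s<..<s'}" by fastforce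
    then show "y \<in> insert (p t) (insert (p t') C)"
      by cases (use u fs in \<open>auto simp: C_def\<close>)
  qed
  have tQ: "p t \<in> Q" "p t' \<in> Q" 
  proof -
    have "p s \<in> p ` {s..s'}" "p s' \<in> p ` {s..s'}" using s by auto
    then show "p t \<in> Q" "p t' \<in> Q" unfolding Q_def using fs by (metis image_eqI)+
  qed
  have nC: "p t \<notin> C" "p t' \<notin> C"
  proof -
    have "p u \<noteq> p s" "p u \<noteq> p s'" if "u \<in> {s<..<s'}" for u
      using that s p_eq_iff[of s u] p_eq_iff[of s' u] by auto
    then show "p t \<notin> C" "p t' \<notin> C"
      using inj[of _ s] inj[of _ s'] s unfolding C_def fs[symmetric] by force+
  qed
  have kQ: "p k' \<notin> Q"
  proof
    assume "p k' \<in> Q"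
    then obtain u where u: "u \<in> {s..s'}" "f (p k) = f (p u)" using k(7) by (auto simp: Q_def)
    then have "p k = p u" using inj k s by auto
    then show False using p_eq_iff[of k u] k u s by auto
  qed
  have sub: "C \<subseteq> p ` {t<..<t'}"
  proof (rule ccontr)
    assume "\<not> C \<subseteq> p ` {t<..<t'}"
    then have dis: "C \<inter> p ` {t..t'} = {}"
      using connected_arc_dichotomy[OF con(2) QX(2) nC] t by auto
    define u where "u = (t + t') / 2"
    have u: "t < u" "u < t'" using t by (auto simp: u_def)
    have uQ: "p u \<notin> Q"
    proof
      assume "p u \<in> Q"
      moreover have "p u \<notin> C"
      proof
        assume "p u \<in> C"
        moreover have "p u \<in> p ` {t..t'}" using u by auto
        ultimately show False using dis by auto
      qed
      ultimately have "p u = p t \<or> p u = p t'" using QC by auto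
      then show False using p_eq_iff[of u t] p_eq_iff[of u t'] u t by auto
    qed
    show False
    proof (cases "k' < t")
      case True
      have "Q \<subseteq> p ` {k'<..<u} \<or> Q \<inter> p ` {k'..u} = {}"
        using True u t k by (intro connected_arc_dichotomy[OF con(1) QX(1) kQ uQ]) auto
      moreover have "p t \<in> p ` {k'..u}" using True u by auto
      ultimately have "p t' \<in> p ` {k'<..<u}" using tQ by auto
      then show False using p_in_Ioo_iff[of t' k' u] u t k True by auto
    next
      case False
      then have k't: "t' < k'" using k by auto
      have "Q \<subseteq> p ` {u<..<k'} \<or> Q \<inter> p ` {u..k'} = {}"
        using k't u t k by (intro connected_arc_dichotomy[OF con(1) QX(1) uQ kQ]) auto
      moreover have "p t' \<in> p ` {u..k'}" using k't u by auto
      ultimately have "p t \<in> p ` {u<..<k'}" using tQ by auto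
      then show False using p_in_Ioo_iff[of t u k'] u t k by auto
    qed
  qed
  have "Q \<subseteq> p ` {t..t'}"
  proof
    fix y assume "y \<in> Q"
    then have "y = p t \<or> y = p t' \<or> y \<in> p ` {t<..<t'}" using QC sub by auto
    then show "y \<in> p ` {t..t'}" using t by auto
  qed
  moreover have "p ` {t..t'} \<subseteq> Q"
  proof
    fix y assume "y \<in> p ` {t..t'}"
    then obtain v where v: "v \<in> {t..t'}" "y = p v" by auto
    show "y \<in> Q"
    proof (rule ccontr)
      assume "y \<notin> Q"
      then have vQ: "p v \<notin> Q" using v by simp
      have "p 0 \<notin> p ` {t..t'}"
      proof
        assume "p 0 \<in> p ` {t..t'}"
        then obtain w where "w \<in> {t..t'}" "p w = p 0" by auto
        then show False using p_eq_iff[of w 0] t by auto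
      qed
      then have "p 0 \<notin> Q" using \<open>Q \<subseteq> p ` {t..t'}\<close> by auto
      then have "Q \<subseteq> p ` {0<..<v} \<or> Q \<inter> p ` {0..v} = {}"
        using v t by (intro connected_arc_dichotomy[OF con(1) QX(1) _ vQ]) auto
      moreover have "p t \<in> p ` {0..v}" using v t by auto
      ultimately have "p t' \<in> p ` {0<..<v}" using tQ by auto
      then show False using p_in_Ioo_iff[of t' 0 v] v t by auto
    qed
  qed
  ultimately show ?thesis unfolding Q_def by auto
qed

text \<open>If in every cell of the grid some point is mapped into the same cell, then the arcs between
  consecutive such points are mapped onto the corresponding arcs, which are short. What remains is
  the part of the space before the first and after the last marked point. On a closed curve this is
  one short arc around \<open>p 0\<close>. On an arc it consists of two short arcs that could only be
  interchanged, and this is impossible because each of them is connected and contains a marked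
  point.\<close>

lemma grid_close:
  assumes n: "3 \<le> n" and f: "f \<in> G"
    and s: "\<And>i. i < n \<Longrightarrow> real i * m / n < s i \<and> s i < (real i + 1) * m / n"
    and t: "\<And>i. i < n \<Longrightarrow> real i * m / n < t i \<and> t i < (real i + 1) * m / n"
    and fst: "\<And>i. i < n \<Longrightarrow> f (p (s i)) = p (t i)"
    and osc: "\<And>u v. u \<in> {0..m} \<Longrightarrow> v \<in> {0..m} \<Longrightarrow> \<bar>u - v\<bar> \<le> 2 * m / n \<Longrightarrow> dist (p u) (p v) < e"
    and x: "x \<in> X"
  shows "dist (f x) x < 2 * e"
proof -
  have n0: "0 < real n" using n by simp
  define h where "h = m / n"
  have h: "0 < h" "real n * h = m" using m_pos n0 by (auto simp: h_def)
  have sh: "real i * h < s i" "s i < (real i + 1) * h" "real i * h < t i" "t i < (real i + 1) * h"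
    if "i < n" for i using s[OF that] t[OF that] by (auto simp: h_def)
  have bd: "(real i + 1) * h \<le> m" "0 \<le> real i * h" if "i < n" for i
  proof -
    have "(real i + 1) * h \<le> real n * h" using that h by (intro mult_right_mono) auto
    then show "(real i + 1) * h \<le> m" using h by simp
    show "0 \<le> real i * h" using h by simp
  qed
  have in0: "0 < s i" "s i < m" "0 < t i" "t i < m" if "i < n" for i
    using sh[OF that] bd[OF that] by linarith+
  have less: "s i < s j" "t i < t j" if "i < j" "j < n" for i j
  proof -
    have "(real i + 1) * h \<le> real j * h" using that h by (intro mult_right_mono) auto
    then show "s i < s j" "t i < t j" using sh[of i] sh[of j] that by linarith+
  qed
  have img: "f ` p ` {s i..s (Suc i)} = p ` {t i..t (Suc i)}" if i: "Suc i < n" for i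
  proof -
    \<comment> \<open>A third marked point exists because there are at least three cells.\<close>
    obtain k where k: "k < n" "k < i \<or> Suc i < k"
    proof (cases "i = 0")
      case True
      then show ?thesis using that[of 2] n by simp
    next
      case False
      then show ?thesis using that[of 0] n by simp
    qed
    then have "s k \<notin> {s i..s (Suc i)}" "t k \<notin> {t i..t (Suc i)}"
      using less[of k i] less[of "Suc i" k] i by auto
    then show ?thesis using i k in0 less[of i "Suc i"] fst
      by (intro arc_image_eq[OF f, of _ _ _ _ "s k" "t k"]) auto
  qed
  obtain u where u: "u \<in> {0..m}" "x = p u" using x p_surj by auto
  obtain v where v: "v \<in> {0..m}" "f x = p v" using G_in[OF f x] p_surj by (metis imageE)
  have key: "dist (f x) x < 2 * e" if "dist (p a) (p u) < e" "f x = p a" for a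
  proof -
    have "dist (f x) x < e" using that by (simp only: u(2)[symmetric])
    then show ?thesis using zero_le_dist[of "f x" x] by linarith
  qed
  have n1: "n - 1 < n" "0 < n" "0 < n - 1" "real (n - 1) = real n - 1" using n by auto
  show ?thesis
  proof (cases "s 0 \<le> u \<and> u \<le> s (n - 1)")
    case True
    then obtain i where i: "i < n - 1" "s i \<le> u" "u \<le> s (Suc i)"
      using chain_cover[of s u "n - 1"] n1 by auto
    then have "Suc i < n" by simp
    have "f x \<in> f ` p ` {s i..s (Suc i)}" using u i by auto
    then obtain w where w: "w \<in> {t i..t (Suc i)}" "f x = p w" using img[OF \<open>Suc i < n\<close>] by auto
    have "\<bar>w - u\<bar> \<le> 2 * h" "w \<in> {0..m}"
      using w i sh[of i] sh[OF \<open>Suc i < n\<close>] \<open>Suc i < n\<close> in0[of i] in0[of "Suc i"]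
      by (auto simp: abs_le_iff algebra_simps)
    then have "dist (p w) (p u) < e" using osc[of w u] u by (simp add: h_def)
    then show ?thesis by (rule key[OF _ w(2)])
  next
    case False
    have vout: "v \<le> t 0 \<or> t (n - 1) \<le> v"
    proof (rule ccontr)
      assume nv: "\<not> ?thesis"
      then obtain i where i: "i < n - 1" "t i \<le> v" "v \<le> t (Suc i)"
        using chain_cover[of t v "n - 1"] n1 by auto
      then have Si: "Suc i < n" by simp
      have "p v \<in> p ` {t i..t (Suc i)}" using i by auto
      then have "f x \<in> f ` p ` {s i..s (Suc i)}" using v img[OF Si] by simp
      then obtain w where w: "w \<in> {s i..s (Suc i)}" "f x = f (p w)" by auto
      have "i < n" using i by simp
      have wb: "0 < w" "w < m" using w in0[OF \<open>i < n\<close>] in0[OF Si] by auto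
      then have "x = p w" using inj_onD[OF G_inj[OF f] w(2) x] by (simp add: p_in)
      then have "p w = p u" using u(2) by metis
      then have "u = w" using p_eq_iff[OF wb, of u] u(1) by simp
      have "s 0 \<le> s i" using less[of 0 i] \<open>i < n\<close> by (cases "i = 0") auto
      moreover have "s (Suc i) \<le> s (n - 1)" using less[of "Suc i" "n - 1"] i n1 by (cases "Suc i = n - 1") auto
      ultimately show False using False w \<open>u = w\<close> by auto
    qed
    have s0: "s 0 < h" "t 0 < h" using sh[of 0] n1 by auto
    have sn: "m - h < s (n - 1)" "m - h < t (n - 1)"
      using sh[OF n1(1)] n1(4) h by (auto simp: algebra_simps)
    have near: "dist (p a) (p b) < e" if "a \<in> {0..m}" "b \<in> {0..m}" "\<bar>a - b\<bar> \<le> h" for a b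
      using osc[OF that(1,2)] that(3) h by (simp add: h_def)
    show ?thesis
    proof (cases "p 0 = p m")
      case True
      have c: "dist (p a) (p 0) < e" if "a \<in> {0..m}" "a \<le> h \<or> m - h \<le> a" for a
      proof (cases "a \<le> h")
        case le: True
        then show ?thesis using near[of a 0] that m_pos by auto
      next
        case False
        then show ?thesis using near[of a m] that True m_pos by auto
      qed
      have "dist (p u) (p 0) < e" "dist (p v) (p 0) < e"
        using c[OF u(1)] c[OF v(1)] False vout s0 sn by linarith+
      then have "dist (p v) (p u) < 2 * e" using dist_triangle2[of "p v" "p u" "p 0"] by linarith
      then show ?thesis by (simp only: u(2)[symmetric] v(2)[symmetric])
    next
      case p0m: False
      have dis: "p ` {0..t 0} \<inter> p ` {t (n - 1)..m} = {}"
      proof (rule ccontr)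
        assume "\<not> ?thesis"
        then obtain y where "y \<in> p ` {0..t 0}" "y \<in> p ` {t (n - 1)..m}" by auto
        then obtain a b where ab: "a \<in> {0..t 0}" "b \<in> {t (n - 1)..m}" "p a = p b"
          by (elim imageE) simp
        have "t 0 < t (n - 1)" using less n1 by simp
        then show False using p_eqD[OF ab(3)] ab p0m in0[of 0] in0[OF n1(1)] n1 by auto
      qed
      have cl: "closed (p ` {0..t 0})" "closed (p ` {t (n - 1)..m})"
        using in0[of 0] in0[OF n1(1)] n1 by (auto intro!: compact_imp_closed closed_p_image)
      \<comment> \<open>Images of points outside the inner arcs lie outside the inner arcs, by injectivity.\<close>
      have outer: "f ` p ` R \<subseteq> p ` {0..t 0} \<union> p ` {t (n - 1)..m}"
        if R: "R \<subseteq> {0..m}" "\<And>r. r \<in> R \<Longrightarrow> r \<le> s 0 \<or> s (n - 1) \<le> r" for R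
      proof
        fix y assume "y \<in> f ` p ` R"
        then obtain r where r: "r \<in> R" "y = f (p r)" by auto
        then have "p r \<in> X" using R(1) by (intro p_in) auto
        then have "y \<in> p ` {0..m}" using G_in[OF f] r(2) p_surj by simp
        then obtain w where w: "w \<in> {0..m}" "y = p w" by (elim imageE)
        show "y \<in> p ` {0..t 0} \<union> p ` {t (n - 1)..m}"
        proof (rule ccontr)
          assume no: "y \<notin> p ` {0..t 0} \<union> p ` {t (n - 1)..m}"
          have wb: "t 0 < w" "w < t (n - 1)"
          proof -
            have "w \<notin> {0..t 0}" "w \<notin> {t (n - 1)..m}" using no w(2) by (metis UnI1 UnI2 image_eqI)+
            then show "t 0 < w" "w < t (n - 1)" using w(1) by auto
          qed
          then obtain i where i: "i < n - 1" "t i \<le> w" "w \<le> t (Suc i)"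
            using chain_cover[of t w "n - 1"] n1 by auto
          then have Si: "Suc i < n" by simp
          have "p w \<in> p ` {t i..t (Suc i)}" using i by auto
          then have "y \<in> f ` p ` {s i..s (Suc i)}" using w img[OF Si] by simp
          then obtain q where q: "q \<in> {s i..s (Suc i)}" "f (p r) = f (p q)" using r by auto
          have "i < n" using i by simp
          have qb: "0 < q" "q < m" using q in0[OF \<open>i < n\<close>] in0[OF Si] by auto
          have "p r = p q"
          proof (rule inj_onD[OF G_inj[OF f] q(2)])
            show "p r \<in> X" "p q \<in> X" using r R(1) qb by (auto intro!: p_in)
          qed
          then have "r = q" using p_eq_iff[OF qb, of r] r R(1) by auto
          have "s 0 \<le> s i" using less[of 0 i] \<open>i < n\<close> by (cases "i = 0") auto
          moreover have "s (Suc i) \<le> s (n - 1)"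
            using less[of "Suc i" "n - 1"] i n1 by (cases "Suc i = n - 1") auto
          ultimately have "r = s 0 \<or> r = s (n - 1)" using R(2)[OF r(1)] q \<open>r = q\<close> by auto
          then have "y = p (t 0) \<or> y = p (t (n - 1))" using r fst n1 by auto
          then show False using no in0[of 0] in0[OF n1(1)] n1 by auto
        qed
      qed
      show ?thesis
      proof (cases "u \<le> s 0")
        case True
        let ?Q = "f ` p ` {0..s 0}"
        have "connected ?Q" using in0[of 0] n1
          by (intro connected_G_image[OF f] connected_p_image) (auto intro!: p_in)
        moreover have "?Q \<subseteq> p ` {0..t 0} \<union> p ` {t (n - 1)..m}"
          using in0[of 0] n1 by (intro outer) auto
        ultimately have "p ` {0..t 0} \<inter> ?Q = {} \<or> p ` {t (n - 1)..m} \<inter> ?Q = {}"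
          using dis by (intro connected_closedD cl) auto
        moreover have "p (t 0) \<in> p ` {0..t 0} \<inter> ?Q"
        proof
          show "p (t 0) \<in> p ` {0..t 0}" using in0[of 0] n1 by auto
          have "p (s 0) \<in> p ` {0..s 0}" using in0[of 0] n1 by auto
          then show "p (t 0) \<in> ?Q" using fst[of 0] n1 by (metis image_eqI)
        qed
        ultimately have "p ` {t (n - 1)..m} \<inter> ?Q = {}" by auto
        moreover have "f x \<in> ?Q" using u True by auto
        ultimately have "f x \<notin> p ` {t (n - 1)..m}" by auto
        then have "v \<notin> {t (n - 1)..m}" using v(2) by (metis image_eqI)
        then have "v < t (n - 1)" using v(1) by auto
        then have "v \<le> t 0" using vout by auto
        then have "dist (p v) (p u) < e" using near[OF v(1) u(1)] u v s0 True by auto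
        then show ?thesis by (rule key[OF _ v(2)])
      next
        case False2: False
        then have us: "s (n - 1) \<le> u" using False by auto
        let ?Q = "f ` p ` {s (n - 1)..m}"
        have "connected ?Q" using in0[OF n1(1)] n1
          by (intro connected_G_image[OF f] connected_p_image) (auto intro!: p_in)
        moreover have "?Q \<subseteq> p ` {0..t 0} \<union> p ` {t (n - 1)..m}"
          using in0[OF n1(1)] n1 by (intro outer) auto
        ultimately have "p ` {0..t 0} \<inter> ?Q = {} \<or> p ` {t (n - 1)..m} \<inter> ?Q = {}"
          using dis by (intro connected_closedD cl) auto
        moreover have "p (t (n - 1)) \<in> p ` {t (n - 1)..m} \<inter> ?Q"
        proof
          show "p (t (n - 1)) \<in> p ` {t (n - 1)..m}" using in0[OF n1(1)] by auto
          have "p (s (n - 1)) \<in> p ` {s (n - 1)..m}" using in0[OF n1(1)] by auto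
          then show "p (t (n - 1)) \<in> ?Q" using fst[OF n1(1)] by (metis image_eqI)
        qed
        ultimately have "p ` {0..t 0} \<inter> ?Q = {}" by auto
        moreover have "f x \<in> ?Q" using u us by auto
        ultimately have "f x \<notin> p ` {0..t 0}" by auto
        then have "v \<notin> {0..t 0}" using v(2) by (metis image_eqI)
        then have "t 0 < v" using v(1) by auto
        then have "t (n - 1) \<le> v" using vout by auto
        then have "dist (p v) (p u) < e" using near[OF v(1) u(1)] u v sn us by auto
        then show ?thesis by (rule key[OF _ v(2)])
      qed
    qed
  qed
qed

theorem tau_co_coarsest:
  assumes S: "topological_group GG S" "Hausdorff_space S"
  shows "coarser_topology tco S"
proof (rule topological_group_coarser[OF _ S(1)])
  interpret S: topological_group GG S by fact
  show "topological_group GG tco" by (rule co.topological_group_axioms)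
  fix V assume "co.nbhd V"
  then obtain e where e: "e > 0" "\<And>h. h \<in> G \<Longrightarrow> sup_dist h one < e \<Longrightarrow> h \<in> V"
    using co_nbhd_contains_ball by metis
  have "e / 4 > 0" using e by simp
  then obtain d where d: "d > 0" "\<And>s t. s \<in> {0..m} \<Longrightarrow> t \<in> {0..m} \<Longrightarrow> \<bar>s - t\<bar> < d \<Longrightarrow> dist (p s) (p t) < e/4"
    using p_uniformly_continuous[of "e/4"] by metis
  obtain n0 where n0: "2 * m / d < real n0" using reals_Archimedean2 by blast
  define n where "n = n0 + 3"
  have n: "3 \<le> n" "0 < real n" and "2 * m / d < real n" using n0 by (auto simp: n_def)
  then have nd: "2 * m / n < d" using d(1) by (simp add: field_simps)
  have "\<exists>W. S.nbhd W \<and> (\<forall>f\<in>W. \<exists>s\<in>{real i * m / n<..<(real i + 1) * m / n}.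
      \<exists>t\<in>{real i * m / n<..<(real i + 1) * m / n}. f (p s) = p t)" if "i < n" for i
  proof (rule nbhd_meets_arc[OF S])
    show "0 \<le> real i * m / n" using m_pos by simp
    show "real i * m / n < (real i + 1) * m / n" using m_pos n by (simp add: divide_strict_right_mono)
    have "(real i + 1) * m \<le> real n * m" using that m_pos by (intro mult_right_mono) auto
    then show "(real i + 1) * m / n \<le> m" using n by (simp add: field_simps)
  qed
  then obtain W where W: "\<And>i. i < n \<Longrightarrow> S.nbhd (W i)"
    "\<And>i f. i < n \<Longrightarrow> f \<in> W i \<Longrightarrow> \<exists>s\<in>{real i * m / n<..<(real i + 1) * m / n}.
      \<exists>t\<in>{real i * m / n<..<(real i + 1) * m / n}. f (p s) = p t"
    by metis
  obtain N where N: "S.nbhd N" "\<forall>i\<in>{..<n}. N \<subseteq> W i"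
    using S.nbhd_INT[of "{..<n}" W] W(1) by auto
  have "f \<in> V" if fN: "f \<in> N" for f
  proof -
    have f: "f \<in> G" using S.nbhd_subset[OF N(1)] fN by auto
    have "\<forall>i. \<exists>s t. i < n \<longrightarrow> s \<in> {real i * m / n<..<(real i + 1) * m / n} \<and>
        t \<in> {real i * m / n<..<(real i + 1) * m / n} \<and> f (p s) = p t"
      using W(2) N(2) fN by (metis lessThan_iff subsetD)
    then obtain s t where st: "\<And>i. i < n \<Longrightarrow> s i \<in> {real i * m / n<..<(real i + 1) * m / n} \<and>
        t i \<in> {real i * m / n<..<(real i + 1) * m / n} \<and> f (p (s i)) = p (t i)"
      by metis
    have "dist (f x) x < 2 * (e/4)" if "x \<in> X" for x
      by (rule grid_close[OF n(1) f, of s t]) (use st d(2) nd that in auto)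
    then have "sup_dist f one \<le> e/2"
      using f by (subst sup_dist_le_iff) (auto intro: less_imp_le)
    then show ?thesis using e f by auto
  qed
  then show "\<exists>W. S.nbhd W \<and> W \<subseteq> V" using N(1) by blast
qed

section \<open>Vanishing of the limiting affinity\<close>

text \<open>The piecewise affine self-map of \<open>{0..m}\<close> that fixes the ends and carries \<open>{a..b}\<close> onto \<open>{u..v}\<close>.\<close>

definition stretch :: "real \<Rightarrow> real \<Rightarrow> real \<Rightarrow> real \<Rightarrow> real \<Rightarrow> real" where
  "stretch a b u v t = (if t \<le> a then (u / a) * t
     else if t \<le> b then u + ((v - u) / (b - a)) * (t - a)
     else v + ((m - v) / (m - b)) * (t - b))"

lemma stretch_bilip:
  assumes ab: "0 < a" "a < b" "b < m" and uv: "0 < u" "u < v" "v < m"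
  shows "\<exists>c C. bilip c C (stretch a b u v)"
proof -
  define k1 k2 k3 where "k1 = u / a" and "k2 = (v - u) / (b - a)" and "k3 = (m - v) / (m - b)"
  define c C where "c = min k1 (min k2 k3)" and "C = max k1 (max k2 k3)"
  let ?f = "stretch a b u v"
  have ks: "0 < k1" "0 < k2" "0 < k3" using ab uv by (auto simp: k1_def k2_def k3_def)
  have cC: "c \<le> k1" "c \<le> k2" "c \<le> k3" "k1 \<le> C" "k2 \<le> C" "k3 \<le> C" by (auto simp: c_def C_def)
  have k2e: "k2 * (b - a) = v - u" using ab by (simp add: k2_def)
  have k1e: "k1 * a = u" using ab by (simp add: k1_def)
  have f1: "?f t = k1 * t" if "t \<le> a" for t using that by (simp add: stretch_def k1_def)
  have f2: "?f t = u + k2 * (t - a)" if "a \<le> t" "t \<le> b" for t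
    using that ab k1e by (cases "t = a") (auto simp: stretch_def k1_def[symmetric] k2_def[symmetric])
  have f3: "?f t = v + k3 * (t - b)" if "b \<le> t" for t
    using that ab k2e by (cases "t = b") (auto simp: stretch_def k2_def[symmetric] k3_def[symmetric])
  have e1: "?f t - ?f s = k1 * (t - s)" if "s \<le> t" "t \<le> a" for s t
    using that by (simp add: f1 right_diff_distrib)
  have e2: "?f t - ?f s = k2 * (t - s)" if "a \<le> s" "s \<le> t" "t \<le> b" for s t
    using that by (simp add: f2 right_diff_distrib)
  have e3: "?f t - ?f s = k3 * (t - s)" if "b \<le> s" "s \<le> t" for s t
    using that by (simp add: f3 right_diff_distrib)
  have lo: "c * (t - s) \<le> ?f t - ?f s" if "0 \<le> s" "s \<le> t" "t \<le> m" for s t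
  proof (rule slope_bound_join[of 0 b c ?f m, OF _ _ that])
    show "c * (t - s) \<le> ?f t - ?f s" if "0 \<le> s" "s \<le> t" "t \<le> b" for s t
      by (rule slope_bound_join[of 0 a c ?f b, OF _ _ that])
        (simp_all add: e1 e2 cC mult_right_mono)
    show "c * (t - s) \<le> ?f t - ?f s" if "b \<le> s" "s \<le> t" for s t
      using that by (simp add: e3 cC mult_right_mono)
  qed
  have up: "(- C) * (t - s) \<le> - ?f t - (- ?f s)" if "0 \<le> s" "s \<le> t" "t \<le> m" for s t
  proof (rule slope_bound_join[of 0 b "- C" "\<lambda>t. - ?f t" m, OF _ _ that])
    have n: "- ?f t - (- ?f s) = - (?f t - ?f s)" for s t by simp
    have mm: "(- C) * r \<le> - (k * r)" if "0 \<le> r" "k \<le> C" for r k :: real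
      using mult_right_mono[OF that(2,1)] by simp
    show "(- C) * (t - s) \<le> - ?f t - (- ?f s)" if "0 \<le> s" "s \<le> t" "t \<le> b" for s t
    proof (rule slope_bound_join[of 0 a "- C" "\<lambda>t. - ?f t" b, OF _ _ that])
      show "(- C) * (t - s) \<le> - ?f t - (- ?f s)" if "0 \<le> s" "s \<le> t" "t \<le> a" for s t
        unfolding n e1[OF that(2,3)] using that cC by (intro mm) auto
      show "(- C) * (t - s) \<le> - ?f t - (- ?f s)" if "a \<le> s" "s \<le> t" "t \<le> b" for s t
        unfolding n e2[OF that] using that cC by (intro mm) auto
    qed
    show "(- C) * (t - s) \<le> - ?f t - (- ?f s)" if "b \<le> s" "s \<le> t" for s t
      unfolding n e3[OF that] using that cC by (intro mm) auto
  qed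
  have "bilip c C ?f"
    unfolding bilip_def
  proof (intro conjI allI impI)
    show "0 < c" using ks by (simp add: c_def)
    show "?f 0 = 0" using ab by (simp add: stretch_def)
    show "?f m = m" using ab by (simp add: stretch_def)
    fix s t assume st: "0 \<le> s" "s \<le> t" "t \<le> m"
    show "c * (t - s) \<le> ?f t - ?f s" by (rule lo[OF st])
    show "?f t - ?f s \<le> C * (t - s)" using up[OF st] by simp
  qed
  then show ?thesis by blast
qed

text \<open>Where the stretching map \<open>g\<close> is affine, its derivative has the same constant value at \<open>x\<close> and at
  \<open>f x\<close>. By the chain rule, conjugation by \<open>g\<close> then does not change the derivative of \<open>f\<close>, and the
  affinity is only rescaled by the change of variables.\<close>

lemma hell_conj_stretch:
  assumes ab: "0 < a" "a < b" "b < m" and uv: "0 < u" "u < v" "v < m"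
    and f: "f \<in> G" and J: "a \<le> s" "s \<le> t" "t \<le> b"
    and fJ: "f ` p ` {s..t} \<subseteq> p ` {a..b}"
  defines "g \<equiv> lift (stretch a b u v)" and "\<phi> \<equiv> stretch a b u v"
  shows "(b - a) / (v - u) * hell (p ` {\<phi> s..\<phi> t}) (g \<odot> f \<odot> ginv g) = hell (p ` {s..t}) f"
proof -
  obtain c C where bi: "bilip c C \<phi>" using stretch_bilip[OF ab uv] unfolding \<phi>_def by blast
  have g: "g \<in> G" using lift_in_G[OF bi] by (simp add: g_def \<phi>_def)
  have gl: "g = lift \<phi>" by (simp add: g_def \<phi>_def)
  define k where "k = g \<odot> f \<odot> ginv g"
  have k: "k \<in> G" using f g by (simp add: k_def)
  define la where "la = (v - u) / (b - a)"
  have la: "0 < la" using ab uv by (simp add: la_def)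
  have aff: "\<phi> w = la * w + (u - la * a)" if "a \<le> w" "w \<le> b" for w
    using that ab by (cases "w = a") (auto simp: \<phi>_def stretch_def la_def[symmetric] right_diff_distrib)
  have Dg: "AE x in M. x \<in> p ` {a..b} \<longrightarrow> D g x = la"
  proof (rule D_eq_on[OF g])
    show "p ` {a..b} \<in> sets M" using ab by (intro p_image_Icc_sets) auto
    fix A assume "A \<in> sets M" "A \<subseteq> p ` {a..b}"
    then show "measure M (g ` A) = la * measure M A"
      unfolding gl using ab by (intro lift_measure_affine[OF bi _ _ _ _ aff la]) auto
  qed (use la in simp)
  have kg: "k \<odot> g = g \<odot> f"
    using f g by (intro G_eqI) (auto simp: k_def G_in)
  let ?J = "p ` {s..t}" and ?K = "p ` {\<phi> s..\<phi> t}"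
  have Js: "?J \<in> sets M" using ab J by (intro p_image_Icc_sets) auto
  have JX: "?J \<subseteq> X" using Js by (simp add: sets_M_iff)
  have st: "0 \<le> s" "t \<le> m" using ab J by auto
  have img: "\<phi> ` {s..t} = {\<phi> s..\<phi> t}"
  proof -
    have "\<phi> ` {s..t} = (\<lambda>w. la * w + (u - la * a)) ` {s..t}" using J by (intro image_cong) (auto simp: aff)
    also have "\<dots> = {la * s + (u - la * a)..la * t + (u - la * a)}"
      using la J by (subst image_affinity_atLeastAtMost) auto
    finally show ?thesis using J by (simp add: aff)
  qed
  have gJ: "g ` ?J = ?K"
  proof -
    have "g ` p ` {s..t} = p ` \<phi> ` {s..t}"
      unfolding image_image gl using lift_p[OF bi] st by (intro image_cong) auto
    then show ?thesis by (simp add: img)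
  qed
  have Ks: "?K \<in> sets M" using G_image_sets[OF g Js] gJ by simp
  have AE: "AE x in M. x \<in> ?J \<longrightarrow> D k (g x) = D f x \<and> D g x = la"
    using D_chain[OF k g] D_chain[OF g f] Dg AE_pullback[OF f Dg] 
  proof eventually_elim
    case (elim x)
    show ?case
    proof
      assume x: "x \<in> ?J"
      have "x \<in> p ` {a..b}" using x J by auto
      moreover have "f x \<in> p ` {a..b}" using x fJ by auto
      ultimately have "D g x = la" "D g (f x) = la" using elim by auto
      then show "D k (g x) = D f x \<and> D g x = la" using elim(1,2) kg la by simp
    qed
  qed
  have "hell ?K k = (\<integral>x. (indicator ?K x * sqrt (D k x)) \<partial>M)"
    by (simp add: hell_def set_lebesgue_integral_def)
  also have "\<dots> = (\<integral>x. (indicator ?K (g x) * sqrt (D k (g x))) * D g x \<partial>M)"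
    using Ks by (subst integral_change(1)[OF g, of "\<lambda>x. indicator ?K x * sqrt (D k x)"]) auto
  also have "\<dots> = (\<integral>x. la * (indicator ?J x * sqrt (D f x)) \<partial>M)"
  proof (rule integral_cong_AE)
    have [measurable]: "g \<in> measurable M M" by (rule G_measurable[OF g])
    show "(\<lambda>x. indicator ?K (g x) * sqrt (D k (g x)) * D g x) \<in> borel_measurable M"
      using Ks by measurable
    show "(\<lambda>x. la * (indicator ?J x * sqrt (D f x))) \<in> borel_measurable M" using Js by measurable
    show "AE x in M. indicator ?K (g x) * sqrt (D k (g x)) * D g x = la * (indicator ?J x * sqrt (D f x))"
      using AE AE_space
    proof eventually_elim
      case (elim x)
      have "g x \<in> ?K \<longleftrightarrow> x \<in> ?J"
        using inj_on_image_mem_iff[OF G_inj[OF g] _ JX] elim(2) gJ by (simp add: space_M)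
      then show ?case using elim(1) by (auto simp: indicator_def)
    qed
  qed
  also have "\<dots> = la * hell ?J f" by (simp add: hell_def set_lebesgue_integral_def)
  finally have "hell ?K k = la * hell ?J f" .
  then show ?thesis using la ab uv by (simp add: k_def la_def)
qed

text \<open>Stretch the arc over nearly all of \<open>X\<close>. The conjugate of \<open>f\<close> is again small in \<open>S\<close>, so its affinity
  is at least about \<open>c\<close>; by Cauchy--Schwarz the short pieces of \<open>X\<close> near the ends contribute little
  to it, and the rest is the affinity of \<open>f\<close> on the arc, scaled by \<open>m / (b - a)\<close>.\<close>

lemma hell_arc_lower:
  assumes S: "topological_group GG S" and co: "coarser_topology tco S"
    and c: "\<And>\<epsilon>. \<epsilon> > 0 \<Longrightarrow> \<exists>V. topological_group.nbhd GG S V \<and> (\<forall>f\<in>V. c - \<epsilon> < hell X f)"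
    and ab: "0 \<le> a" "a < b" "b \<le> m" and \<epsilon>: "\<epsilon> > 0"
  shows "\<exists>V. topological_group.nbhd GG S V \<and> (\<forall>f\<in>V. c * (b - a) / m - \<epsilon> < hell (p ` {a<..<b}) f)"
proof -
  interpret S: topological_group GG S by fact
  \<comment> \<open>The parameter \<theta> is the margin left at each end of the arc and of the whole segment; ?F \<theta> is
    the lower bound that this margin yields.\<close>
  let ?F = "\<lambda>\<theta>. (b - a - 2 * \<theta>) / (m - 2 * \<theta>) * (c - \<theta> - 2 * sqrt (\<theta> * m))"
  have "(?F \<longlongrightarrow> (b - a - 2 * 0) / (m - 2 * 0) * (c - 0 - 2 * sqrt (0 * m))) (at_right 0)"
    using m_pos by (intro tendsto_intros) auto
  then have "(?F \<longlongrightarrow> c * (b - a) / m) (at_right 0)" by (simp add: mult.commute)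
  then have "eventually (\<lambda>\<theta>. c * (b - a) / m - \<epsilon> < ?F \<theta>) (at_right 0)"
    using \<epsilon> by (intro order_tendstoD(1)) auto
  moreover have "eventually (\<lambda>\<theta>. 0 < \<theta> \<and> \<theta> < (b - a) / 8) (at_right 0)"
    using ab by (intro eventually_at_right_real[of 0 "(b - a) / 8", unfolded greaterThanLessThan_iff]) auto
  ultimately have "eventually (\<lambda>\<theta>. c * (b - a) / m - \<epsilon> < ?F \<theta> \<and> 0 < \<theta> \<and> \<theta> < (b - a) / 8) (at_right 0)"
    by eventually_elim simp
  then obtain \<theta> where \<theta>: "c * (b - a) / m - \<epsilon> < ?F \<theta>" "0 < \<theta>" "\<theta> < (b - a) / 8"
    using eventually_happens'[OF trivial_limit_at_right_real] by blast
  define a1 b1 where "a1 = a + \<theta>" and "b1 = b - \<theta>"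
  have a1: "0 < a1" "a1 < b1" "b1 < m" using ab \<theta> by (auto simp: a1_def b1_def)
  have uv: "0 < \<theta>" "\<theta> < m - \<theta>" "m - \<theta> < m" using ab \<theta> by auto
  define r where "r = (b1 - a1) / (m - \<theta> - \<theta>)"
  have r: "0 < r" "r * (m - \<theta> - \<theta>) = b1 - a1" using a1 uv by (auto simp: r_def)
  have r1: "r \<le> 1"
    using uv ab by (auto simp: r_def a1_def b1_def divide_le_eq)
  define a2 b2 where "a2 = a1 + r * \<theta>" and "b2 = b1 - r * \<theta>"
  have rt: "0 < r * \<theta>" "r * \<theta> \<le> \<theta>" using r r1 \<theta> by (auto simp: mult_le_cancel_right1 mult_left_le_one_le)
  have a2: "a1 < a2" "a2 < b2" "b2 < b1" 
  proof -
    have "8 * \<theta> < b - a" "0 < \<theta>" using \<theta>(2,3) by auto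
    then show "a1 < a2" "a2 < b2" "b2 < b1"
      using rt unfolding a2_def b2_def a1_def b1_def by linarith+
  qed
  let ?\<phi> = "stretch a1 b1 \<theta> (m - \<theta>)"
  define g where "g = lift ?\<phi>"
  have g: "g \<in> G" unfolding g_def using lift_in_G stretch_bilip[OF a1 uv] by blast
  have inv: "(m - \<theta> - \<theta>) / (b1 - a1) * (r * \<theta>) = \<theta>" using r a1 uv by (simp add: r_def)
  have v2: "?\<phi> a2 = 2 * \<theta>" "?\<phi> b2 = m - 2 * \<theta>"
  proof -
    show "?\<phi> a2 = 2 * \<theta>" using a2 inv by (simp add: stretch_def a2_def)
    have "b2 - a1 = (b1 - a1) - r * \<theta>" by (simp add: b2_def)
    moreover define la where "la = (m - \<theta> - \<theta>) / (b1 - a1)"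
    moreover have "la * (b1 - a1) = m - \<theta> - \<theta>" "la * (r * \<theta>) = \<theta>"
      using a1 inv by (auto simp: la_def)
    ultimately have "(m - \<theta> - \<theta>) / (b1 - a1) * (b2 - a1) = (m - \<theta> - \<theta>) - \<theta>"
      by (simp only: right_diff_distrib)
    then show "?\<phi> b2 = m - 2 * \<theta>" using a2 by (simp add: stretch_def)
  qed
  \<comment> \<open>Uniformly small f keep the slightly shorter arc from a2 to b2 inside the arc from a1 to b1 on
    which the stretching is affine.\<close>
  obtain e where e: "e > 0" "\<forall>x\<in>p ` {a2..b2}. \<forall>y\<in>X. dist x y < e \<longrightarrow> y \<in> p ` {a1<..<b1}"
    using arc_neighbourhood[of a1 a2 b2 b1] a1 a2 by auto
  obtain V0 where V0: "S.nbhd V0" "\<forall>f\<in>V0. c - \<theta> < hell X f" using c[OF \<theta>(2)] by blast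
  obtain V1 where V1: "S.nbhd V1" "\<forall>f\<in>V1. g \<odot> f \<odot> ginv g \<in> V0" using S.nbhd_conj[OF V0(1)] g by auto
  have B: "S.nbhd {f \<in> G. sup_dist f one < e}"
    using co_nbhd_ball[OF e(1)] co by (auto simp: S.nbhd_def co.nbhd_def coarser_topology_def)
  have "c * (b - a) / m - \<epsilon> < hell (p ` {a<..<b}) f" if fV: "f \<in> V1 \<inter> {f \<in> G. sup_dist f one < e}" for f
  proof -
    have f: "f \<in> G" "sup_dist f one < e" using fV by auto
    define k where "k = g \<odot> f \<odot> ginv g"
    have k: "k \<in> G" using f g by (simp add: k_def)
    have hk: "c - \<theta> < hell X k" using V0 V1 fV by (auto simp: k_def)
    have "f ` p ` {a2..b2} \<subseteq> p ` {a1..b1}"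
    proof
      fix y assume "y \<in> f ` p ` {a2..b2}"
      then obtain x where x: "x \<in> p ` {a2..b2}" "y = f x" by blast
      have "x \<in> X" using x(1) a1 a2 by (auto intro!: p_in)
      then have "dist x y < e" "y \<in> X"
        using dist_le_sup_dist[OF f(1), of one x] f(2) x(2) G_in[OF f(1)] by (auto simp: dist_commute)
      then have "y \<in> p ` {a1<..<b1}" using e(2) x(1) by blast
      then show "y \<in> p ` {a1..b1}" by auto
    qed
    then have eq: "r * hell (p ` {2 * \<theta>..m - 2 * \<theta>}) k = hell (p ` {a2..b2}) f"
      using hell_conj_stretch[OF a1 uv f(1), of a2 b2] a2 v2 by (simp add: g_def k_def r_def)
    let ?K = "p ` {2 * \<theta>..m - 2 * \<theta>}" and ?K1 = "p ` {0..2 * \<theta>}" and ?K2 = "p ` {m - 2 * \<theta>..m}"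
    have t4: "4 * \<theta> < m" "0 < \<theta>" using \<theta> ab by auto
    have Ks: "?K \<in> sets M" "?K1 \<in> sets M" "?K2 \<in> sets M"
      using t4 by (auto intro!: p_image_Icc_sets)
    have "{0..m} = {2 * \<theta>..m - 2 * \<theta>} \<union> ({0..2 * \<theta>} \<union> {m - 2 * \<theta>..m})" using t4 by auto
    then have X: "X = ?K \<union> (?K1 \<union> ?K2)" using p_surj by (metis image_Un)
    have "hell X k \<le> hell ?K k + hell (?K1 \<union> ?K2) k"
      using hell_Un_le[OF k Ks(1) sets.Un[OF Ks(2,3)]] X by simp
    also have "hell (?K1 \<union> ?K2) k \<le> sqrt (measure M (?K1 \<union> ?K2) * measure M X)"
      using Ks by (intro hell_le[OF k]) auto
    also have "\<dots> \<le> sqrt (4 * \<theta> * m)"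
    proof -
      have "measure M (?K1 \<union> ?K2) \<le> measure M ?K1 + measure M ?K2" using Ks by (intro measure_Un_le)
      also have "\<dots> = 4 * \<theta>" using t4 by (simp add: measure_p_Icc)
      finally show ?thesis using m_pos by (simp add: measure_X)
    qed
    also have "sqrt (4 * \<theta> * m) = 2 * sqrt (\<theta> * m)" by (simp add: real_sqrt_mult)
    finally have "c - \<theta> - 2 * sqrt (\<theta> * m) < hell ?K k" using hk by linarith
    then have "r * (c - \<theta> - 2 * sqrt (\<theta> * m)) < hell (p ` {a2..b2}) f"
      unfolding eq[symmetric] using r(1) by simp
    also have "\<dots> \<le> hell (p ` {a<..<b}) f"
    proof (rule hell_mono[OF f(1)])
      show "p ` {a2..b2} \<in> sets M" using a1 a2 by (intro p_image_Icc_sets) auto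
      show "p ` {a<..<b} \<in> sets M" using ab by (intro p_image_measure) auto
      show "p ` {a2..b2} \<subseteq> p ` {a<..<b}" using a2 \<theta> by (intro image_mono) (auto simp: a1_def b1_def)
    qed
    also have "r * (c - \<theta> - 2 * sqrt (\<theta> * m)) = ?F \<theta>" by (simp add: r_def a1_def b1_def)
    finally show ?thesis using \<theta>(1) by simp
  qed
  then show ?thesis using S.nbhd_Int[OF V1(1) B] by blast
qed

definition mesh :: "nat \<Rightarrow> real" where "mesh n = m / n"

lemma mesh: "0 < n \<Longrightarrow> 0 < mesh n" "0 < n \<Longrightarrow> real n * mesh n = m"
  using m_pos by (auto simp: mesh_def)

abbreviation cell :: "nat \<Rightarrow> nat \<Rightarrow> 'a set" where
  "cell n i \<equiv> p ` {real i * mesh n<..<(real i + 1) * mesh n}"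

lemma cell_bounds:
  assumes "i < n"
  shows "0 \<le> real i * mesh n" "real i * mesh n < (real i + 1) * mesh n" "(real i + 1) * mesh n \<le> m"
proof -
  have h: "0 < mesh n" "real n * mesh n = m" using mesh[of n] assms by auto
  show "0 \<le> real i * mesh n" using h by simp
  show "real i * mesh n < (real i + 1) * mesh n" using h(1) by (simp add: distrib_right)
  have "(real i + 1) * mesh n \<le> real n * mesh n" using assms h by (intro mult_right_mono) auto
  then show "(real i + 1) * mesh n \<le> m" using h by simp
qed

lemma cell_sets: "i < n \<Longrightarrow> cell n i \<in> sets M"
  using cell_bounds[of i n] by (intro p_image_measure) auto

lemma cell_measure:
  assumes "i < n"
  shows "measure M (cell n i) = mesh n"
proof -
  have "{real i * mesh n<..<(real i + 1) * mesh n} \<subseteq> {0..m}"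
    using cell_bounds[OF assms] by (intro subsetI, unfold greaterThanLessThan_iff atLeastAtMost_iff) linarith
  then show ?thesis
    using cell_bounds(2)[OF assms] by (subst measure_p_image) (auto simp: distrib_right)
qed

lemma cell_disjoint: "disjoint_family_on (cell n) {..<n}"
  unfolding disjoint_family_on_def
proof (intro ballI impI)
  have *: "cell n i \<inter> cell n j = {}" if "i < j" "i < n" "j < n" for i j
  proof (rule ccontr)
    assume "cell n i \<inter> cell n j \<noteq> {}"
    then obtain x where "x \<in> cell n i" "x \<in> cell n j" by auto
    then obtain s t where st: "s \<in> {real i * mesh n<..<(real i + 1) * mesh n}"
      "t \<in> {real j * mesh n<..<(real j + 1) * mesh n}" "p s = p t" by (elim imageE) simp
    have "(real i + 1) * mesh n \<le> real j * mesh n"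
      using that mesh(1)[of n] by (intro mult_right_mono) auto
    then have "s < t" using st by auto
    then show False
      using p_eqD[OF st(3)] st cell_bounds[OF that(2)] cell_bounds[OF that(3)] by auto
  qed
  fix i j assume "i \<in> {..<n}" "j \<in> {..<n}" "i \<noteq> j"
  then show "cell n i \<inter> cell n j = {}" using *[of i j] *[of j i] by (cases "i < j") auto
qed

lemma AE_cell:
  assumes "0 < n"
  shows "AE x in M. \<exists>i<n. x \<in> cell n i"
proof -
  let ?B = "{0..m} - (\<Union>i<n. {real i * mesh n<..<(real i + 1) * mesh n})"
  let ?g = "\<lambda>i. real i * mesh n"
  have h: "0 < mesh n" "real n * mesh n = m" using mesh[of n] assms by auto
  have sub: "?B \<subseteq> ?g ` {..n}"
  proof
    fix v assume v: "v \<in> ?B"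
    then obtain i where i: "i < n" "?g i \<le> v" "v \<le> ?g (Suc i)"
      using chain_cover[of ?g v n] h assms by auto
    have e: "?g (Suc i) = (real i + 1) * mesh n" by (simp add: add.commute[of 1])
    have "i \<in> {..n}" "Suc i \<in> {..n}" using i(1) by auto
    have "v \<notin> {?g i<..<(real i + 1) * mesh n}" using v i(1) by blast
    then have "v = ?g i \<or> v = ?g (Suc i)" using i(2,3) unfolding e by auto
    then show "v \<in> ?g ` {..n}" using \<open>i \<in> {..n}\<close> \<open>Suc i \<in> {..n}\<close> by (metis image_eqI)
  qed
  then have fin: "finite ?B" by (rule finite_subset) simp
  have B: "p ` ?B \<in> sets M" "emeasure M (p ` ?B) = 0"
  proof -
    have bb: "?B \<in> sets borel" by measurable
    show "p ` ?B \<in> sets M" by (rule p_image_measure(1)[OF bb]) auto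
    have "emeasure M (p ` ?B) = emeasure lborel ?B" by (rule p_image_measure(2)[OF bb]) auto
    also have "\<dots> = 0" using fin by (intro emeasure_lborel_countable countable_finite)
    finally show "emeasure M (p ` ?B) = 0" .
  qed
  show ?thesis
  proof (rule AE_I[OF _ B(2,1)])
    show "{x \<in> space M. \<not> (\<exists>i<n. x \<in> cell n i)} \<subseteq> p ` ?B"
    proof
      fix x assume x: "x \<in> {x \<in> space M. \<not> (\<exists>i<n. x \<in> cell n i)}"
      then have "x \<in> p ` {0..m}" using p_surj by (simp add: space_M)
      then obtain t where t: "t \<in> {0..m}" "x = p t" by (elim imageE)
      have "t \<notin> {real i * mesh n<..<(real i + 1) * mesh n}" if "i < n" for i
        using x t(2) that by auto
      then have "t \<in> ?B" using t(1) by blast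
      then show "x \<in> p ` ?B" using t(2) by (rule rev_image_eqI)
    qed
  qed
qed

text \<open>A map that nearly minimises the total affinity cannot exceed the average on one cell, because it
  cannot fall noticeably below the average on any other cell.\<close>

lemma near_optimal_uniform:
  assumes S: "topological_group GG S" and co: "coarser_topology tco S"
    and c1: "\<And>\<epsilon>. \<epsilon> > 0 \<Longrightarrow> \<exists>V. topological_group.nbhd GG S V \<and> (\<forall>f\<in>V. c - \<epsilon> < hell X f)"
    and c2: "\<And>V \<epsilon>. topological_group.nbhd GG S V \<Longrightarrow> \<epsilon> > 0 \<Longrightarrow> \<exists>f\<in>V. hell X f < c + \<epsilon>"
    and V: "topological_group.nbhd GG S V" and n: "0 < n" and \<epsilon>: "\<epsilon> > 0"
  shows "\<exists>f\<in>V. \<forall>i<n. hell (cell n i) f \<le> c / n + \<epsilon>"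
proof -
  interpret S: topological_group GG S by fact
  define \<epsilon>1 where "\<epsilon>1 = \<epsilon> / n"
  have \<epsilon>1: "0 < \<epsilon>1" "real n * \<epsilon>1 = \<epsilon>" using \<epsilon> n by (auto simp: \<epsilon>1_def)
  have "\<exists>W. S.nbhd W \<and> (\<forall>f\<in>W. c / n - \<epsilon>1 < hell (cell n i) f)" if "i < n" for i
  proof -
    have "c * ((real i + 1) * mesh n - real i * mesh n) / m = c / n"
    proof -
      have "(real i + 1) * mesh n - real i * mesh n = mesh n" by (simp add: distrib_right)
      then show ?thesis using m_pos by (simp add: mesh_def)
    qed
    then show ?thesis
      using hell_arc_lower[OF S co c1 cell_bounds[OF that] \<epsilon>1(1)] by simp
  qed
  then obtain W where W: "\<And>i. i < n \<Longrightarrow> S.nbhd (W i)"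
    "\<And>i f. i < n \<Longrightarrow> f \<in> W i \<Longrightarrow> c / n - \<epsilon>1 < hell (cell n i) f" by metis
  obtain N where N: "S.nbhd N" "\<forall>i\<in>{..<n}. N \<subseteq> W i"
    using S.nbhd_INT[of "{..<n}" W] W(1) by auto
  obtain f where f: "f \<in> V \<inter> N" "hell X f < c + \<epsilon>1" using c2[OF S.nbhd_Int[OF V N(1)] \<epsilon>1(1)] by blast
  have fG: "f \<in> G" using S.nbhd_subset[OF V] f by auto
  have "hell (cell n i) f \<le> c / n + \<epsilon>" if i: "i < n" for i
  proof -
    have "(\<Sum>j<n. hell (cell n j) f) = hell (\<Union>j<n. cell n j) f"
      using hell_Union_disjoint[OF fG _ _ cell_disjoint, of n] cell_sets by simp
    also have "\<dots> \<le> hell X f"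
    proof (rule hell_mono[OF fG])
      show "(\<Union>j<n. cell n j) \<in> sets M" using cell_sets by (intro sets.finite_UN) auto
      then show "(\<Union>j<n. cell n j) \<subseteq> X" by (simp add: sets_M_iff)
    qed simp
    finally have "(\<Sum>j<n. hell (cell n j) f) < c + \<epsilon>1" using f(2) by simp
    moreover have "(\<Sum>j<n. hell (cell n j) f) = hell (cell n i) f + (\<Sum>j\<in>{..<n} - {i}. hell (cell n j) f)"
      using i by (intro sum.remove) auto
    moreover have "(\<Sum>j\<in>{..<n} - {i}. c / n - \<epsilon>1) \<le> (\<Sum>j\<in>{..<n} - {i}. hell (cell n j) f)"
      using W(2) N(2) f(1) by (intro sum_mono less_imp_le) auto
    moreover have "(\<Sum>j\<in>{..<n} - {i}. c / n - \<epsilon>1) = (real n - 1) * (c / n - \<epsilon>1)"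
      using i by (simp add: of_nat_diff)
    moreover have "(real n - 1) * (c / n - \<epsilon>1) = c - c / n - real n * \<epsilon>1 + \<epsilon>1"
    proof -
      have "real n * (c / n) = c" using n by simp
      moreover have "(N - 1) * (q - e) = N * q - q - N * e + e" for N q e :: real
        by (simp add: algebra_simps)
      ultimately show ?thesis by metis
    qed
    ultimately show ?thesis using \<epsilon>1 by linarith
  qed
  then show ?thesis using f(1) by blast
qed

lemma step_integral_le:
  assumes f: "f \<in> G" and n: "0 < n" and w: "continuous_on X w"
    and near: "\<And>i x. i < n \<Longrightarrow> x \<in> cell n i \<Longrightarrow> w (f x) \<le> a i" and a: "\<And>i. i < n \<Longrightarrow> 0 \<le> a i"
    and w0: "\<And>x. x \<in> X \<Longrightarrow> 0 \<le> w x"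
  shows "(\<integral>x. w (f x) * sqrt (D f x) \<partial>M) \<le> (\<Sum>i<n. a i * hell (cell n i) f)"
proof -
  let ?r = "\<lambda>x. \<Sum>i<n. a i * (indicator (cell n i) x * sqrt (D f x))"
  have i: "integrable M (\<lambda>x. indicator (cell n i) x * sqrt (D f x))" if "i < n" for i
    using hell_set_integrable[OF f cell_sets[OF that]] by (simp add: set_integrable_def)
  have ri: "integrable M ?r" using i by (intro Bochner_Integration.integrable_sum integrable_mult_right) auto
  have r0: "0 \<le> ?r x" for x using a by (intro sum_nonneg mult_nonneg_nonneg) auto
  have [measurable]: "f \<in> measurable M M" by (rule G_measurable[OF f])
  have [measurable]: "w \<in> borel_measurable M" by (rule continuous_measurable[OF w])
  have le: "AE x in M. w (f x) * sqrt (D f x) \<le> ?r x"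
    using AE_cell[OF n] AE_space
  proof eventually_elim
    case (elim x)
    then obtain j where j: "j < n" "x \<in> cell n j" by blast
    have "w (f x) * sqrt (D f x) \<le> a j * (indicator (cell n j) x * sqrt (D f x))"
      using near[OF j] j by (auto intro!: mult_right_mono)
    also have "\<dots> \<le> ?r x"
      using j a by (intro member_le_sum[of j "{..<n}" "\<lambda>i. a i * (indicator (cell n i) x * sqrt (D f x))"]) auto
    finally show ?case .
  qed
  have "(\<integral>x. w (f x) * sqrt (D f x) \<partial>M) \<le> (\<integral>x. ?r x \<partial>M)"
  proof (rule integral_mono_AE[OF _ ri le])
    show "integrable M (\<lambda>x. w (f x) * sqrt (D f x))"
    proof (rule Bochner_Integration.integrable_bound[OF ri])
      show "AE x in M. norm (w (f x) * sqrt (D f x)) \<le> norm (?r x)"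
        using le AE_space
      proof eventually_elim
        case (elim x)
        then have "0 \<le> w (f x) * sqrt (D f x)" using w0 G_in[OF f] by (simp add: space_M)
        then show ?case using elim(1) r0[of x] by simp
      qed
    qed measurable
  qed
  also have "\<dots> = (\<Sum>i<n. a i * hell (cell n i) f)"
    using i by (simp add: hell_def set_lebesgue_integral_def)
  finally show ?thesis .
qed

lemma step_sum_le:
  assumes n: "0 < n" and w: "continuous_on X w"
    and near: "\<And>i x. i < n \<Longrightarrow> x \<in> cell n i \<Longrightarrow> a i \<le> w x"
  shows "(\<Sum>i<n. a i) * mesh n \<le> (\<integral>x. w x \<partial>M)"
proof -
  let ?r = "\<lambda>x. \<Sum>i<n. a i * indicator (cell n i) x"
  have i: "integrable M (indicator (cell n i) :: 'a \<Rightarrow> real)" if "i < n" for i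
    using cell_sets[OF that] by (simp add: emeasure_eq_measure)
  have "(\<Sum>i<n. a i) * mesh n = (\<integral>x. ?r x \<partial>M)"
  proof -
    have "(\<integral>x. ?r x \<partial>M) = (\<Sum>i<n. \<integral>x. a i * indicator (cell n i) x \<partial>M)"
      using i by (intro Bochner_Integration.integral_sum integrable_mult_right) auto
    also have "\<dots> = (\<Sum>i<n. a i * mesh n)"
    proof (intro sum.cong refl)
      fix j assume "j \<in> {..<n}"
      then have "j < n" by simp
      then show "(\<integral>x. a j * indicator (cell n j) x \<partial>M) = a j * mesh n"
        using cell_measure[of j n] cell_sets[of j n] by simp
    qed
    finally show ?thesis by (simp add: sum_distrib_right)
  qed
  also have "\<dots> \<le> (\<integral>x. w x \<partial>M)"
  proof (rule integral_mono_AE)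
    show "integrable M ?r" using i by (intro Bochner_Integration.integrable_sum integrable_mult_right) auto
    show "integrable M w" by (rule continuous_integrable[OF w])
    show "AE x in M. ?r x \<le> w x"
      using AE_cell[OF n]
    proof eventually_elim
      case (elim x)
      then obtain j where j: "j < n" "x \<in> cell n j" by blast
      have "x \<notin> cell n i" if "i < n" "i \<noteq> j" for i
        using cell_disjoint[of n] j that unfolding disjoint_family_on_def by (metis disjoint_iff lessThan_iff)
      then have "?r x = (\<Sum>i<n. if i = j then a j else 0)"
        using j by (intro sum.cong) (auto simp: indicator_def)
      then show ?case using near[OF j] j by simp
    qed
  qed
  finally show ?thesis .
qed

text \<open>Let \<open>f1\<close> be nearly optimal, \<open>w\<close> a continuous approximation of \<open>sqrt (D f1)\<close>, and \<open>f2\<close> nearly optimal,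
  uniformly close to the identity and evenly spread on a grid adapted to \<open>w\<close>. Then the affinity of
  \<open>f1 \<odot> f2\<close> is about the sum of \<open>w\<close> over the grid times \<open>c / n\<close>, that is \<open>c / m\<close> times the integral of
  \<open>w\<close>, that is \<open>c\<^sup>2 / m\<close>. On the other hand the product is small in \<open>S\<close>, so its affinity is at least
  about \<open>c\<close>. Only the error terms, which vanish with \<open>\<epsilon>\<close>, make the stated inequality longer.\<close>

lemma hell_product_near:
  assumes S: "topological_group GG S" and co: "coarser_topology tco S"
    and c0: "0 \<le> c"
    and c1: "\<And>\<epsilon>. \<epsilon> > 0 \<Longrightarrow> \<exists>V. topological_group.nbhd GG S V \<and> (\<forall>f\<in>V. c - \<epsilon> < hell X f)"
    and c2: "\<And>V \<epsilon>. topological_group.nbhd GG S V \<Longrightarrow> \<epsilon> > 0 \<Longrightarrow> \<exists>f\<in>V. hell X f < c + \<epsilon>"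
    and \<epsilon>: "\<epsilon> > 0"
  shows "c - \<epsilon> \<le> (c / m) * (c + \<epsilon> + \<epsilon> * sqrt m + 3 * \<epsilon> * m) + \<epsilon> + \<epsilon> * sqrt m"
proof -
  interpret S: topological_group GG S by fact
  obtain V where V: "S.nbhd V" "\<forall>f\<in>V. c - \<epsilon> < hell X f" using c1[OF \<epsilon>] by blast
  obtain V' where V': "S.nbhd V'" "\<forall>x\<in>V'. \<forall>y\<in>V'. x \<odot> y \<in> V" using S.nbhd_mult[OF V(1)] by blast
  obtain f1 where f1: "f1 \<in> V'" "hell X f1 < c + \<epsilon>" using c2[OF V'(1) \<epsilon>] by blast
  have f1G: "f1 \<in> G" using S.nbhd_subset[OF V'(1)] f1 by auto
  obtain w where w: "continuous_on UNIV w" "\<And>x. 0 \<le> w x" "(\<integral>x. \<bar>D f1 x - (w x)\<^sup>2\<bar> \<partial>M) < \<epsilon>\<^sup>2"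
    using D_approx_square[OF f1G, of "\<epsilon>\<^sup>2"] \<epsilon> by auto
  have wX: "continuous_on X w" using w(1) by (rule continuous_on_subset) simp
  have err: "sqrt (measure M X * (\<integral>x. \<bar>D f1 x - (w x)\<^sup>2\<bar> \<partial>M)) \<le> \<epsilon> * sqrt m"
  proof -
    have "sqrt (measure M X * (\<integral>x. \<bar>D f1 x - (w x)\<^sup>2\<bar> \<partial>M)) \<le> sqrt (m * \<epsilon>\<^sup>2)"
      using w(3) m_pos by (simp add: measure_X)
    also have "\<dots> = \<epsilon> * sqrt m" using \<epsilon> by (simp add: real_sqrt_mult mult.commute)
    finally show ?thesis .
  qed
  obtain B where B: "B > 0" "\<forall>x\<in>X. \<bar>w x\<bar> \<le> B" using compact_bound_real[OF w(1)] by blast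
  obtain d where d: "d > 0" "\<forall>x\<in>X. \<forall>y\<in>X. dist x y < d \<longrightarrow> \<bar>w x - w y\<bar> < \<epsilon>"
    using compact_uniform_real[OF w(1) \<epsilon>] by blast
  obtain d' where d': "d' > 0" "\<forall>s\<in>{0..m}. \<forall>t\<in>{0..m}. \<bar>s - t\<bar> < d' \<longrightarrow> dist (p s) (p t) < d"
    using p_uniformly_continuous[OF d(1)] by blast
  obtain n where n0: "m / d' < real n" using reals_Archimedean2 by blast
  have "0 < m / d'" using m_pos d'(1) by simp
  then have n: "0 < n" using n0 by (cases n) auto
  have h: "mesh n < d'" using n0 n d'(1) by (simp add: mesh_def field_simps)
  \<comment> \<open>Small enough that the errors of all n cells, each weighted by at most B + 2\<epsilon>, add up to \<epsilon>.\<close>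
  define \<epsilon>2 where "\<epsilon>2 = \<epsilon> / (n * (B + 2 * \<epsilon>))"
  have \<epsilon>2: "\<epsilon>2 > 0" "\<epsilon>2 * (n * (B + 2 * \<epsilon>)) = \<epsilon>"
    using \<epsilon> n B by (auto simp: \<epsilon>2_def zero_less_divide_iff)
  have Bd: "S.nbhd {f \<in> G. sup_dist f one < d}"
    using co_nbhd_ball[OF d(1)] co by (auto simp: S.nbhd_def co.nbhd_def coarser_topology_def)
  obtain f2 where f2: "f2 \<in> V' \<inter> {f \<in> G. sup_dist f one < d}" "\<forall>i<n. hell (cell n i) f2 \<le> c / n + \<epsilon>2"
    using near_optimal_uniform[OF S co c1 c2 S.nbhd_Int[OF V'(1) Bd] n \<epsilon>2(1)] by blast
  have f2G: "f2 \<in> G" using f2 by auto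
  define wi where "wi i = w (p (real i * mesh n))" for i :: nat
  have wi: "\<bar>w x - wi i\<bar> < \<epsilon>" if ix: "i < n" "x \<in> cell n i" for i x
  proof -
    obtain t where t: "t \<in> {real i * mesh n<..<(real i + 1) * mesh n}" "x = p t" using ix(2) by (elim imageE)
    note b = cell_bounds[OF ix(1)]
    have "\<bar>t - real i * mesh n\<bar> < d'" using t(1) h by (auto simp: abs_less_iff distrib_right)
    then have "dist (p t) (p (real i * mesh n)) < d"
      using d'(2)[rule_format, of t "real i * mesh n"] t(1) b by auto
    then show ?thesis
      using d(2)[rule_format, of "p t" "p (real i * mesh n)"] p_in[of t] p_in[of "real i * mesh n"] t b
      by (simp add: wi_def)
  qed
  have wB: "0 \<le> wi i" "wi i \<le> B" if "i < n" for i
  proof -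
    have "p (real i * mesh n) \<in> X" using cell_bounds[OF that] by (intro p_in) auto
    then show "0 \<le> wi i" "wi i \<le> B" using B(2) w(2) by (auto simp: wi_def abs_le_iff)
  qed
  have near: "w (f2 x) \<le> wi i + 2 * \<epsilon>" if ix: "i < n" "x \<in> cell n i" for i x
  proof -
    have x: "x \<in> X" using ix(2) cell_sets[OF ix(1)] by (auto simp: sets_M_iff)
    have "dist (f2 x) x < d" using dist_le_sup_dist[OF f2G, of one x] f2(1) x by auto
    then have "\<bar>w (f2 x) - w x\<bar> < \<epsilon>" using d(2) x G_in[OF f2G x] by blast
    then show ?thesis using wi[OF ix] by linarith
  qed
  have sum1: "(\<Sum>i<n. wi i - \<epsilon>) * mesh n \<le> (\<integral>x. w x \<partial>M)"
  proof (rule step_sum_le[OF n wX])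
    show "wi i - \<epsilon> \<le> w x" if "i < n" "x \<in> cell n i" for i x using wi[OF that] by linarith
  qed
  have wint: "(\<integral>x. w x \<partial>M) \<le> c + \<epsilon> + \<epsilon> * sqrt m"
    using hell_product_le(2)[OF f1G f2G wX] w(2) err f1(2) by force
  have sumw: "(\<Sum>i<n. wi i + 2 * \<epsilon>) * mesh n \<le> c + \<epsilon> + \<epsilon> * sqrt m + 3 * \<epsilon> * m"
  proof -
    have "(\<Sum>i<n. wi i + 2 * \<epsilon>) * mesh n = (\<Sum>i<n. wi i - \<epsilon>) * mesh n + 3 * \<epsilon> * m"
    proof -
      have "(\<Sum>i<n. wi i + 2 * \<epsilon>) = (\<Sum>i<n. wi i - \<epsilon>) + real n * (3 * \<epsilon>)"
        by (simp add: sum.distrib sum_subtractf algebra_simps)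
      then have "(\<Sum>i<n. wi i + 2 * \<epsilon>) * mesh n = (\<Sum>i<n. wi i - \<epsilon>) * mesh n + 3 * \<epsilon> * (real n * mesh n)"
        by (simp only: distrib_right) simp
      then show ?thesis using mesh(2)[OF n] by simp
    qed
    then show ?thesis using sum1 wint by linarith
  qed
  have "(\<integral>x. w (f2 x) * sqrt (D f2 x) \<partial>M) \<le> (\<Sum>i<n. (wi i + 2 * \<epsilon>) * hell (cell n i) f2)"
    using wB \<epsilon> w(2) near by (intro step_integral_le[OF f2G n wX]) (auto intro: add_nonneg_nonneg)
  also have "\<dots> \<le> (\<Sum>i<n. (wi i + 2 * \<epsilon>) * (c / n + \<epsilon>2))"
    using f2(2) wB \<epsilon> by (intro sum_mono mult_left_mono) auto
  also have "\<dots> = (\<Sum>i<n. wi i + 2 * \<epsilon>) * (c / n) + (\<Sum>i<n. wi i + 2 * \<epsilon>) * \<epsilon>2"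
    by (simp only: sum_distrib_right[symmetric] distrib_left sum.distrib)
  also have "(\<Sum>i<n. wi i + 2 * \<epsilon>) * \<epsilon>2 \<le> (n * (B + 2 * \<epsilon>)) * \<epsilon>2"
  proof (rule mult_right_mono)
    have "(\<Sum>i<n. wi i + 2 * \<epsilon>) \<le> (\<Sum>i<n. B + 2 * \<epsilon>)" using wB by (intro sum_mono) auto
    then show "(\<Sum>i<n. wi i + 2 * \<epsilon>) \<le> n * (B + 2 * \<epsilon>)" by simp
  qed (use \<epsilon>2 in simp)
  also have "(n * (B + 2 * \<epsilon>)) * \<epsilon>2 = \<epsilon>" using \<epsilon>2(2) by (simp add: mult.commute)
  also have "(\<Sum>i<n. wi i + 2 * \<epsilon>) * (c / n) = (c / m) * ((\<Sum>i<n. wi i + 2 * \<epsilon>) * mesh n)"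
    using m_pos by (simp add: mesh_def)
  also have "\<dots> \<le> (c / m) * (c + \<epsilon> + \<epsilon> * sqrt m + 3 * \<epsilon> * m)"
    using sumw c0 m_pos by (intro mult_left_mono) auto
  finally have "(\<integral>x. w (f2 x) * sqrt (D f2 x) \<partial>M) \<le> (c / m) * (c + \<epsilon> + \<epsilon> * sqrt m + 3 * \<epsilon> * m) + \<epsilon>"
    by simp
  moreover have "f1 \<odot> f2 \<in> V" using V' f1 f2 by auto
  then have "c - \<epsilon> < hell X (f1 \<odot> f2)" using V(2) by blast
  moreover have "hell X (f1 \<odot> f2) \<le> (\<integral>x. w (f2 x) * sqrt (D f2 x) \<partial>M) + \<epsilon> * sqrt m"
    using hell_product_le(1)[OF f1G f2G wX] w(2) err by force
  ultimately show ?thesis by linarith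
qed

text \<open>The number \<open>c\<close> is the limit inferior of \<open>hell X f\<close> as \<open>f\<close> tends to the identity in \<open>S\<close>. It is less
  than \<open>m\<close> because of the maps that stay away from the identity for \<open>rho\<close>, and letting \<open>\<epsilon>\<close> tend to 0
  in the product estimate gives \<open>c * m \<le> c * c\<close>.\<close>

lemma hell_arbitrarily_small:
  assumes S: "topological_group GG S" and co: "coarser_topology tco S"
    and e0: "e0 > 0" "\<And>V. topological_group.nbhd GG S V \<Longrightarrow> \<exists>f\<in>V. e0 \<le> rho f one"
    and V: "topological_group.nbhd GG S V" and \<eta>: "\<eta> > 0"
  shows "\<exists>f\<in>V. hell X f < \<eta>"
proof -
  interpret S: topological_group GG S by fact
  define I where "I V = (INF f\<in>V. hell X f)" for V
  define c where "c = (SUP V\<in>{V. S.nbhd V}. I V)"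
  have bb: "bdd_below (hell X ` V)" for V by (intro bdd_belowI2[of _ 0]) simp
  have ne: "V \<noteq> {}" if "S.nbhd V" for V using S.nbhd_one[OF that] by auto
  have I_le: "I V \<le> hell X f" if "f \<in> V" for V f unfolding I_def using bb that by (rule cINF_lower)
  have I0: "0 \<le> I V" if "S.nbhd V" for V unfolding I_def using ne[OF that] by (intro cINF_greatest) auto
  have m0: "m \<noteq> 0" using m_pos by simp
  have bound: "I V \<le> m - e0\<^sup>2 / (8 * m)" if N: "S.nbhd V" for V
  proof -
    obtain f where f: "f \<in> V" "e0 \<le> rho f one" using e0(2)[OF N] by blast
    then have fG: "f \<in> G" using S.nbhd_subset[OF N] by auto
    have "e0\<^sup>2 \<le> (rho f one)\<^sup>2" using f(2) e0(1) by (intro power_mono) auto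
    also have "\<dots> \<le> 8 * m * (m - hell X f)" using rho_sq_le_hell[OF fG] by (simp add: measure_X)
    finally have "e0\<^sup>2 / (8 * m) \<le> m - hell X f" using m_pos by (simp add: field_simps)
    then show ?thesis using I_le[OF f(1)] by linarith
  qed
  have ba: "bdd_above (I ` {V. S.nbhd V})" using bound by (intro bdd_aboveI2) auto
  have nn: "{V. S.nbhd V} \<noteq> {}" using V by auto
  have c_ge: "I V \<le> c" if "S.nbhd V" for V unfolding c_def using ba that by (intro cSUP_upper) auto
  have c0: "0 \<le> c" using I0[OF V] c_ge[OF V] by linarith
  have "c \<le> m - e0\<^sup>2 / (8 * m)" unfolding c_def using nn bound by (intro cSUP_least) auto
  moreover have "0 < e0\<^sup>2 / (8 * m)" using e0(1) m_pos by simp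
  ultimately have cm: "c < m" by linarith
  have c1: "\<exists>V. S.nbhd V \<and> (\<forall>f\<in>V. c - \<epsilon> < hell X f)" if "\<epsilon> > 0" for \<epsilon>
  proof -
    have "c - \<epsilon> < (SUP V\<in>{V. S.nbhd V}. I V)" using that by (simp add: c_def[symmetric])
    then obtain W where W: "S.nbhd W" "c - \<epsilon> < I W" using less_cSUP_iff[OF nn ba] by auto
    then show ?thesis using I_le less_le_trans by blast
  qed
  have c2: "\<exists>f\<in>V. hell X f < c + \<epsilon>" if "S.nbhd V" "\<epsilon> > 0" for V \<epsilon>
  proof -
    have "(INF f\<in>V. hell X f) < c + \<epsilon>" using c_ge[OF that(1)] that(2) by (simp add: I_def)
    then show ?thesis using cINF_less_iff[OF ne[OF that(1)] bb] by auto
  qed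
  have lim: "c - \<epsilon> \<le> (c / m) * (c + \<epsilon> + \<epsilon> * sqrt m + 3 * \<epsilon> * m) + \<epsilon> + \<epsilon> * sqrt m" if "\<epsilon> > 0" for \<epsilon>
    by (rule hell_product_near[OF S co c0 c1 c2 that])
  have "c - 0 \<le> (c / m) * (c + 0 + 0 * sqrt m + 3 * 0 * m) + 0 + 0 * sqrt m"
  proof (rule tendsto_le[OF trivial_limit_at_right_real[of 0]])
    show "((\<lambda>\<epsilon>. (c / m) * (c + \<epsilon> + \<epsilon> * sqrt m + 3 * \<epsilon> * m) + \<epsilon> + \<epsilon> * sqrt m) \<longlongrightarrow>
       (c / m) * (c + 0 + 0 * sqrt m + 3 * 0 * m) + 0 + 0 * sqrt m) (at_right 0)"
      by (intro tendsto_intros)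
    show "((\<lambda>\<epsilon>. c - \<epsilon>) \<longlongrightarrow> c - 0) (at_right 0)" by (intro tendsto_intros)
    show "\<forall>\<^sub>F \<epsilon> in at_right 0. c - \<epsilon> \<le> (c / m) * (c + \<epsilon> + \<epsilon> * sqrt m + 3 * \<epsilon> * m) + \<epsilon> + \<epsilon> * sqrt m"
      using lim eventually_at_right_less[of "0::real"] by (auto elim: eventually_mono)
  qed
  then have "c * m \<le> c * c" using m_pos by (simp add: field_simps)
  then have "c = 0" using cm c0 by (auto simp: mult_le_cancel_left)
  then show ?thesis using c2[OF V \<eta>] by simp
qed

section \<open>Fragmentation of small homeomorphisms\<close>

lemma emeasure_Un_eq_0_iff:
  assumes "A \<in> sets M" "B \<in> sets M"
  shows "emeasure M (A \<union> B) = 0 \<longleftrightarrow> emeasure M A = 0 \<and> emeasure M B = 0"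
proof
  assume "emeasure M (A \<union> B) = 0"
  then show "emeasure M A = 0 \<and> emeasure M B = 0"
    using emeasure_mono[of A "A \<union> B" M] emeasure_mono[of B "A \<union> B" M] assms by auto
next
  assume "emeasure M A = 0 \<and> emeasure M B = 0"
  then show "emeasure M (A \<union> B) = 0"
    using emeasure_subadditive[OF assms] by simp
qed

lemma glue_in_G:
  assumes h: "h \<in> G" and cl: "closed U" "closed R" and UR: "U \<union> R = X"
    and hU: "h ` U = U" and bd: "\<And>x. x \<in> U \<inter> R \<Longrightarrow> h x = x"
  shows "(\<lambda>x\<in>X. if x \<in> U then h x else x) \<in> G"
  unfolding G_iff
proof (intro conjI ballI)
  let ?u = "\<lambda>x\<in>X. if x \<in> U then h x else x"
  have UX: "U \<subseteq> X" using UR by auto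
  show "?u \<in> extensional X" by simp
  have "inj_on ?u X"
  proof (rule inj_onI)
    fix x y assume "x \<in> X" "y \<in> X" "?u x = ?u y"
    then show "x = y"
      using inj_onD[OF G_inj[OF h], of x y] hU by (auto split: if_splits)
  qed
  moreover have "?u ` X = X"
  proof
    show "?u ` X \<subseteq> X" using hU UX by auto
    show "X \<subseteq> ?u ` X"
    proof
      fix y assume y: "y \<in> X"
      show "y \<in> ?u ` X"
      proof (cases "y \<in> U")
        case True
        then obtain x where "x \<in> U" "y = h x" using hU by blast
        then show ?thesis using UX by (intro image_eqI[of _ _ x]) auto
      next
        case False
        then show ?thesis using y by (intro image_eqI[of _ _ y]) auto
      qed
    qed
  qed
  ultimately show "bij_betw ?u X X" by (simp add: bij_betw_def)
  have "continuous_on (U \<union> R) (\<lambda>x. if x \<in> U then h x else x)"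
  proof (rule continuous_on_cases[OF cl])
    show "continuous_on U h" by (rule continuous_on_subset[OF G_continuous[OF h] UX])
    show "continuous_on R (\<lambda>x. x)" by (intro continuous_intros)
    show "\<forall>x. x \<in> U \<and> x \<notin> U \<or> x \<in> R \<and> x \<in> U \<longrightarrow> h x = x" using bd by auto
  qed
  then show "continuous_on X ?u" unfolding UR by (rule continuous_on_eq) simp
  fix A assume A: "A \<in> sets M"
  have Us: "U \<in> sets M" using cl UX by (simp add: sets_M_iff)
  have AU: "A \<inter> U \<in> sets M" "A - U \<in> sets M" using A Us by auto
  have img: "?u ` A = h ` (A \<inter> U) \<union> (A - U)"
  proof -
    have "?u ` A = ?u ` (A \<inter> U) \<union> ?u ` (A - U)" by (metis Int_Diff_Un image_Un)
    moreover have "?u ` (A \<inter> U) = h ` (A \<inter> U)" using UX by (intro image_cong) auto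
    moreover have "?u ` (A - U) = (\<lambda>x. x) ` (A - U)" using A by (intro image_cong) (auto simp: sets_M_iff)
    ultimately show ?thesis by simp
  qed
  have "emeasure M (?u ` A) = 0 \<longleftrightarrow> emeasure M (h ` (A \<inter> U)) = 0 \<and> emeasure M (A - U) = 0"
    unfolding img using emeasure_Un_eq_0_iff[OF G_image_sets[OF h AU(1)] AU(2)] by simp
  also have "\<dots> \<longleftrightarrow> emeasure M (A \<inter> U) = 0 \<and> emeasure M (A - U) = 0"
    using G_null_image[OF h AU(1)] by simp
  also have "\<dots> \<longleftrightarrow> emeasure M A = 0"
    using emeasure_Un_eq_0_iff[OF AU] by (simp add: Int_Diff_Un)
  finally show "(emeasure M A = 0) = (emeasure M (?u ` A) = 0)" by simp
qed

text \<open>The set \<open>R\<close> is the complement of \<open>U\<close> together with points that \<open>h\<close> fixes, so \<open>h\<close>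
  preserves \<open>R\<close> as well and its restrictions to \<open>U\<close> and to \<open>R\<close> extend by the identity.\<close>

lemma glue_factorisation:
  assumes h: "h \<in> G" and cl: "closed U" "closed R" and UR: "U \<union> R = X"
    and hU: "h ` U = U" and bd: "\<And>x. x \<in> U \<inter> R \<Longrightarrow> h x = x"
  defines "u \<equiv> \<lambda>x\<in>X. if x \<in> U then h x else x" and "b \<equiv> \<lambda>x\<in>X. if x \<in> R then h x else x"
  shows "u \<in> G" "b \<in> G" "h = b \<odot> u" "b ` R \<subseteq> R" "\<And>x. x \<in> X \<Longrightarrow> x \<notin> R \<Longrightarrow> b x = x"
    "\<And>x. x \<in> X \<Longrightarrow> b x = h x \<or> b x = x"
proof -
  have UX: "U \<subseteq> X" "R \<subseteq> X" using UR by auto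
  have hR: "h ` R \<subseteq> R"
  proof
    fix y assume "y \<in> h ` R"
    then obtain x where x: "x \<in> R" "y = h x" by blast
    show "y \<in> R"
    proof (cases "x \<in> U")
      case True
      then show ?thesis using x bd by auto
    next
      case False
      have "y \<notin> U"
      proof
        assume "y \<in> U"
        then obtain z where z: "z \<in> U" "h x = h z" using hU x by blast
        then have "x = z" using inj_onD[OF G_inj[OF h] z(2)] UX x by auto
        then show False using False z by simp
      qed
      then show ?thesis using UR G_in[OF h, of x] UX x by auto
    qed
  qed
  have hR2: "h ` R = R"
  proof
    show "R \<subseteq> h ` R"
    proof
      fix y assume y: "y \<in> R"
      then obtain x where x: "x \<in> X" "y = h x" using G_image[OF h] UX by (metis imageE subsetD)
      show "y \<in> h ` R"
      proof (cases "x \<in> R")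
        case False
        then have "x \<in> U" using x UR by auto
        then have "y \<in> U" using hU x by auto
        then show ?thesis using y bd by (metis IntI image_eqI)
      qed (use x in auto)
    qed
  qed (rule hR)
  show u: "u \<in> G" unfolding u_def by (rule glue_in_G[OF h cl UR hU bd])
  show b: "b \<in> G" unfolding b_def
    by (rule glue_in_G[OF h cl(2,1) _ hR2]) (use UR bd in auto)
  show "b ` R \<subseteq> R" using hR UX by (auto simp: b_def)
  show "b x = x" if "x \<in> X" "x \<notin> R" for x using that by (simp add: b_def)
  show "b x = h x \<or> b x = x" if "x \<in> X" for x using that by (simp add: b_def)
  show "h = b \<odot> u"
  proof (rule G_eqI[OF h])
    show "b \<odot> u \<in> G" using u b by simp
    fix x assume x: "x \<in> X"
    show "h x = (b \<odot> u) x"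
    proof (cases "x \<in> U")
      case True
      then have "u x = h x" "h x \<in> U" using x hU by (auto simp: u_def)
      moreover have "b (h x) = h x" if "h x \<in> U"
        using that UX bd[of "h x"] by (auto simp: b_def)
      ultimately show ?thesis using u b x by simp
    next
      case False
      then have "u x = x" "x \<in> R" using x UR by (auto simp: u_def)
      then show ?thesis using u b x by (simp add: b_def)
    qed
  qed
qed

abbreviation grid :: "nat \<Rightarrow> nat \<Rightarrow> real" where "grid n i \<equiv> real i * mesh n"

lemma grid_mono: "0 < n \<Longrightarrow> i \<le> j \<Longrightarrow> grid n i \<le> grid n j"
  using mesh(1)[of n] by (intro mult_right_mono) auto

lemma grid_less: "0 < n \<Longrightarrow> i < j \<Longrightarrow> grid n i < grid n j"
  using mesh(1)[of n] by (intro mult_strict_right_mono) auto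

lemma grid_Suc: "grid n (Suc i) = grid n i + mesh n"
  by (simp add: distrib_right)

lemma grid_end: "0 < n \<Longrightarrow> grid n n = m"
  by (rule mesh)

lemma grid_interior:
  assumes "0 < i" "i < n"
  shows "mesh n \<le> grid n i" "grid n i \<le> m - mesh n" "0 < grid n i" "grid n i < m"
proof -
  have n: "0 < n" using assms by simp
  show 1: "mesh n \<le> grid n i" using grid_mono[OF n, of 1 i] assms by simp
  have "grid n (Suc i) \<le> grid n n" using assms by (intro grid_mono[OF n]) auto
  then show 2: "grid n i \<le> m - mesh n" using grid_end[OF n] grid_Suc[where n=n and i=i] by linarith
  show "0 < grid n i" "grid n i < m" using 1 2 mesh(1)[OF n] by linarith+
qed

lemma near_identity_moves_grid_little:
  assumes n: "0 < n" and \<kappa>: "0 < \<kappa>" "\<kappa> \<le> mesh n"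
  shows "\<exists>e>0. \<forall>h\<in>G. sup_dist h one < e \<longrightarrow>
    (\<forall>i\<in>{1..<n}. \<exists>t. \<bar>t - grid n i\<bar> < \<kappa> \<and> h (p (grid n i)) = p t)"
proof -
  have "\<exists>V. co.nbhd V \<and> (\<forall>h\<in>V. \<exists>t. \<bar>t - grid n i\<bar> < \<kappa> \<and> h (p (grid n i)) = p t)"
    if i: "i \<in> {1..<n}" for i
  proof -
    let ?g = "grid n i"
    have g: "mesh n \<le> ?g" "?g \<le> m - mesh n" "0 < ?g" "?g < m" using grid_interior[of i n] i by auto
    obtain e where e: "e > 0" "\<forall>x\<in>p ` {?g..?g}. \<forall>y\<in>X. dist x y < e \<longrightarrow> y \<in> p ` {?g - \<kappa><..<?g + \<kappa>}"
      using arc_neighbourhood[of "?g - \<kappa>" ?g ?g "?g + \<kappa>"] g \<kappa> by auto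
    have "\<exists>t. \<bar>t - ?g\<bar> < \<kappa> \<and> h (p ?g) = p t" if h: "h \<in> {h \<in> G. sup_dist h one < e}" for h
    proof -
      have hG: "h \<in> G" "sup_dist h one < e" using h by auto
      have pX: "p ?g \<in> X" using g by (intro p_in) auto
      have "dist (p ?g) (h (p ?g)) < e"
        using dist_le_sup_dist[OF hG(1), of one "p ?g"] hG(2) pX by (simp add: dist_commute)
      then have "h (p ?g) \<in> p ` {?g - \<kappa><..<?g + \<kappa>}" using e(2) G_in[OF hG(1) pX] by auto
      then obtain t where "t \<in> {?g - \<kappa><..<?g + \<kappa>}" "h (p ?g) = p t" by (elim imageE)
      then show ?thesis by (intro exI[of _ t]) (auto simp: abs_less_iff)
    qed
    then show ?thesis using co_nbhd_ball[OF e(1)] by blast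
  qed
  then obtain V where V: "\<And>i. i \<in> {1..<n} \<Longrightarrow> co.nbhd (V i)"
    "\<And>i h. i \<in> {1..<n} \<Longrightarrow> h \<in> V i \<Longrightarrow> \<exists>t. \<bar>t - grid n i\<bar> < \<kappa> \<and> h (p (grid n i)) = p t"
    by metis
  obtain W where W: "co.nbhd W" "\<forall>i\<in>{1..<n}. W \<subseteq> V i"
    using co.nbhd_INT[of "{1..<n}" V] V(1) by auto
  obtain e where e: "e > 0" "\<And>h. h \<in> G \<Longrightarrow> sup_dist h one < e \<Longrightarrow> h \<in> W"
    by (rule co_nbhd_contains_ball[OF W(1)]) (rule that)
  have "\<forall>i\<in>{1..<n}. \<exists>t. \<bar>t - grid n i\<bar> < \<kappa> \<and> h (p (grid n i)) = p t"
    if "h \<in> G" "sup_dist h one < e" for h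
  proof
    fix i assume i: "i \<in> {1..<n}"
    then have "h \<in> V i" using e(2)[OF that] W(2) by auto
    then show "\<exists>t. \<bar>t - grid n i\<bar> < \<kappa> \<and> h (p (grid n i)) = p t" by (rule V(2)[OF i])
  qed
  then show ?thesis using e(1) by blast
qed

text \<open>The displacements of the grid points are interpolated by a sum of tents of radius half a mesh. Each
  tent vanishes at all other grid points. The slopes of the \<open>n\<close> tents are simply added; the factor
  \<open>n\<close> lost in this way is harmless, since \<open>\<kappa>\<close> is chosen after \<open>n\<close>.\<close>

lemma grid_adjustment:
  assumes n: "0 < n" and t: "\<And>i. i \<in> {1..<n} \<Longrightarrow> \<bar>t i - grid n i\<bar> \<le> \<kappa>" and \<kappa>: "0 \<le> \<kappa>"
    and L: "L = real n * (\<kappa> * (2 / mesh n))" "L < 1"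
  obtains \<beta> where "\<beta> \<in> G" "\<And>i. i \<in> {1..<n} \<Longrightarrow> \<beta> (p (grid n i)) = p (t i)"
    "rho \<beta> one \<le> 2 * L * m"
    "\<And>s. 0 \<le> s \<Longrightarrow> s \<le> m \<Longrightarrow> \<exists>s'. 0 \<le> s' \<and> s' \<le> m \<and> \<beta> (p s) = p s' \<and> \<bar>s' - s\<bar> \<le> real n * \<kappa>"
proof -
  let ?h = "mesh n"
  have h: "0 < ?h" by (rule mesh(1)[OF n])
  define \<psi> where "\<psi> s = (\<Sum>i\<in>{1..<n}. (t i - grid n i) * (tent (grid n i) (?h / 2) s * (2 / ?h)))" for s
  have far: "?h / 2 \<le> \<bar>grid n j - grid n i\<bar>" if "i \<noteq> j" for i j
  proof -
    have *: "?h / 2 \<le> grid n b - grid n a" if "a < b" for a b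
    proof -
      have "grid n (Suc a) \<le> grid n b" using that by (intro grid_mono[OF n]) auto
      then show ?thesis using grid_Suc[where n=n and i=a] h by linarith
    qed
    show ?thesis
    proof (cases "i < j")
      case True
      then show ?thesis using *[OF True] by linarith
    next
      case False
      then have "j < i" using that by simp
      then show ?thesis using *[OF \<open>j < i\<close>] by linarith
    qed
  qed
  have \<psi>g: "\<psi> (grid n j) = t j - grid n j" if "j \<in> {1..<n}" for j
  proof -
    have "\<psi> (grid n j) = (\<Sum>i\<in>{1..<n}. if i = j then t j - grid n j else 0)"
      unfolding \<psi>_def
    proof (intro sum.cong refl)
      fix i assume "i \<in> {1..<n}"
      show "(t i - grid n i) * (tent (grid n i) (?h / 2) (grid n j) * (2 / ?h)) = (if i = j then t j - grid n j else 0)"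
      proof (cases "i = j")
        case True
        then show ?thesis using h by (simp add: tent_def)
      next
        case False
        then show ?thesis using tent_zero[OF far[OF False]] by simp
      qed
    qed
    then show ?thesis using that by simp
  qed
  have \<psi>0: "\<psi> 0 = 0" unfolding \<psi>_def
  proof (intro sum.neutral ballI)
    fix i assume "i \<in> {1..<n}"
    then have "?h / 2 \<le> \<bar>0 - grid n i\<bar>" using far[of i 0] by simp
    then show "(t i - grid n i) * (tent (grid n i) (?h / 2) 0 * (2 / ?h)) = 0" by (simp add: tent_zero)
  qed
  have \<psi>m: "\<psi> m = 0" unfolding \<psi>_def
  proof (intro sum.neutral ballI)
    fix i assume "i \<in> {1..<n}"
    then have "?h / 2 \<le> \<bar>m - grid n i\<bar>" using far[of i n] grid_end[OF n] by simp
    then show "(t i - grid n i) * (tent (grid n i) (?h / 2) m * (2 / ?h)) = 0" by (simp add: tent_zero)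
  qed
  have \<psi>L: "\<bar>\<psi> s' - \<psi> s\<bar> \<le> L * \<bar>s' - s\<bar>" for s s'
  proof -
    have "\<bar>\<psi> s' - \<psi> s\<bar> = \<bar>\<Sum>i\<in>{1..<n}. (t i - grid n i) * ((tent (grid n i) (?h / 2) s' - tent (grid n i) (?h / 2) s) * (2 / ?h))\<bar>"
      unfolding \<psi>_def sum_subtractf[symmetric] by (simp only: right_diff_distrib left_diff_distrib)
    also have "\<dots> \<le> (\<Sum>i\<in>{1..<n}. \<bar>(t i - grid n i) * ((tent (grid n i) (?h / 2) s' - tent (grid n i) (?h / 2) s) * (2 / ?h))\<bar>)"
      by (rule sum_abs)
    also have "\<dots> \<le> (\<Sum>i\<in>{1..<n}. \<kappa> * (\<bar>s' - s\<bar> * (2 / ?h)))"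
      unfolding abs_mult using t tent_Lipschitz h \<kappa> by (intro sum_mono mult_mono) auto
    also have "\<dots> = real (n - 1) * (\<kappa> * (\<bar>s' - s\<bar> * (2 / ?h)))" by simp
    also have "\<dots> \<le> real n * (\<kappa> * (\<bar>s' - s\<bar> * (2 / ?h)))"
      using \<kappa> h by (intro mult_right_mono) auto
    also have "\<dots> = L * \<bar>s' - s\<bar>" unfolding L(1) by simp
    finally show ?thesis .
  qed
  have \<psi>b: "\<bar>\<psi> s\<bar> \<le> real n * \<kappa>" for s
  proof -
    have "\<bar>\<psi> s\<bar> \<le> (\<Sum>i\<in>{1..<n}. \<bar>(t i - grid n i) * (tent (grid n i) (?h / 2) s * (2 / ?h))\<bar>)"
      unfolding \<psi>_def by (rule sum_abs)
    also have "\<dots> \<le> (\<Sum>i\<in>{1..<n}. \<kappa> * 1)"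
    proof (rule sum_mono)
      fix i assume i: "i \<in> {1..<n}"
      have T: "0 \<le> tent (grid n i) (?h / 2) s" "tent (grid n i) (?h / 2) s \<le> ?h / 2"
        using h by (simp_all only: tent_def max.bounded_iff) simp_all
      then have "\<bar>tent (grid n i) (?h / 2) s * (2 / ?h)\<bar> = tent (grid n i) (?h / 2) s * (2 / ?h)"
        using h by (intro abs_of_nonneg mult_nonneg_nonneg) auto
      also have "\<dots> \<le> ?h / 2 * (2 / ?h)" using T h by (intro mult_right_mono) auto
      also have "\<dots> = 1" using h by simp
      finally have "\<bar>tent (grid n i) (?h / 2) s * (2 / ?h)\<bar> \<le> 1" .
      then show "\<bar>(t i - grid n i) * (tent (grid n i) (?h / 2) s * (2 / ?h))\<bar> \<le> \<kappa> * 1"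
        unfolding abs_mult[of "t i - grid n i"] using t[OF i] \<kappa> by (intro mult_mono) auto
    qed
    also have "\<dots> \<le> real n * \<kappa>" using \<kappa> by (simp add: mult_right_mono)
    finally show ?thesis .
  qed
  define \<phi> where "\<phi> s = s + \<psi> s" for s
  have bi: "bilip (1 - L) (1 + L) \<phi>"
    unfolding \<phi>_def using L(2) \<psi>0 \<psi>m \<psi>L by (intro bilip_perturbation) auto
  have G: "lift \<phi> \<in> G" by (rule lift_in_G[OF bi])
  have L0: "0 \<le> L" unfolding L(1) using \<kappa> h by simp
  show ?thesis
  proof (rule that[OF G])
    show "lift \<phi> (p (grid n i)) = p (t i)" if "i \<in> {1..<n}" for i
      using lift_p[OF bi, of "grid n i"] grid_interior[of i n] \<psi>g[OF that] that by (simp add: \<phi>_def)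
    show "rho (lift \<phi>) one \<le> 2 * L * m"
      using rho_Lipschitz_le[OF G L0 lift_measure_le[OF bi]] by (simp add: measure_X)
    show "\<exists>s'. 0 \<le> s' \<and> s' \<le> m \<and> lift \<phi> (p s) = p s' \<and> \<bar>s' - s\<bar> \<le> real n * \<kappa>"
      if "0 \<le> s" "s \<le> m" for s
      using lift_p[OF bi that] bilip_range[OF bi that] \<psi>b[of s] by (intro exI[of _ "\<phi> s"]) (simp add: \<phi>_def)
  qed
qed

lemma closed_cell_close:
  assumes osc: "\<forall>s\<in>{0..m}. \<forall>t\<in>{0..m}. \<bar>s - t\<bar> < d \<longrightarrow> dist (p s) (p t) < e"
    and n: "mesh n < d" "i < n" and xy: "x \<in> p ` {grid n i..grid n (Suc i)}" "y \<in> p ` {grid n i..grid n (Suc i)}"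
  shows "dist x y < e"
proof -
  obtain s where s: "s \<in> {grid n i..grid n (Suc i)}" "x = p s" using xy(1) by (elim imageE)
  obtain t where t: "t \<in> {grid n i..grid n (Suc i)}" "y = p t" using xy(2) by (elim imageE)
  have n0: "0 < n" using n(2) by simp
  have b: "0 \<le> grid n i" "grid n (Suc i) \<le> m"
    using grid_mono[OF n0, of "Suc i" n] grid_end[OF n0] n(2) mesh(1)[OF n0] by auto
  have "s \<in> {0..m}" "t \<in> {0..m}" using s(1) t(1) b by auto
  moreover have "\<bar>s - t\<bar> < d"
    using s(1) t(1) n(1) unfolding grid_Suc atLeastAtMost_iff abs_less_iff by linarith
  ultimately have "dist (p s) (p t) < e" using osc by blast
  then show ?thesis by (simp only: s(2) t(2))
qed

definition block :: "nat \<Rightarrow> nat set \<Rightarrow> 'a set" where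
  "block n I = (\<Union>i\<in>I. p ` {grid n i..grid n (Suc i)})"

text \<open>The closed remainder of a block: only the open parameter intervals of its cells are removed, so that
  block and remainder overlap in grid points.\<close>

definition coblock :: "nat \<Rightarrow> nat set \<Rightarrow> 'a set" where
  "coblock n I = p ` ({0..m} - (\<Union>i\<in>I. {grid n i<..<grid n (Suc i)}))"

lemma cell_index_interior:
  assumes "i \<in> {1..<n - 1}"
  shows "0 < grid n i" "grid n i < grid n (Suc i)" "grid n (Suc i) < m" "i \<in> {1..<n}" "Suc i \<in> {1..<n}"
proof -
  show i: "i \<in> {1..<n}" "Suc i \<in> {1..<n}" using assms by auto
  show "0 < grid n i" "grid n (Suc i) < m"
    using grid_interior[of i n] grid_interior[of "Suc i" n] i by auto
  show "grid n i < grid n (Suc i)" using i by (intro grid_less) auto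
qed

lemma block_closed:
  assumes "I \<subseteq> {1..<n - 1}"
  shows "closed (block n I)" "closed (coblock n I)" "block n I \<union> coblock n I = X"
    "\<And>x. x \<in> block n I \<inter> coblock n I \<Longrightarrow> \<exists>j\<in>{1..<n}. x = p (grid n j)"
proof -
  have fin: "finite I" using assms finite_subset by blast
  have sub: "{grid n i..grid n (Suc i)} \<subseteq> {0..m}" if "i \<in> I" for i
    using cell_index_interior(1,3)[OF subsetD[OF assms that]]
    by (simp only: atLeastatMost_subset_iff) linarith
  show "closed (block n I)" unfolding block_def
    using fin sub by (intro closed_UN ballI compact_imp_closed closed_p_image) auto
  have "closed ({0..m} - (\<Union>i\<in>I. {grid n i<..<grid n (Suc i)}))"
    by (intro closed_Diff open_UN) auto
  then show "closed (coblock n I)" unfolding coblock_def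
    by (rule compact_imp_closed[OF closed_p_image[OF Diff_subset]])
  show "block n I \<union> coblock n I = X"
  proof -
    have "(\<Union>i\<in>I. {grid n i..grid n (Suc i)}) \<union> ({0..m} - (\<Union>i\<in>I. {grid n i<..<grid n (Suc i)})) = {0..m}"
    proof
      show "(\<Union>i\<in>I. {grid n i..grid n (Suc i)}) \<union> ({0..m} - (\<Union>i\<in>I. {grid n i<..<grid n (Suc i)})) \<subseteq> {0..m}"
        using sub by (intro Un_least UN_least Diff_subset)
      show "{0..m} \<subseteq> (\<Union>i\<in>I. {grid n i..grid n (Suc i)}) \<union> ({0..m} - (\<Union>i\<in>I. {grid n i<..<grid n (Suc i)}))"
      proof
        fix x assume x: "x \<in> {0..m}"
        have "x \<in> (\<Union>i\<in>I. {grid n i..grid n (Suc i)})" if "x \<in> (\<Union>i\<in>I. {grid n i<..<grid n (Suc i)})"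
          using that less_imp_le by (elim UN_E) (intro UN_I, auto)
        then show "x \<in> (\<Union>i\<in>I. {grid n i..grid n (Suc i)}) \<union> ({0..m} - (\<Union>i\<in>I. {grid n i<..<grid n (Suc i)}))"
          using x by blast
      qed
    qed
    then show ?thesis using p_surj unfolding block_def coblock_def by (metis image_UN image_Un)
  qed
  fix x assume "x \<in> block n I \<inter> coblock n I"
  then obtain i where i: "i \<in> I" "x \<in> p ` {grid n i..grid n (Suc i)}" "x \<in> coblock n I"
    by (auto simp: block_def)
  obtain s where s: "s \<in> {grid n i..grid n (Suc i)}" "x = p s" using i(2) by (elim imageE)
  obtain r where r: "r \<in> {0..m} - (\<Union>i\<in>I. {grid n i<..<grid n (Suc i)})" "x = p r"
    using i(3) unfolding coblock_def by (elim imageE)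
  have ci: "0 < grid n i" "grid n (Suc i) < m" "i \<in> {1..<n}" "Suc i \<in> {1..<n}"
    using cell_index_interior[of i n] i(1) assms by auto
  have "s = r" using p_eq_iff[of s r] s r ci by simp
  have "s \<notin> {grid n i<..<grid n (Suc i)}" using r(1) i(1) \<open>s = r\<close> by blast
  then have "s = grid n i \<or> s = grid n (Suc i)" using s(1) by auto
  then show "\<exists>j\<in>{1..<n}. x = p (grid n j)" using ci(3,4) s(2) by blast
qed

text \<open>A cell whose end points are fixed is mapped to itself, since a third grid point is fixed too; this
  is why at least four cells are taken. The first and the last cell are never part of a block: they
  end at \<open>p 0\<close> or \<open>p m\<close>, which on a closed curve need not be fixed.\<close>

lemma block_invariant:
  assumes h: "h \<in> G" and n: "4 \<le> n" and I: "I \<subseteq> {1..<n - 1}"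
    and fixed: "\<And>j. j \<in> {1..<n} \<Longrightarrow> h (p (grid n j)) = p (grid n j)"
  shows "i \<in> I \<Longrightarrow> h ` p ` {grid n i..grid n (Suc i)} = p ` {grid n i..grid n (Suc i)}"
    and "h ` block n I = block n I"
proof -
  have cell: "h ` p ` {grid n i..grid n (Suc i)} = p ` {grid n i..grid n (Suc i)}" if i: "i \<in> I" for i
  proof -
    have ii: "i \<in> {1..<n - 1}" using i I by auto
    obtain j where j: "j \<in> {1..<n}" "j < i \<or> Suc i < j"
    proof (cases "i = 1")
      case True
      then show ?thesis using that[of 3] n by simp
    next
      case False
      then show ?thesis using that[of 1] ii by auto
    qed
    have n0: "0 < n" using n by simp
    have jn: "grid n j \<notin> {grid n i..grid n (Suc i)}"
      using grid_less[OF n0, of j i] grid_less[OF n0, of "Suc i" j] j(2) by auto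
    note ci = cell_index_interior[OF ii]
    have jb: "0 < grid n j" "grid n j < m" using grid_interior[of j n] j(1) by auto
    show ?thesis
      by (rule arc_image_eq[OF h ci(1,2,3,1,2,3) fixed[OF ci(4)] fixed[OF ci(5)] jb jn jb jn fixed[OF j(1)]])
  qed
  then show "i \<in> I \<Longrightarrow> h ` p ` {grid n i..grid n (Suc i)} = p ` {grid n i..grid n (Suc i)}" .
  show "h ` block n I = block n I"
    unfolding block_def image_UN using cell by simp
qed

text \<open>Up to finitely many points, the remainder consists of cells that miss \<open>C\<close> and of the two outermost
  cells.\<close>

lemma coblock_measure_le:
  assumes n: "4 \<le> n" and C: "C \<in> sets M"
    and I: "I = {i \<in> {1..<n - 1}. p ` {grid n i..grid n (Suc i)} \<inter> C \<noteq> {}}"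
  shows "measure M (coblock n I) \<le> (measure M X - measure M C) + 2 * mesh n"
proof -
  have n0: "0 < n" using n by simp
  have h: "0 < mesh n" "2 * mesh n \<le> m"
    using mesh[OF n0] grid_mono[OF n0, of 2 n] n by auto
  let ?E1 = "p ` {0..mesh n}" and ?E2 = "p ` {m - mesh n..m}" and ?F = "p ` (grid n ` {1..<n})"
  have Isub: "I \<subseteq> {1..<n - 1}" using I by auto
  have Es: "?E1 \<in> sets M" "?E2 \<in> sets M" using h by (auto intro!: p_image_Icc_sets)
  have gsub: "grid n ` {1..<n} \<subseteq> {0..m}"
  proof
    fix x assume "x \<in> grid n ` {1..<n}"
    then obtain j where "j \<in> {1..<n}" "x = grid n j" by auto
    then show "x \<in> {0..m}" using grid_interior[of j n] by auto
  qed
  have Fb: "grid n ` {1..<n} \<in> sets borel" by (intro borel_closed finite_imp_closed) simp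
  have Fs: "?F \<in> sets M" "measure M ?F = 0"
  proof -
    show "?F \<in> sets M" by (rule p_image_measure(1)[OF Fb gsub])
    have "emeasure lborel (grid n ` {1..<n}) = 0" by (intro emeasure_lborel_countable countable_finite) simp
    then show "measure M ?F = 0" using p_image_measure(2)[OF Fb gsub] by (simp add: measure_def)
  qed
  have XC: "X - C \<in> sets M" using C by auto
  have "coblock n I \<subseteq> ((X - C) \<union> ?F) \<union> (?E1 \<union> ?E2)"
  proof
    fix x assume "x \<in> coblock n I"
    then obtain r where r: "r \<in> {0..m} - (\<Union>i\<in>I. {grid n i<..<grid n (Suc i)})" "x = p r"
      unfolding coblock_def by (elim imageE)
    have rm: "0 \<le> r" "r \<le> m" using r(1) by auto
    show "x \<in> ((X - C) \<union> ?F) \<union> (?E1 \<union> ?E2)"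
    proof (rule ccontr)
      assume no: "x \<notin> ((X - C) \<union> ?F) \<union> (?E1 \<union> ?E2)"
      have xC: "x \<in> C" using no r(2) p_in[OF rm] by auto
      have r1: "r \<notin> {0..mesh n}" "r \<notin> {m - mesh n..m}" "r \<notin> grid n ` {1..<n}"
        using no r(2) by (metis UnCI image_eqI)+
      obtain i where i: "i < n" "grid n i \<le> r" "r \<le> grid n (Suc i)"
        using chain_cover[of "grid n" r n] rm grid_end[OF n0] n0 by auto
      have "i \<noteq> 0"
      proof
        assume "i = 0"
        then have "r \<le> mesh n" using i(3) by simp
        then show False using r1(1) rm by auto
      qed
      moreover have "i \<noteq> n - 1"
      proof
        assume "i = n - 1"
        then have "m \<le> grid n i + mesh n" using grid_Suc[where n=n and i=i] grid_end[OF n0] n0 by simp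
        then show False using r1(2) rm i(2) by auto
      qed
      ultimately have ii: "i \<in> {1..<n - 1}" using i(1) by auto
      have "x \<in> p ` {grid n i..grid n (Suc i)}" using i r(2) by auto
      then have "i \<in> I" using ii xC unfolding I by auto
      then have "r \<notin> {grid n i<..<grid n (Suc i)}" using r(1) by blast
      then have "r = grid n i \<or> r = grid n (Suc i)" using i by auto
      then have "r \<in> grid n ` {1..<n}" using cell_index_interior(4,5)[OF ii] by (metis image_eqI)
      then show False using r1(3) by simp
    qed
  qed
  then have "measure M (coblock n I) \<le> measure M (((X - C) \<union> ?F) \<union> (?E1 \<union> ?E2))"
    using XC Fs Es by (intro finite_measure_mono) auto
  also have "\<dots> \<le> measure M ((X - C) \<union> ?F) + measure M (?E1 \<union> ?E2)"
    using XC Fs Es by (intro measure_Un_le) auto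
  also have "\<dots> \<le> (measure M (X - C) + measure M ?F) + (measure M ?E1 + measure M ?E2)"
    using XC Fs Es by (intro add_mono measure_Un_le) auto
  also have "measure M (X - C) = measure M X - measure M C"
    using C by (intro finite_measure_Diff) (auto simp: sets_M_iff[of C])
  also have "measure M ?E1 + measure M ?E2 = 2 * mesh n"
    using h by (simp add: measure_p_Icc)
  finally show ?thesis using Fs(2) by simp
qed

text \<open>Take a small set \<open>A\<close> with large image, a compact \<open>C\<close> inside \<open>f A\<close> of nearly the same measure, and an
  open neighbourhood \<open>U\<close> of the preimage of \<open>C\<close> whose measure in \<open>X\<close> is still small. On a fine
  enough grid, the cells that meet \<open>C\<close> have preimages inside \<open>U\<close>, because \<open>C\<close> has positive distance
  from the compact set \<open>f (X - U)\<close>.\<close>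

lemma singular_block:
  assumes f: "f \<in> G" and hf: "hell X f < \<eta>" and \<eta>: "0 < \<eta>" and d: "0 < d"
  obtains n I where "4 \<le> n" "mesh n < d" "I \<subseteq> {1..<n - 1}"
    "measure M (coblock n I) < 4 * \<eta>" "measure M (ginv f ` block n I) < 2 * \<eta>"
proof -
  obtain A where A: "A \<in> sets M" "measure M A < \<eta>" "measure M X - \<eta> < measure M (f ` A)"
    by (rule hell_small_singular[OF f hf]) (rule that)
  have fA: "f ` A \<in> sets M" by (rule G_image_sets[OF f A(1)])
  obtain C where C: "C \<subseteq> f ` A" "compact C" "measure M (f ` A) - \<eta> < measure M C"
    by (rule compact_inner_approx[OF fA \<eta>]) (rule that)
  have AX: "A \<subseteq> X" using A(1) by (simp add: sets_M_iff)
  have CX: "C \<subseteq> X" using C(1) fA by (auto simp: sets_M_iff)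
  have Cs: "C \<in> sets M" using C(2) CX by (simp add: sets_M_iff borel_compact)
  have inv: "ginv f \<in> G" using f by simp
  have A1: "ginv f ` C \<in> sets M" by (rule G_image_sets[OF inv Cs])
  have "ginv f ` C \<subseteq> ginv f ` f ` A" using C(1) by (rule image_mono)
  then have A1A: "ginv f ` C \<subseteq> A" using ginv_image[OF f AX] by simp
  obtain U where U: "ginv f ` C \<subseteq> U" "open U" "measure M (U \<inter> X) < measure M (ginv f ` C) + \<eta>"
    by (rule open_outer_approx[OF A1 \<eta>]) (rule that)
  have "measure M (ginv f ` C) \<le> measure M A" using A1A A(1) by (intro finite_measure_mono)
  then have U2: "measure M (U \<inter> X) < 2 * \<eta>" using U(3) A(2) by linarith
  let ?F = "f ` (X - U)"
  have "compact (X - U)" using compact U(2) by (simp add: compact_diff)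
  then have F: "closed ?F"
    by (intro compact_imp_closed compact_continuous_image continuous_on_subset[OF G_continuous[OF f]]) auto
  have CF: "C \<inter> ?F = {}"
  proof (rule ccontr)
    assume "C \<inter> ?F \<noteq> {}"
    then obtain x where x: "x \<in> X" "x \<notin> U" "f x \<in> C" by auto
    then have "x \<in> ginv f ` C" using ginv_apply[OF f x(1)] by (metis image_eqI)
    then show False using U(1) x by auto
  qed
  obtain d0 where d0: "0 < d0" "\<forall>x\<in>C. \<forall>y\<in>?F. d0 \<le> dist x y"
    using separate_compact_closed[OF C(2) F CF] by metis
  obtain d1 where d1: "d1 > 0" "\<forall>s\<in>{0..m}. \<forall>t\<in>{0..m}. \<bar>s - t\<bar> < d1 \<longrightarrow> dist (p s) (p t) < d0"
    using p_uniformly_continuous[OF d0(1)] by metis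
  define k where "k = min d (min d1 \<eta>)"
  have k: "0 < k" using d d1 \<eta> by (simp add: k_def)
  obtain n0 where n0: "m / k < real n0" using reals_Archimedean2 by blast
  define n where "n = n0 + 4"
  have n: "4 \<le> n" "m / k < real n" using n0 by (auto simp: n_def)
  then have "mesh n < k" using k by (simp add: mesh_def field_simps)
  then have mn: "mesh n < d" "mesh n < d1" "mesh n < \<eta>" by (auto simp: k_def)
  define I where "I = {i \<in> {1..<n - 1}. p ` {grid n i..grid n (Suc i)} \<inter> C \<noteq> {}}"
  have Isub: "I \<subseteq> {1..<n - 1}" by (auto simp: I_def)
  have "measure M (coblock n I) \<le> (measure M X - measure M C) + 2 * mesh n"
    by (rule coblock_measure_le[OF n(1) Cs I_def])
  then have co: "measure M (coblock n I) < 4 * \<eta>" using A(3) C(3) mn(3) by linarith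
  have blX: "block n I \<subseteq> X" using block_closed(3)[OF Isub] by auto
  have "ginv f ` block n I \<subseteq> U \<inter> X"
  proof
    fix z assume "z \<in> ginv f ` block n I"
    then obtain x where x: "x \<in> block n I" "z = ginv f x" by auto
    then obtain i where i: "i \<in> I" "x \<in> p ` {grid n i..grid n (Suc i)}" by (auto simp: block_def)
    then obtain y where y: "y \<in> p ` {grid n i..grid n (Suc i)}" "y \<in> C" by (auto simp: I_def)
    have "i < n" using subsetD[OF Isub i(1)] by auto
    then have "dist y x < d0" by (rule closed_cell_close[OF d1(2) mn(2) _ y(1) i(2)])
    then have "x \<notin> ?F" using d0(2) y(2) by force
    moreover have xX: "x \<in> X" using x(1) blX by auto
    moreover have zX: "z \<in> X" using G_in[OF inv xX] x(2) by simp
    moreover have "f z = x" using x(2) apply_ginv[OF f xX] by simp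
    ultimately show "z \<in> U \<inter> X" by auto
  qed
  moreover have "U \<inter> X \<in> sets M" using U(2) compact by (auto simp: sets_M_iff borel_compact)
  ultimately have "measure M (ginv f ` block n I) \<le> measure M (U \<inter> X)" by (intro finite_measure_mono)
  then have "measure M (ginv f ` block n I) < 2 * \<eta>" using U2 by linarith
  then show ?thesis using that[OF n(1) mn(1) Isub co] by blast
qed

lemma sup_dist_mul_le:
  assumes "a \<in> G" "b \<in> G"
  shows "sup_dist (a \<odot> b) one \<le> sup_dist a one + sup_dist b one"
proof -
  have "sup_dist (a \<odot> b) one \<le> sup_dist (a \<odot> b) b + sup_dist b one"
    using assms by (intro sup_dist_triangle) auto
  also have "sup_dist (a \<odot> b) b = sup_dist (a \<odot> b) (one \<odot> b)"
    using assms grp.l_one[of b] by simp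
  also have "\<dots> = sup_dist a one" using assms by (intro sup_dist_right_invariant) auto
  finally show ?thesis .
qed

lemma sup_dist_ginv:
  assumes "a \<in> G"
  shows "sup_dist (ginv a) one = sup_dist a one"
proof -
  have "sup_dist (ginv a) one = sup_dist (ginv a \<odot> a) (one \<odot> a)"
    using assms by (intro sup_dist_right_invariant[symmetric]) auto
  also have "\<dots> = sup_dist one a" using assms grp.l_inv[of a] grp.l_one[of a] by simp
  finally show ?thesis by (simp add: sup_dist_commute)
qed

text \<open>Write \<open>h = \<beta> \<odot> b \<odot> u\<close>. The map \<open>\<beta>\<close> has slopes close to 1 and moves the grid points as \<open>h\<close> does; then
  \<open>h' = ginv \<beta> \<odot> h\<close> fixes them, so it preserves the cells of the block and factors into \<open>u\<close>, supported on
  the block, and \<open>b\<close>, supported on the small remainder. The maps \<open>\<beta>\<close> and \<open>b\<close> are close to the identity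
  in \<open>tau_ac\<close>. The map \<open>u\<close> need not be, but with \<open>f\<close> almost singular its conjugate \<open>ginv f \<odot> u \<odot> f\<close> is,
  being supported on a set of small measure; and \<open>f\<close> itself is small in \<open>S\<close>. Altogether \<open>h\<close> is a
  product of five elements of \<open>W3\<close>.\<close>

theorem nbhd_contains_co_ball:
  assumes S: "topological_group GG S" and co: "coarser_topology tco S" and ac: "coarser_topology S tac"
    and e0: "e0 > 0" "\<And>V. topological_group.nbhd GG S V \<Longrightarrow> \<exists>f\<in>V. e0 \<le> rho f one"
    and W: "topological_group.nbhd GG S W"
  shows "\<exists>e>0. \<forall>h\<in>G. sup_dist h one < e \<longrightarrow> h \<in> W"
proof -
  interpret S: topological_group GG S by fact
  obtain W1 where W1: "S.nbhd W1" "\<forall>x\<in>W1. \<forall>y\<in>W1. x \<odot> y \<in> W" using S.nbhd_mult[OF W] by metis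
  obtain W2 where W2: "S.nbhd W2" "\<forall>x\<in>W2. \<forall>y\<in>W2. x \<odot> y \<in> W1" using S.nbhd_mult[OF W1(1)] by metis
  obtain W3 where W3: "S.nbhd W3" "\<forall>x\<in>W3. \<forall>y\<in>W3. x \<odot> y \<in> W2" using S.nbhd_mult[OF W2(1)] by metis
  obtain W4 where W4: "S.nbhd W4" "\<forall>x\<in>W4. ginv x \<in> W3" using S.nbhd_inv[OF W3(1)] by metis
  have "ac.nbhd W3" using W3(1) ac by (auto simp: S.nbhd_def ac.nbhd_def coarser_topology_def)
  then obtain \<delta> where \<delta>: "\<delta> > 0" "\<And>h. h \<in> G \<Longrightarrow> sup_dist h one + rho h one < \<delta> \<Longrightarrow> h \<in> W3"
    by (rule ac_nbhd_contains_ball) (rule that)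
  \<comment> \<open>With this choice the measure of the remainder is below \<delta>/4 and that of the support of the
    conjugate below \<delta>/8, so their contributions to rho are below \<delta>/2 and \<delta>/4.\<close>
  define \<eta> where "\<eta> = \<delta> / 16"
  have \<eta>: "0 < \<eta>" using \<delta>(1) by (simp add: \<eta>_def)
  have B: "S.nbhd {f \<in> G. sup_dist f one < \<delta> / 8}"
    using co_nbhd_ball[of "\<delta> / 8"] \<delta>(1) co by (auto simp: S.nbhd_def co.nbhd_def coarser_topology_def)
  have "\<exists>f\<in>(W3 \<inter> W4) \<inter> {f \<in> G. sup_dist f one < \<delta> / 8}. hell X f < \<eta>"
    by (rule hell_arbitrarily_small[OF S co e0(1) _ S.nbhd_Int[OF S.nbhd_Int[OF W3(1) W4(1)] B] \<eta>])
      (rule e0(2))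
  then obtain f where f: "f \<in> (W3 \<inter> W4) \<inter> {f \<in> G. sup_dist f one < \<delta> / 8}" "hell X f < \<eta>"
    by (elim bexE)
  have fG: "f \<in> G" and fd: "sup_dist f one < \<delta> / 8" and fW: "f \<in> W3" "ginv f \<in> W3"
    using f(1) W4(2) by auto
  have "\<delta> / 4 > 0" using \<delta>(1) by simp
  from p_uniformly_continuous[OF this] obtain d where d: "d > 0"
    "\<forall>s\<in>{0..m}. \<forall>t\<in>{0..m}. \<bar>s - t\<bar> < d \<longrightarrow> dist (p s) (p t) < \<delta> / 4" by metis
  obtain n I where n: "4 \<le> n" "mesh n < d" and I: "I \<subseteq> {1..<n - 1}"
    and R: "measure M (coblock n I) < 4 * \<eta>" and A: "measure M (ginv f ` block n I) < 2 * \<eta>"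
    by (rule singular_block[OF fG f(2) \<eta> d(1)]) (rule that)
  have n0: "0 < n" using n(1) by simp
  have h0: "0 < mesh n" by (rule mesh(1)[OF n0])
  \<comment> \<open>A bound for the slope of \<beta> minus the identity in terms of the parameter,
    small enough to keep rho \<beta> one at most \<delta>/4.\<close>
  define L where "L = min (1/2) (\<delta> / (8 * m))"
  have L: "0 < L" "L \<le> 1/2" "2 * L * m \<le> \<delta> / 4"
  proof -
    show "0 < L" "L \<le> 1/2" using \<delta>(1) m_pos by (auto simp: L_def)
    have "L * (8 * m) \<le> \<delta> / (8 * m) * (8 * m)" using m_pos by (intro mult_right_mono) (auto simp: L_def)
    then show "2 * L * m \<le> \<delta> / 4" using m_pos by simp
  qed
  \<comment> \<open>The admissible displacement of grid points, given the bound L on slopes.\<close>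
  define \<kappa> where "\<kappa> = L * mesh n / (2 * real n)"
  have \<kappa>: "0 < \<kappa>" using L h0 n0 by (simp add: \<kappa>_def)
  have nk: "real n * \<kappa> = L * mesh n / 2" using n0 by (simp add: \<kappa>_def)
  have Lk: "L = real n * (\<kappa> * (2 / mesh n))"
    unfolding mult.assoc[symmetric] nk using h0 by simp
  have nkm: "real n * \<kappa> < mesh n"
  proof -
    have "L * mesh n \<le> 1/2 * mesh n" using L(2) h0 by (intro mult_right_mono) auto
    then show ?thesis using nk h0 by linarith
  qed
  have km: "\<kappa> \<le> mesh n"
  proof -
    have "1 * \<kappa> \<le> real n * \<kappa>" using \<kappa> n0 by (intro mult_right_mono) auto
    then show ?thesis using nkm by linarith
  qed
  obtain e1 where e1: "e1 > 0" "\<forall>h\<in>G. sup_dist h one < e1 \<longrightarrow>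
      (\<forall>i\<in>{1..<n}. \<exists>t. \<bar>t - grid n i\<bar> < \<kappa> \<and> h (p (grid n i)) = p t)"
    using near_identity_moves_grid_little[OF n0 \<kappa> km] by metis
  have "h \<in> W" if hG: "h \<in> G" and he: "sup_dist h one < min e1 (\<delta> / 8)" for h
  proof -
    have "\<forall>i\<in>{1..<n}. \<exists>t. \<bar>t - grid n i\<bar> < \<kappa> \<and> h (p (grid n i)) = p t"
      using e1(2) hG he by simp
    then obtain t where t: "\<And>i. i \<in> {1..<n} \<Longrightarrow> \<bar>t i - grid n i\<bar> < \<kappa> \<and> h (p (grid n i)) = p (t i)"
      by metis
    obtain \<beta> where \<beta>: "\<beta> \<in> G" "\<And>i. i \<in> {1..<n} \<Longrightarrow> \<beta> (p (grid n i)) = p (t i)"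
      "rho \<beta> one \<le> 2 * L * m"
      "\<And>s. 0 \<le> s \<Longrightarrow> s \<le> m \<Longrightarrow> \<exists>s'. 0 \<le> s' \<and> s' \<le> m \<and> \<beta> (p s) = p s' \<and> \<bar>s' - s\<bar> \<le> real n * \<kappa>"
    proof (rule grid_adjustment[OF n0 _ _ Lk])
      show "\<bar>t i - grid n i\<bar> \<le> \<kappa>" if "i \<in> {1..<n}" for i using t[OF that] by simp
      show "0 \<le> \<kappa>" "L < 1" using \<kappa> L by auto
    qed (rule that)
    have \<beta>d: "sup_dist \<beta> one \<le> \<delta> / 4"
    proof (subst sup_dist_le_iff)
      show "\<forall>x\<in>X. dist (\<beta> x) (one x) \<le> \<delta> / 4"
      proof
        fix x assume x: "x \<in> X"
        then have "x \<in> p ` {0..m}" using p_surj by simp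
        then obtain s where s: "s \<in> {0..m}" "x = p s" by (elim imageE)
        obtain s' where s': "0 \<le> s'" "s' \<le> m" "\<beta> (p s) = p s'" "\<bar>s' - s\<bar> \<le> real n * \<kappa>"
          using \<beta>(4)[of s] s(1) by auto
        have "\<bar>s' - s\<bar> < d" using s'(4) nkm n(2) by linarith
        then have "dist (p s') (p s) < \<delta> / 4" using d(2)[rule_format, of s' s] s' s(1) by auto
        then show "dist (\<beta> x) (one x) \<le> \<delta> / 4" using s s'(3) x by simp
      qed
    qed (use \<beta>(1) in auto)
    have \<beta>W: "\<beta> \<in> W3" using \<beta>(1,3) \<beta>d L(3) \<delta>(1) by (intro \<delta>(2)) auto
    define h' where "h' = ginv \<beta> \<odot> h"
    have h'G: "h' \<in> G" using \<beta>(1) hG by (simp add: h'_def)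
    have h'd: "sup_dist h' one < 3 * \<delta> / 8"
    proof -
      have "sup_dist h' one \<le> sup_dist (ginv \<beta>) one + sup_dist h one"
        unfolding h'_def using \<beta>(1) hG by (intro sup_dist_mul_le) auto
      then show ?thesis using sup_dist_ginv[OF \<beta>(1)] \<beta>d he by simp
    qed
    have fixed: "h' (p (grid n j)) = p (grid n j)" if j: "j \<in> {1..<n}" for j
    proof -
      have pX: "p (grid n j) \<in> X" using grid_interior[of j n] j by (intro p_in) auto
      have "h' (p (grid n j)) = ginv \<beta> (\<beta> (p (grid n j)))"
        using t[OF j] \<beta>(1) \<beta>(2)[OF j] hG pX by (simp add: h'_def)
      then show ?thesis using \<beta>(1) pX by simp
    qed
    note bl = block_closed[OF I]
    have inv: "h' ` block n I = block n I" by (rule block_invariant(2)[OF h'G n(1) I fixed])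
    have meet: "h' x = x" if "x \<in> block n I \<inter> coblock n I" for x
      using bl(4)[OF that] fixed by auto
    define u where "u = (\<lambda>x\<in>X. if x \<in> block n I then h' x else x)"
    define b where "b = (\<lambda>x\<in>X. if x \<in> coblock n I then h' x else x)"
    note gf = glue_factorisation[OF h'G bl(1,2,3) inv meet, folded u_def b_def]
    have uG: "u \<in> G" and bG: "b \<in> G" and h'bu: "h' = b \<odot> u" using gf(1-3) by auto
    have Rs: "coblock n I \<in> sets M" "block n I \<in> sets M"
      using bl(1,2,3) by (auto simp: sets_M_iff)
    have bW: "b \<in> W3"
    proof (rule \<delta>(2)[OF bG])
      have "rho b one \<le> 2 * measure M (coblock n I)"
        using gf(4,5) by (intro rho_supported_le[OF bG Rs(1)]) auto
      moreover have "sup_dist b one \<le> 3 * \<delta> / 8"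
      proof (subst sup_dist_le_iff)
        show "\<forall>x\<in>X. dist (b x) (one x) \<le> 3 * \<delta> / 8"
        proof
          fix x assume x: "x \<in> X"
          have "dist (h' x) x \<le> 3 * \<delta> / 8"
            using dist_le_sup_dist[OF h'G, of one x] h'd x by simp
          then show "dist (b x) (one x) \<le> 3 * \<delta> / 8" using x \<delta>(1) by (auto simp: b_def)
        qed
      qed (use bG in auto)
      ultimately show "sup_dist b one + rho b one < \<delta>" using R \<delta>(1) unfolding \<eta>_def by linarith
    qed
    define v where "v = ginv f \<odot> u \<odot> f"
    have vG: "v \<in> G" using fG uG by (simp add: v_def)
    have uv: "u = f \<odot> v \<odot> ginv f"
      using fG uG by (intro G_eqI) (auto simp: v_def G_in)
    let ?A = "ginv f ` block n I"
    have As: "?A \<in> sets M" using fG Rs by (intro G_image_sets) auto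
    have off: "v x = x" if x: "x \<in> X" "f x \<notin> block n I" for x
    proof -
      have "u (f x) = f x" using x G_in[OF fG x(1)] by (simp add: u_def)
      then show ?thesis using x fG uG by (simp add: v_def G_in)
    qed
    have ublock: "u y \<in> block n I" if "y \<in> block n I" for y
    proof -
      have "y \<in> X" using that bl(3) by auto
      then have "u y = h' y" using that by (simp add: u_def)
      then show ?thesis using inv that by (metis image_eqI)
    qed
    have vA: "v ` ?A \<subseteq> ?A"
    proof
      fix z assume "z \<in> v ` ?A"
      then obtain y where y: "y \<in> block n I" "z = v (ginv f y)" by auto
      have yX: "y \<in> X" using y(1) bl(3) by auto
      then have "z = ginv f (u y)" using y(2) fG uG by (simp add: v_def G_in)
      then show "z \<in> ?A" using ublock[OF y(1)] by simp
    qed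
    have "rho v one \<le> 2 * measure M ?A"
    proof (rule rho_supported_le[OF vG As vA])
      fix x assume x: "x \<in> X - ?A"
      have "f x \<notin> block n I"
      proof
        assume "f x \<in> block n I"
        then have "ginv f (f x) \<in> ?A" by simp
        then show False using x fG by simp
      qed
      then show "v x = x" using off x by simp
    qed
    moreover have "sup_dist v one \<le> \<delta> / 2"
    proof (subst sup_dist_le_iff)
      show "\<forall>x\<in>X. dist (v x) (one x) \<le> \<delta> / 2"
      proof
        fix x assume x: "x \<in> X"
        have "dist (v x) x \<le> \<delta> / 2"
        proof (cases "f x \<in> block n I")
          case True
          then obtain i where i: "i \<in> I" "f x \<in> p ` {grid n i..grid n (Suc i)}" by (auto simp: block_def)
          have fx: "f x \<in> X" by (rule G_in[OF fG x])
          have "u (f x) = h' (f x)" using fx True by (simp add: u_def)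
          then have "u (f x) \<in> p ` {grid n i..grid n (Suc i)}"
            using block_invariant(1)[OF h'G n(1) I fixed i(1)] i(2) by (metis image_eqI)
          moreover have "i < n" using subsetD[OF I i(1)] by auto
          ultimately have d1: "dist (u (f x)) (f x) < \<delta> / 4"
            using closed_cell_close[OF d(2) n(2) _ _ i(2)] by blast
          have vx: "v x = ginv f (u (f x))" using x fG uG by (simp add: v_def G_in)
          have vX: "v x \<in> X" by (rule G_in[OF vG x])
          have "f (v x) = u (f x)" using vx fG G_in[OF uG fx] by simp
          then have d2: "dist (u (f x)) (v x) < \<delta> / 8"
            using dist_le_sup_dist[OF fG, of one "v x"] vX fd by simp
          have d3: "dist (f x) x < \<delta> / 8" using dist_le_sup_dist[OF fG, of one x] x fd by simp
          have "dist (v x) x \<le> dist (v x) (u (f x)) + (dist (u (f x)) (f x) + dist (f x) x)"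
            using dist_triangle[of "v x" x "u (f x)"] dist_triangle[of "u (f x)" x "f x"] by linarith
          then show ?thesis using d1 d2 d3 by (simp add: dist_commute)
        next
          case False
          then show ?thesis using off[OF x] \<delta>(1) by simp
        qed
        then show "dist (v x) (one x) \<le> \<delta> / 2" using x by simp
      qed
    qed (use vG in auto)
    ultimately have vW: "v \<in> W3" using A \<delta>(1) unfolding \<eta>_def by (intro \<delta>(2)[OF vG]) linarith
    have sub: "W3 \<subseteq> W2" "W2 \<subseteq> W1"
    proof -
      have "x \<in> W2" if "x \<in> W3" for x
      proof -
        have "x \<odot> one \<in> W2" using W3(2) S.nbhd_one[OF W3(1)] that by blast
        moreover have "x \<in> G" using S.nbhd_subset[OF W3(1)] that by auto
        ultimately show ?thesis using grp.r_one[of x] by simp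
      qed
      then show "W3 \<subseteq> W2" by blast
      have "x \<in> W1" if "x \<in> W2" for x
      proof -
        have "x \<odot> one \<in> W1" using W2(2) S.nbhd_one[OF W2(1)] that by blast
        moreover have "x \<in> G" using S.nbhd_subset[OF W2(1)] that by auto
        ultimately show ?thesis using grp.r_one[of x] by simp
      qed
      then show "W2 \<subseteq> W1" by blast
    qed
    have "f \<odot> v \<in> W2" using W3(2) fW vW by blast
    then have "u \<in> W1" unfolding uv using W2(2) fW sub by blast
    moreover have "\<beta> \<odot> b \<in> W1" using W3(2) \<beta>W bW sub by blast
    ultimately have "(\<beta> \<odot> b) \<odot> u \<in> W" using W1(2) by blast
    moreover have "(\<beta> \<odot> b) \<odot> u = h"
    proof (rule G_eqI)
      fix x assume x: "x \<in> X"
      have "b (u x) = h' x" using h'bu bG uG x by simp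
      moreover have "\<beta> (h' x) = h x" using \<beta>(1) hG x by (simp add: h'_def G_in)
      ultimately show "((\<beta> \<odot> b) \<odot> u) x = h x" using \<beta>(1) bG uG x by (simp add: G_in)
    qed (use \<beta>(1) bG uG hG in auto)
    ultimately show "h \<in> W" by simp
  qed
  then show ?thesis using e1(1) \<delta>(1) by (intro exI[of _ "min e1 (\<delta> / 8)"]) auto
qed

section \<open>The dichotomy\<close>

theorem group_topology_dichotomy:
  assumes S: "group_topology GG S" "Hausdorff_space S" "coarser_topology S tac"
  shows "S = tac \<or> S = tco"
proof -
  interpret S: topological_group GG S by unfold_locales (rule S(1))
  have tg: "topological_group GG S" by (rule S.topological_group_axioms)
  have co: "coarser_topology tco S" by (rule tau_co_coarsest[OF tg S(2)])
  show ?thesis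
  proof (cases "\<exists>e0>0. \<forall>V. S.nbhd V \<longrightarrow> (\<exists>f\<in>V. e0 \<le> rho f one)")
    case True
    then obtain e0 where e0: "e0 > 0" "\<And>V. S.nbhd V \<Longrightarrow> \<exists>f\<in>V. e0 \<le> rho f one" by blast
    have "coarser_topology S tco"
    proof (rule topological_group_coarser[OF tg co.topological_group_axioms])
      fix W assume "S.nbhd W"
      then obtain e where e: "e > 0" "\<forall>h\<in>G. sup_dist h one < e \<longrightarrow> h \<in> W"
        using nbhd_contains_co_ball[OF tg co S(3) e0] by blast
      then show "\<exists>V. co.nbhd V \<and> V \<subseteq> W"
        using co_nbhd_ball[OF e(1)] by (intro exI[of _ "{h \<in> G. sup_dist h one < e}"]) auto
    qed
    then show ?thesis using coarser_topology_antisym[OF _ co] by blast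
  next
    case False
    have "coarser_topology tac S"
    proof (rule topological_group_coarser[OF ac.topological_group_axioms tg])
      fix W assume "ac.nbhd W"
      then obtain e where e: "e > 0" "\<And>h. h \<in> G \<Longrightarrow> sup_dist h one + rho h one < e \<Longrightarrow> h \<in> W"
        by (rule ac_nbhd_contains_ball) (rule that)
      obtain V where V: "S.nbhd V" "\<forall>f\<in>V. rho f one < e / 2"
        using False e(1) by (meson half_gt_zero not_le)
      have B: "S.nbhd {h \<in> G. sup_dist h one < e / 2}"
        using co_nbhd_ball[of "e / 2"] e(1) co by (auto simp: S.nbhd_def co.nbhd_def coarser_topology_def)
      have "V \<inter> {h \<in> G. sup_dist h one < e / 2} \<subseteq> W" using V(2) e(2) by fastforce
      then show "\<exists>V. S.nbhd V \<and> V \<subseteq> W" using S.nbhd_Int[OF V(1) B] by blast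
    qed
    then show ?thesis using coarser_topology_antisym[OF S(3)] by blast
  qed
qed

theorem Hausdorff_group_topologies_below_tau_ac:
  "Hausdorff_group_topologies_below GG tac = {tac, tco}"
proof (intro equalityI subsetI)
  fix S assume "S \<in> Hausdorff_group_topologies_below GG tac"
  then show "S \<in> {tac, tco}"
    using group_topology_dichotomy by (auto simp: Hausdorff_group_topologies_below_def)
next
  fix S assume "S \<in> {tac, tco}"
  then show "S \<in> Hausdorff_group_topologies_below GG tac"
    using group_topology_tau_ac group_topology_tau_co Hausdorff_tau_ac Hausdorff_tau_co coarser_co_ac
    by (auto simp: Hausdorff_group_topologies_below_def coarser_topology_def)
qed

end

section \<open>The interval and the circle\<close>

text \<open>The distribution function of the parameter \<open>T\<close>: it is continuous because points are null sets, and
  strictly increasing because open arcs have positive measure.\<close>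

lemma (in parametrised_space) parameter_cdf:
  assumes pos: "\<And>U. openin (top_of_set X) U \<Longrightarrow> U \<noteq> {} \<Longrightarrow> 0 < emeasure M U"
    and pt: "\<And>x. x \<in> X \<Longrightarrow> emeasure M {x} = 0"
  shows "\<exists>F. continuous_on UNIV F \<and> F 0 = 0 \<and> strict_mono_on {0..m} F \<and>
    (\<forall>t\<in>{0..m}. measure M (p ` {0..t}) = (F t :: real))"
proof -
  define N where "N = distr M borel T"
  have "finite_measure N" unfolding N_def by (rule finite_measure_distr) measurable
  then interpret N: finite_borel_measure N
    by (intro finite_borel_measure.intro) (auto simp: finite_borel_measure_axioms_def N_def)
  have NM: "measure N A = measure M (T -` A \<inter> X)" if "A \<in> sets borel" for A
    using that by (simp add: N_def measure_distr space_M)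
  have null: "measure N {t} = 0" for t
  proof -
    have "T -` {t} \<inter> X \<subseteq> {p t}"
    proof
      fix x assume "x \<in> T -` {t} \<inter> X"
      then have "x \<in> X" "T x = t" by auto
      then show "x \<in> {p t}" using p_T[of x] by simp
    qed
    then have "measure M (T -` {t} \<inter> X) \<le> 0"
    proof (cases "T -` {t} \<inter> X = {}")
      case False
      then have e: "T -` {t} \<inter> X = {p t}" using \<open>T -` {t} \<inter> X \<subseteq> {p t}\<close> by (metis subset_singletonD)
      then have "p t \<in> T -` {t} \<inter> X" by (simp only: insertI1)
      then have "p t \<in> X" by (rule IntD2)
      then show ?thesis by (simp only: e measure_def pt enn2real_0 order_refl)
    qed (simp only: measure_empty order_refl)
    then have "measure M (T -` {t} \<inter> X) = 0" by (simp only: measure_le_0_iff)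
    then show ?thesis by (simp add: NM)
  qed
  have F1: "measure M (p ` {0..t}) = cdf N t" if "0 \<le> t" "t \<le> m" for t
  proof -
    have "T -` {..t} \<inter> X = {x \<in> X. T x \<le> t}" by auto
    also have "\<dots> = p ` {0..t}"
    proof (cases "t < m")
      case True
      then show ?thesis using T_le_set[of t] that by simp
    next
      case False
      then have "t = m" using that by simp
      moreover have "{x \<in> X. T x \<le> m} = X"
      proof (rule Collect_conj_eq[THEN trans])
        have "X \<subseteq> {x. T x \<le> m}" using T_in by (intro subsetI CollectI) auto
        then show "{x. x \<in> X} \<inter> {x. T x \<le> m} = X" by auto
      qed
      ultimately show ?thesis using p_surj by simp
    qed
    finally show ?thesis by (simp add: cdf_def NM)
  qed
  show ?thesis
  proof (intro exI[of _ "cdf N"] conjI ballI strict_mono_onI)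
    show "continuous_on UNIV (cdf N)"
      using N.isCont_cdf null by (auto intro: continuous_at_imp_continuous_on)
    show "measure M (p ` {0..t}) = cdf N t" if "t \<in> {0..m}" for t using F1[of t] that by simp
    show "cdf N 0 = 0"
      using F1[of 0] pt[of "p 0"] p_in[of 0] m_pos by (simp add: measure_def)
    fix s t :: real assume "s \<in> {0..m}" "t \<in> {0..m}" "s < t"
    then have st: "0 \<le> s" "s < t" "t \<le> m" by simp_all
    have sm: "0 \<le> s" "s \<le> t" "t \<le> m" using st by auto
    have "A = X \<inter> - B" if "A \<inter> B = {}" "A \<union> B = X" for A B using that by blast
    from this[OF arc_complement[OF sm]]
    have "p ` {s<..<t} = X \<inter> - p ` ({0..s} \<union> {t..m})" .
    moreover have "open (- p ` ({0..s} \<union> {t..m}))"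
      using sm by (intro open_Compl compact_imp_closed closed_p_image) auto
    ultimately have op: "openin (top_of_set X) (p ` {s<..<t})"
      by (simp only: openin_open_Int)
    have "p ` {s<..<t} \<subseteq> T -` {s<..t} \<inter> X"
    proof
      fix x assume "x \<in> p ` {s<..<t}"
      then obtain u where "u \<in> {s<..<t}" "x = p u" by (elim imageE)
      then show "x \<in> T -` {s<..t} \<inter> X" using T_p[of u] p_in[of u] sm by auto
    qed
    then have "emeasure M (p ` {s<..<t}) \<le> emeasure M (T -` {s<..t} \<inter> X)"
      using measurable_sets[OF T_measurable, of "{s<..t}"] by (intro emeasure_mono) (auto simp: space_M)
    moreover have "0 < emeasure M (p ` {s<..<t})"
      using st by (intro pos op) auto
    ultimately have "0 < measure N {s<..t}" by (simp add: NM emeasure_eq_measure)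
    then show "cdf N s < cdf N t" using N.cdf_diff_eq[OF st(2)] by linarith
  qed
qed

lemma increasing_inverse:
  fixes F :: "real \<Rightarrow> real"
  assumes c: "continuous_on {0..b} F" and b: "0 \<le> b" and F0: "F 0 = 0" and inc: "strict_mono_on {0..b} F"
  shows "\<exists>E. continuous_on {0..F b} E \<and> E 0 = 0 \<and> E (F b) = b \<and>
    (\<forall>t\<in>{0..F b}. E t \<in> {0..b} \<and> F (E t) = t \<and> E ` {0..t} = {0..E t})"
proof -
  note mono = strict_mono_on_less_eq[OF inc]
  have inj: "inj_on F {0..b}"
  proof (rule inj_onI)
    fix s t assume st: "s \<in> {0..b}" "t \<in> {0..b}" "F s = F t"
    then show "s = t" using mono[OF st(1,2)] mono[OF st(2,1)] by simp
  qed
  have img: "F ` {0..b} = {0..F b}"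
  proof (intro equalityI subsetI)
    fix y assume "y \<in> F ` {0..b}"
    then obtain x where x: "y = F x" "x \<in> {0..b}" by (rule imageE)
    then show "y \<in> {0..F b}" using mono[of 0 x] mono[of x b] F0 b by simp
  next
    fix y assume "y \<in> {0..F b}"
    then obtain x where "0 \<le> x" "x \<le> b" "F x = y"
      using IVT'[of F 0 y b] F0 c b by auto
    then show "y \<in> F ` {0..b}" by (intro image_eqI[of _ _ x]) simp_all
  qed
  define E where "E = inv_into {0..b} F"
  have EF: "E (F s) = s" if "s \<in> {0..b}" for s
    unfolding E_def by (rule inv_into_f_f[OF inj that])
  have E01: "E t \<in> {0..b}" if "t \<in> {0..F b}" for t
    unfolding E_def by (rule inv_into_into) (simp only: img that)
  have FE: "F (E t) = t" if "t \<in> {0..F b}" for t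
    unfolding E_def by (rule f_inv_into_f) (simp only: img that)
  have "continuous_on (F ` {0..b}) E"
    by (rule continuous_on_inv[OF c compact_Icc]) (simp add: EF)
  then have Ec: "continuous_on {0..F b} E" by (simp only: img)
  have "E ` {0..t} = {0..E t}" if t: "t \<in> {0..F b}" for t
  proof (intro equalityI subsetI)
    fix x assume "x \<in> E ` {0..t}"
    then obtain s where s: "x = E s" "s \<in> {0..t}" by (rule imageE)
    have s1: "s \<in> {0..F b}" using s t by simp
    then have "E s \<le> E t" using mono[OF E01[OF s1] E01[OF t]] FE[OF s1] FE[OF t] s by simp
    then show "x \<in> {0..E t}" using E01[OF s1] s by simp
  next
    fix x assume x: "x \<in> {0..E t}"
    have x1: "x \<in> {0..b}" using x E01[OF t] by simp
    have "F x \<le> t" using mono[OF x1 E01[OF t]] FE[OF t] x by simp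
    moreover have "0 \<le> F x" using mono[of 0 x] F0 x1 b by simp
    ultimately show "x \<in> E ` {0..t}" by (intro image_eqI[of _ _ "F x"]) (simp_all add: EF[OF x1])
  qed
  moreover have "E 0 = 0" "E (F b) = b" using EF[of 0] EF[of b] F0 b by simp_all
  ultimately show ?thesis using Ec E01 FE by (intro exI[of _ E] conjI ballI) simp_all
qed

text \<open>Reparametrising by the inverse of the distribution function turns the measure of an initial arc into
  its parameter.\<close>

lemma arc_parametrisation_exists:
  assumes q: "parametrised_space X M q b"
    and pos: "\<And>U. openin (top_of_set X) U \<Longrightarrow> U \<noteq> {} \<Longrightarrow> 0 < emeasure M U"
    and pt: "\<And>x. x \<in> X \<Longrightarrow> emeasure M {x} = 0"
  shows "\<exists>p m. arc_space X M p m"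
proof -
  interpret Q: parametrised_space X M q b by (rule q)
  obtain F where F: "continuous_on UNIV F" "F 0 = 0" "strict_mono_on {0..b} F"
    and FM: "\<forall>t\<in>{0..b}. measure M (q ` {0..t}) = F t"
    using Q.parameter_cdf pos pt by metis
  define m where "m = F b"
  have m: "0 < m" using strict_mono_onD[OF F(3), of 0 b] F(2) Q.m_pos by (simp add: m_def)
  have cF: "continuous_on {0..b} F" using F(1) by (rule continuous_on_subset) simp
  obtain E where Ec: "continuous_on {0..m} E" and E0: "E 0 = 0" "E m = b"
    and E: "\<forall>t\<in>{0..m}. E t \<in> {0..b} \<and> F (E t) = t \<and> E ` {0..t} = {0..E t}"
    using increasing_inverse[OF cF less_imp_le[OF Q.m_pos] F(2,3), folded m_def] by (elim exE conjE)
  have E01: "E t \<in> {0..b}" and FE1: "F (E t) = t" and Eimg: "E ` {0..t} = {0..E t}"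
    if "t \<in> {0..m}" for t using bspec[OF E that] by simp_all
  have Fb: "F b = m" by (simp only: m_def)
  have Einj: "inj_on E {0..m}" by (rule inj_on_inverseI[of _ F]) (rule FE1)
  have Eb: "E t \<noteq> b" if t: "t \<in> {0..<m}" for t
  proof
    assume e: "E t = b"
    have "F (E t) = t" using t by (intro FE1) simp
    then show False using t by (simp add: e Fb)
  qed
  have E0': "E t \<noteq> 0" if t: "t \<in> {0<..m}" for t
  proof
    assume e: "E t = 0"
    have "F (E t) = t" using t by (intro FE1) simp
    then show False using t by (simp add: e F(2))
  qed
  have im: "(\<lambda>t. q (E t)) ` A = q ` E ` A" for A by (simp only: image_image)
  have "arc_space X M (\<lambda>t. q (E t)) m"
  proof (intro arc_space.intro parametrised_space.intro parametrised_space_axioms.intro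
      arc_space_axioms.intro Q.compact_measure_axioms)
    show "0 < m" by (rule m)
    show "continuous_on {0..m} (\<lambda>t. q (E t))"
      by (rule continuous_on_compose2[OF Q.p_continuous Ec]) (use E01 in \<open>intro image_subsetI\<close>)
    show "(\<lambda>t. q (E t)) ` {0..m} = X"
      using Eimg[of m] m E0 Q.p_surj by (simp add: im)
    show "inj_on (\<lambda>t. q (E t)) {0..<m}"
    proof (rule inj_onI)
      fix s t assume st: "s \<in> {0..<m}" "t \<in> {0..<m}" "q (E s) = q (E t)"
      have "E s \<in> {0..<b}" "E t \<in> {0..<b}"
        using E01[of s] E01[of t] Eb[OF st(1)] Eb[OF st(2)] st by simp_all
      then have "E s = E t" using inj_onD[OF Q.p_inj st(3)] by simp
      then show "s = t" using inj_onD[OF Einj] st by simp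
    qed
    show "inj_on (\<lambda>t. q (E t)) {0<..m}"
    proof (rule inj_onI)
      fix s t assume st: "s \<in> {0<..m}" "t \<in> {0<..m}" "q (E s) = q (E t)"
      have "E s \<in> {0<..b}" "E t \<in> {0<..b}"
        using E01[of s] E01[of t] E0'[OF st(1)] E0'[OF st(2)] st by simp_all
      then have "E s = E t" using inj_onD[OF Q.p_inj' st(3)] by simp
      then show "s = t" using inj_onD[OF Einj] st by simp
    qed
    fix t assume t: "0 \<le> t" "t \<le> m"
    have "(\<lambda>t. q (E t)) ` {0..t} = q ` {0..E t}"
      using Eimg[of t] t by (simp add: im)
    then show "measure M ((\<lambda>t. q (E t)) ` {0..t}) = t"
      using bspec[OF FM, of "E t"] E01[of t] FE1[of t] t by simp
  qed
  then show ?thesis by blast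
qed

lemma OU_pair_compact_measure:
  fixes X :: "'a::euclidean_space set"
  assumes OU: "OU_pair (top_of_set X) M" and X: "compact X" "X \<noteq> {}"
  shows "compact_measure X M"
proof (rule compact_measure.intro)
  show "compact X" "X \<noteq> {}" by fact+
  show "finite_measure M" using OU by (simp add: OU_pair_def)
  have "{U. openin (top_of_set X) U} = (\<inter>) X ` {S. open S}"
    by (auto simp: openin_open)
  then have "sets M = sigma_sets X ((\<inter>) X ` {S. open S})"
    using OU by (simp add: OU_pair_def)
  also have "\<dots> = (\<inter>) X ` sigma_sets UNIV {S. open S}"
  proof (rule sigma_sets_Int[symmetric])
    show "X \<in> sigma_sets UNIV {S. open S}"
      using borel_compact[OF X(1)] by (simp add: borel_def)
  qed simp
  also have "\<dots> = sets (restrict_space borel X)"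
    by (simp add: sets_restrict_space borel_def)
  finally show "sets M = sets (restrict_space borel X)" .
qed

lemma OU_pair_Hausdorff_group_topologies:
  fixes X :: "'a::euclidean_space set"
  assumes OU: "OU_pair (top_of_set X) M"
    and q: "continuous_on {0..1} q" "q ` {0..1} = X" "inj_on q {0..<1}" "inj_on q {0<..1::real}"
  shows "Hausdorff_group_topologies_below (homeo_bac_group (top_of_set X) M) (tau_ac (top_of_set X) M)
    = {tau_ac (top_of_set X) M, tau_co (top_of_set X) M}"
proof -
  have X: "compact X" "X \<noteq> {}"
    using compact_continuous_image[OF q(1)] q(2) by auto
  interpret compact_measure X M by (rule OU_pair_compact_measure[OF OU X])
  have "parametrised_space X M q 1"
    by unfold_locales (use q in auto)
  then obtain p m where "arc_space X M p m"
    using arc_parametrisation_exists[of X M q 1] OU by (auto simp: OU_pair_def)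
  then show ?thesis by (rule arc_space.Hausdorff_group_topologies_below_tau_ac)
qed

lemma circle_parametrisation:
  defines "q \<equiv> \<lambda>t. cis (2 * pi * t)"
  shows "continuous_on {0..1} q" "q ` {0..1} = sphere 0 1" "inj_on q {0..<1}" "inj_on q {0<..1}"
proof -
  show "continuous_on {0..1} q" unfolding q_def by (intro continuous_intros)
  have eq: "\<exists>k::int. s - t = of_int k" if "q s = q t" for s t
  proof -
    have "exp (\<i> * of_real (2 * pi * s)) = exp (\<i> * of_real (2 * pi * t))"
      using that by (simp add: q_def cis_conv_exp)
    then obtain k :: int where "\<i> * of_real (2 * pi * s) = \<i> * of_real (2 * pi * t) + (of_int (2 * k) * pi) * \<i>"
      by (auto simp: exp_eq)
    then have "2 * pi * s = 2 * pi * t + 2 * pi * k"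
      by (simp add: complex_eq_iff)
    then have "2 * pi * (s - t - k) = 0" by (simp add: algebra_simps)
    then show ?thesis by (intro exI[of _ k]) simp
  qed
  have int0: "s = t" if st: "q s = q t" "\<bar>s - t\<bar> < 1" for s t
  proof -
    obtain k :: int where k: "s - t = of_int k" using eq[OF st(1)] by blast
    then have "\<bar>real_of_int k\<bar> < 1" using st(2) by simp
    then have "k = 0" by linarith
    then show ?thesis using k by simp
  qed
  show "inj_on q {0..<1}" by (intro inj_onI int0) (auto simp: abs_less_iff)
  show "inj_on q {0<..1}" by (intro inj_onI int0) (auto simp: abs_less_iff)
  show "q ` {0..1} = sphere 0 1"
  proof
    show "q ` {0..1} \<subseteq> sphere 0 1" by (auto simp: q_def)
    show "sphere 0 1 \<subseteq> q ` {0..1}"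
    proof
      fix z :: complex assume "z \<in> sphere 0 1"
      then have z: "z = cis (Arg2pi z)" "0 \<le> Arg2pi z" "Arg2pi z < 2 * pi"
        using Arg2pi[of z] by (auto simp: is_Arg_def cis_conv_exp)
      have "z = q (Arg2pi z / (2 * pi))" using z(1) by (simp add: q_def)
      moreover have "Arg2pi z / (2 * pi) \<in> {0..1}" using z by simp
      ultimately show "z \<in> q ` {0..1}" by (rule image_eqI)
    qed
  qed
qed

theorem corollary3:
  shows "(\<forall>\<mu> :: real measure. OU_pair (top_of_set {0..1}) \<mu> \<longrightarrow>
            Hausdorff_group_topologies_below
              (homeo_bac_group (top_of_set {0..1}) \<mu>) (tau_ac (top_of_set {0..1}) \<mu>)
            = {tau_ac (top_of_set {0..1}) \<mu>, tau_co (top_of_set {0..1}) \<mu>})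
       \<and> (\<forall>\<mu> :: complex measure. OU_pair (top_of_set (sphere 0 1)) \<mu> \<longrightarrow>
            Hausdorff_group_topologies_below
              (homeo_bac_group (top_of_set (sphere 0 1)) \<mu>) (tau_ac (top_of_set (sphere 0 1)) \<mu>)
            = {tau_ac (top_of_set (sphere 0 1)) \<mu>, tau_co (top_of_set (sphere 0 1)) \<mu>})"
proof (intro conjI allI impI)
  fix \<mu> :: "real measure"
  assume "OU_pair (top_of_set {0..1}) \<mu>"
  then show "Hausdorff_group_topologies_below
      (homeo_bac_group (top_of_set {0..1}) \<mu>) (tau_ac (top_of_set {0..1}) \<mu>)
    = {tau_ac (top_of_set {0..1}) \<mu>, tau_co (top_of_set {0..1}) \<mu>}"
    by (rule OU_pair_Hausdorff_group_topologies[where q="\<lambda>t. t"]) auto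
next
  fix \<mu> :: "complex measure"
  assume "OU_pair (top_of_set (sphere 0 1)) \<mu>"
  then show "Hausdorff_group_topologies_below
      (homeo_bac_group (top_of_set (sphere 0 1)) \<mu>) (tau_ac (top_of_set (sphere 0 1)) \<mu>)
    = {tau_ac (top_of_set (sphere 0 1)) \<mu>, tau_co (top_of_set (sphere 0 1)) \<mu>}"
    by (rule OU_pair_Hausdorff_group_topologies[OF _ circle_parametrisation])
qed

end
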